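(* Consider the blackboard model with $s$ machines, where machine $i\in[s]$ holds an oracle returning a subgradient (represented with $L$ bits in fixed-point arithmetic) of a function $f_i:\mathbb{R}^d\to\mathbb{R}$. Suppose each $f_i$ is convex, $\mu$-Lipschitz, and depends on only $d_i$ coordinates of its argument. Let $\theta^\star:=\arg\min_{\theta\in\mathbb{R}^d}\sum_{i=1}^s f_i(\theta)$, and suppose we know $\theta^{(0)}\in\mathbb{R}^d$ with $\|\theta^\star-\theta^{(0)}\|_2\le D$. Given $\epsilon>0$, there is an algorithm that outputs $\theta\in\mathbb{R}^d$ with $$\sum_{i=1}^s f_i(\theta)\le\sum_{i=1}^s f_i(\theta^\star)+\epsilon\mu D,$$ using $O\big(\sum_{i=1}^s d_i^2\log(sd\epsilon^{-1})\cdot L\big)$ bits of communication, where $L=O(\log d)$ is the word length. At the end of the algorithm all servers hold this solution.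
   Context: Blackboard model: there are $s$ machines and a blackboard (coordinator); machines may write to and read from the blackboard, and only bits written (sent) to the blackboard count toward the communication. A number is represented with $L$ bits in fixed-point arithmetic if it has at most $L$ bits before and after the binary point. *)

theory Defs
  imports "HOL-Analysis.Analysis"
begin

section \<open>Functions on $d$-dimensional space\<close>

text \<open>The constant hidden in the communication bound is uniform in the dimension, so \<open>d\<close> has to be a
  term and cannot be a type. Vectors are functions \<open>nat \<Rightarrow> real\<close> with coordinates indexed by \<open>{..<d}\<close>,
  and the points of the $d$-dimensional space are the library's
  \<open>topspace (Euclidean_space d) = {x. \<forall>i\<ge>d. x i = 0}\<close>. Functions \<open>f\<close> are only constrained on these
  points.\<close>

type_synonym vec = "nat \<Rightarrow> real"

abbreviation Rn :: "nat \<Rightarrow> vec set" where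
  "Rn d \<equiv> topspace (Euclidean_space d)"

definition dist2 :: "nat \<Rightarrow> vec \<Rightarrow> vec \<Rightarrow> real" where
  "dist2 d x y = L2_set (\<lambda>j. x j - y j) {..<d}"

definition convex_fun :: "nat \<Rightarrow> (vec \<Rightarrow> real) \<Rightarrow> bool" where
  "convex_fun d f \<longleftrightarrow>
     (\<forall>x\<in>Rn d. \<forall>y\<in>Rn d. \<forall>t\<in>{0..1}. f (\<lambda>j. (1 - t) * x j + t * y j) \<le> (1 - t) * f x + t * f y)"

definition lipschitz_fun :: "nat \<Rightarrow> real \<Rightarrow> (vec \<Rightarrow> real) \<Rightarrow> bool" where
  "lipschitz_fun d \<mu> f \<longleftrightarrow>
     0 \<le> \<mu> \<and> (\<forall>x\<in>Rn d. \<forall>y\<in>Rn d. \<bar>f x - f y\<bar> \<le> \<mu> * dist2 d x y)"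

definition depends_on :: "nat \<Rightarrow> nat set \<Rightarrow> (vec \<Rightarrow> real) \<Rightarrow> bool" where
  "depends_on d S f \<longleftrightarrow>
     (\<forall>x\<in>Rn d. \<forall>y\<in>Rn d. (\<forall>j\<in>S. x j = y j) \<longrightarrow> f x = f y)"

definition subgradient :: "nat \<Rightarrow> (vec \<Rightarrow> real) \<Rightarrow> vec \<Rightarrow> vec \<Rightarrow> bool" where
  "subgradient d f x v \<longleftrightarrow> v \<in> Rn d \<and> (\<forall>y\<in>Rn d. f y \<ge> f x + (\<Sum>j<d. v j * (y j - x j)))"

text \<open>A sign, at most \<open>L\<close> bits before and at most \<open>L\<close> bits after the binary point.\<close>

definition fixed_point :: "nat \<Rightarrow> real \<Rightarrow> bool" where
  "fixed_point L r \<longleftrightarrow> r * 2 ^ L \<in> \<int> \<and> \<bar>r\<bar> < 2 ^ L"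

definition subgradient_oracle :: "nat \<Rightarrow> nat \<Rightarrow> (vec \<Rightarrow> real) \<Rightarrow> (vec \<Rightarrow> vec) \<Rightarrow> bool" where
  "subgradient_oracle d L f g \<longleftrightarrow>
     (\<forall>x\<in>Rn d. subgradient d f x (g x) \<and> (\<forall>j<d. fixed_point L (g x j)))"

section \<open>The blackboard model\<close>

text \<open>A local computation with oracle access. Being an inductive datatype, it makes only finitely
  many (adaptive) queries on every run.\<close>

datatype 'r oracle_prog = Return 'r | Query vec "vec \<Rightarrow> 'r oracle_prog"

primrec run :: "(vec \<Rightarrow> vec) \<Rightarrow> 'r oracle_prog \<Rightarrow> 'r" where
  "run g (Return r) = r"
| "run g (Query x k) = run g (k (g x))"

text \<open>The content of the blackboard, that is, the list of all bits written so far, determines which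
  machine writes the next bit (\<open>None\<close>: the protocol stops). That bit is computed by this machine from
  the blackboard and its own oracle. Neither the choice of the speaker nor the boundaries between
  messages carry information beyond the bits on the blackboard. The coordinator has no input, so
  whatever it could write is already a function of the blackboard. Local computation, oracle queries
  and reading are free; a machine needs no memory because it can repeat its queries.\<close>

record protocol =
  speaker :: "bool list \<Rightarrow> nat option"
  next_bit :: "nat \<Rightarrow> bool list \<Rightarrow> bool oracle_prog"
  result :: "nat \<Rightarrow> bool list \<Rightarrow> vec oracle_prog"

definition is_protocol :: "nat \<Rightarrow> protocol \<Rightarrow> bool" where
  "is_protocol s P \<longleftrightarrow> (\<forall>b i. speaker P b = Some i \<longrightarrow> i < s)"

inductive blackboard :: "protocol \<Rightarrow> (nat \<Rightarrow> vec \<Rightarrow> vec) \<Rightarrow> bool list \<Rightarrow> bool"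
  for P :: protocol and g :: "nat \<Rightarrow> vec \<Rightarrow> vec" where
  blank: "blackboard P g []"
| write_bit: "blackboard P g b \<Longrightarrow> speaker P b = Some i \<Longrightarrow> blackboard P g (b @ [run (g i) (next_bit P i b)])"

definition final_blackboard :: "protocol \<Rightarrow> (nat \<Rightarrow> vec \<Rightarrow> vec) \<Rightarrow> bool list \<Rightarrow> bool" where
  "final_blackboard P g b \<longleftrightarrow> blackboard P g b \<and> speaker P b = None"

end

theory Submission
  imports Defs
begin

text \<open>Every machine \<open>i\<close> keeps two public outer approximations: a body \<open>P i\<close> around the epigraph of its
  function and a body \<open>J i\<close> around the epigraph of the convex conjugate, both in dimension
  \<open>dims i + 1\<close>. On each body one considers the density proportional to \<open>exp (\<theta> \<bullet> u)\<close>. The tilts \<open>\<theta>\<close>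
  are chosen to minimize the sum of the logarithms of the total masses, machine \<open>i\<close> counted with weight
  \<open>w i = dims i\<close>: on the primal side over multipliers that sum to zero, on the dual side over points
  \<open>x\<close> of a cube, both scaled with an inverse temperature \<open>t\<close>. First-order optimality says that the primal
  centres agree on common coordinates and that the dual centres sum to zero, up to the constraint
  that \<open>x\<close> stays in the cube.

  If for some \<open>i\<close> the primal centre \<open>(p, z)\<close> and the dual centre \<open>(q, \<tau>)\<close> satisfy
  \<open>z + \<tau> < p \<bullet> q\<close>, machine \<open>i\<close> is asked whether its function is at most \<open>z\<close> at \<open>p\<close>. The answer yes cuts
  \<open>J i\<close> through its centre at the price of one bit; the answer no comes with a subgradient of
  \<open>dims i\<close> numbers and cuts \<open>P i\<close> through its centre. As log-concave densities lose a constant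
  fraction of their mass, the potential drops by a constant times \<open>dims i\<close>, that is, in proportion to
  the bits written. If there is no such \<open>i\<close>, doubling \<open>t\<close> raises the potential by only
  \<open>O(\<Sum>i. dims i ^ 2)\<close>, and the dual minimizer \<open>x\<close> has error \<open>O(\<Sum>i. dims i ^ 2) / t\<close>. Since the potential
  is bounded below, the number of bits is \<open>O(\<Sum>i. dims i ^ 2 * L)\<close> times a logarithm.

  A machine never needs its function exactly: it works with the maximum of finitely many tangents at the
  points of a fine finite net, whose subgradients are again fixed-point vectors.\<close>

section \<open>The Prekopa--Leindler inequality for midpoints\<close>

text \<open>The obstacle is that a step may cost only the dimension of the machine that speaks,
  although progress is measured for all machines jointly. Weighting the logarithms with
  \<open>w i\<close> makes a cut at machine \<open>i\<close> worth a constant times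
  \<open>w i\<close>, which matches the price of its message. Two bodies are needed because the two
  answers to a comparison inform about different objects: a point known to lie in the epigraph is a
  halfspace for the conjugate, whereas a point known to lie below the graph, together with a slope,
  is a halfspace for the epigraph. The coupling between machines uses only public bodies and hence
  costs nothing.

  Two things are not given and have to be produced. The oracles return slopes but no values, so a
  function is rebuilt, up to an additive constant, by summing slopes along segments. The relevant
  coordinates are private, so each machine first announces those coordinates that occur in its
  slopes on the net.\<close>

lemma midpoint_measure_1d:
  fixes A B C :: "real set"
  assumes m: "A \<in> sets lborel" "B \<in> sets lborel" "C \<in> sets lborel"
    and ne: "A \<noteq> {}" "B \<noteq> {}"
    and bd: "A \<subseteq> {-R..R}" "B \<subseteq> {-R..R}"
    and mid: "\<And>a b. a \<in> A \<Longrightarrow> b \<in> B \<Longrightarrow> (a + b) / 2 \<in> C"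
  shows "emeasure lborel A + emeasure lborel B \<le> 2 * emeasure lborel C"
proof (rule ennreal_le_epsilon)
  fix e :: real assume e: "0 < e"
  have bA: "bdd_above A" using bd by (meson bdd_above_Icc bdd_above_mono)
  have bB: "bdd_below B" using bd by (meson bdd_below_Icc bdd_below_mono)
  obtain a where a: "a \<in> A" "Sup A - e/2 < a" using less_cSup_iff[OF ne(1) bA, of "Sup A - e/2"] e by auto
  obtain b where b: "b \<in> B" "b < Inf B + e/2" using cInf_less_iff[OF ne(2) bB, of "Inf B + e/2"] e by auto
  \<comment> \<open>With \<open>a\<close> close to the top of \<open>A\<close> and \<open>b\<close>
    close to the bottom of \<open>B\<close>, the midpoints of \<open>?A\<close> with
    \<open>b\<close> lie below \<open>(a + b) / 2\<close>, those of \<open>a\<close> with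
    \<open>?B\<close> lie at or above it. So \<open>C\<close> contains disjoint half-size copies of
    both sets.\<close>
  let ?A = "A \<inter> {..<a}" and ?B = "B \<inter> {b..}"
  let ?f = "\<lambda>x::real. (x + b)/2" and ?g = "\<lambda>x::real. (x + a)/2"
  have mA: "emeasure lborel A \<le> emeasure lborel ?A + ennreal (e/2)"
  proof -
    have "A \<subseteq> ?A \<union> {a..a+e/2}" using a cSup_upper[OF _ bA] by fastforce
    then have "emeasure lborel A \<le> emeasure lborel (?A \<union> {a..a+e/2})" using m by (intro emeasure_mono) auto
    also have "\<dots> \<le> emeasure lborel ?A + emeasure lborel {a..a+e/2}" using m by (intro emeasure_subadditive) auto
    finally show ?thesis using e by simp
  qed
  have mB: "emeasure lborel B \<le> emeasure lborel ?B + ennreal (e/2)"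
  proof -
    have "B \<subseteq> ?B \<union> {b-e/2..b}" using b cInf_lower[OF _ bB] by fastforce
    then have "emeasure lborel B \<le> emeasure lborel (?B \<union> {b-e/2..b})" using m by (intro emeasure_mono) auto
    also have "\<dots> \<le> emeasure lborel ?B + emeasure lborel {b-e/2..b}" using m by (intro emeasure_subadditive) auto
    finally show ?thesis using e by simp
  qed
  define P where "P = {y. 2 * y - b \<in> ?A}"
  define Q where "Q = {y. 2 * y - a \<in> ?B}"
  have aff: "emeasure lborel S = 2 * emeasure lborel {y. 2 * y - c \<in> S}" if "S \<in> sets lborel" for S and c :: real
  proof -
    have "emeasure lborel S = (\<integral>\<^sup>+x. indicator S x \<partial>lborel)" using that by simp
    also have "\<dots> = ennreal \<bar>2\<bar> * (\<integral>\<^sup>+x. indicator S (-c + 2 * x) \<partial>lborel)"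
      using that by (intro nn_integral_real_affine) auto
    also have "(\<lambda>x. indicator S (-c + 2 * x) :: ennreal) = indicator {y. 2 * y - c \<in> S}"
      by (auto simp: fun_eq_iff split: split_indicator)
    also have "(\<integral>\<^sup>+x. indicator {y. 2 * y - c \<in> S} x \<partial>lborel) = emeasure lborel {y. 2 * y - c \<in> S}"
    proof (rule nn_integral_indicator)
      have "(\<lambda>y. 2 * y - c) -` S \<inter> space borel \<in> sets borel"
        using that by (intro measurable_sets[of _ borel borel]) auto
      then show "{y. 2 * y - c \<in> S} \<in> sets lborel" by (simp add: vimage_def)
    qed
    finally show ?thesis by simp
  qed
  have sP: "P \<in> sets lborel" "Q \<in> sets lborel"
  proof -
    have "(\<lambda>y. 2 * y - b) -` ?A \<inter> space borel \<in> sets borel"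
      using m by (intro measurable_sets[of _ borel borel]) auto
    then show "P \<in> sets lborel" by (simp add: vimage_def P_def)
    have "(\<lambda>y. 2 * y - a) -` ?B \<inter> space borel \<in> sets borel"
      using m by (intro measurable_sets[of _ borel borel]) auto
    then show "Q \<in> sets lborel" by (simp add: vimage_def Q_def)
  qed
  have sub: "P \<union> Q \<subseteq> C"
  proof
    fix y assume "y \<in> P \<union> Q"
    then show "y \<in> C"
      using mid[OF _ b(1), of "2 * y - b"] mid[OF a(1), of "2 * y - a"] by (auto simp: P_def Q_def)
  qed
  have dis: "P \<inter> Q = {}" by (auto simp: P_def Q_def)
  have "emeasure lborel ?A + emeasure lborel ?B = 2 * (emeasure lborel P + emeasure lborel Q)"
    using aff[of ?A b] aff[of ?B a] m by (simp add: P_def Q_def distrib_left)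
  also have "emeasure lborel P + emeasure lborel Q = emeasure lborel (P \<union> Q)"
    using sP dis by (intro plus_emeasure) auto
  also have "2 * \<dots> \<le> 2 * emeasure lborel C" using sub m by (intro mult_left_mono emeasure_mono) auto
  finally have 1: "emeasure lborel ?A + emeasure lborel ?B \<le> 2 * emeasure lborel C" .
  have "emeasure lborel A + emeasure lborel B \<le> (emeasure lborel ?A + ennreal (e/2)) + (emeasure lborel ?B + ennreal (e/2))"
    using mA mB by (rule add_mono)
  also have "\<dots> = (emeasure lborel ?A + emeasure lborel ?B) + (ennreal (e/2) + ennreal (e/2))" by (simp add: ac_simps)
  also have "ennreal (e/2) + ennreal (e/2) = ennreal e" using e by (simp flip: ennreal_plus)
  also have "(emeasure lborel ?A + emeasure lborel ?B) + ennreal e \<le> 2 * emeasure lborel C + ennreal e"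
    using 1 by (rule add_right_mono)
  finally show "emeasure lborel A + emeasure lborel B \<le> 2 * emeasure lborel C + ennreal e" .
qed

text \<open>The layer-cake formula, by Tonelli for the region under the graph.\<close>

lemma nn_integral_layers:
  fixes f :: "real \<Rightarrow> real"
  assumes [measurable]: "f \<in> borel_measurable borel" and nn: "\<And>x. 0 \<le> f x"
  shows "(\<integral>\<^sup>+x. ennreal (f x) \<partial>lborel) = (\<integral>\<^sup>+l. indicator {0<..} l * emeasure lborel {x. l < f x} \<partial>lborel)"
proof -
  have *: "ennreal (f x) = (\<integral>\<^sup>+l. indicator {0<..} l * indicator {x. l < f x} x \<partial>lborel)" for x
  proof -
    have "(\<integral>\<^sup>+l. indicator {0<..} l * indicator {x. l < f x} x \<partial>lborel) = (\<integral>\<^sup>+l. indicator {0<..<f x} l \<partial>lborel)"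
      by (intro nn_integral_cong) (auto split: split_indicator)
    also have "\<dots> = ennreal (f x)" using nn[of x] by simp
    finally show ?thesis by simp
  qed
  have "(\<integral>\<^sup>+x. ennreal (f x) \<partial>lborel) = (\<integral>\<^sup>+x. \<integral>\<^sup>+l. indicator {0<..} l * indicator {x. l < f x} x \<partial>lborel \<partial>lborel)"
    by (simp add: *)
  also have "\<dots> = (\<integral>\<^sup>+l. \<integral>\<^sup>+x. indicator {0<..} l * indicator {x. l < f x} x \<partial>lborel \<partial>lborel)"
  proof (rule lborel_pair.Fubini')
    show "(\<lambda>(l, x). indicator {0<..} l * indicator {x. l < f x} x :: ennreal) \<in> borel_measurable (lborel \<Otimes>\<^sub>M lborel)"
    proof -
      have "(\<lambda>z. indicator {z. 0 < fst z \<and> fst z < f (snd z)} z :: ennreal) \<in> borel_measurable (lborel \<Otimes>\<^sub>M lborel)"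
        by measurable
      also have "(\<lambda>z. indicator {z. 0 < fst z \<and> fst z < f (snd z)} z :: ennreal) = (\<lambda>(l, x). indicator {0<..} l * indicator {x. l < f x} x)"
        by (auto simp: fun_eq_iff split: split_indicator)
      finally show ?thesis .
    qed
  qed
  also have "\<dots> = (\<integral>\<^sup>+l. indicator {0<..} l * emeasure lborel {x. l < f x} \<partial>lborel)"
    by (intro nn_integral_cong) (simp add: nn_integral_cmult)
  finally show ?thesis .
qed

text \<open>The level sets of \<open>f\<close>, \<open>g\<close>, \<open>h\<close> satisfy the one-dimensional Brunn--Minkowski inequality once
  \<open>f\<close> and \<open>g\<close> are scaled to have the same supremum 1.\<close>

lemma prekopa_leindler_1d_normalized:
  fixes f g h :: "real \<Rightarrow> real"
  assumes [measurable]: "f \<in> borel_measurable borel" "g \<in> borel_measurable borel" "h \<in> borel_measurable borel"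
    and nn: "\<And>x. 0 \<le> f x" "\<And>x. 0 \<le> g x" "\<And>x. 0 \<le> h x"
    and sf: "\<And>x. f x \<le> 1" "\<And>l. l < 1 \<Longrightarrow> \<exists>x. l < f x"
    and sg: "\<And>x. g x \<le> 1" "\<And>l. l < 1 \<Longrightarrow> \<exists>x. l < g x"
    and bd: "\<And>x. f x \<noteq> 0 \<Longrightarrow> \<bar>x\<bar> \<le> R" "\<And>x. g x \<noteq> 0 \<Longrightarrow> \<bar>x\<bar> \<le> R"
    and mid: "\<And>x y. f x * g y \<le> (h ((x + y)/2))\<^sup>2"
  shows "(\<integral>\<^sup>+x. ennreal (f x) \<partial>lborel) + (\<integral>\<^sup>+x. ennreal (g x) \<partial>lborel) \<le> 2 * (\<integral>\<^sup>+x. ennreal (h x) \<partial>lborel)"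
proof -
  have "(\<integral>\<^sup>+x. ennreal (f x) \<partial>lborel) + (\<integral>\<^sup>+x. ennreal (g x) \<partial>lborel)
    = (\<integral>\<^sup>+l. indicator {0<..} l * emeasure lborel {x. l < f x} + indicator {0<..} l * emeasure lborel {x. l < g x} \<partial>lborel)"
    unfolding nn_integral_layers[OF assms(1) nn(1)] nn_integral_layers[OF assms(2) nn(2)]
    by (subst nn_integral_add) auto
  also have "\<dots> \<le> (\<integral>\<^sup>+l. 2 * (indicator {0<..} l * emeasure lborel {x. l < h x}) \<partial>lborel)"
  proof (rule nn_integral_mono)
    fix l :: real
    show "indicator {0<..} l * emeasure lborel {x. l < f x} + indicator {0<..} l * emeasure lborel {x. l < g x}
      \<le> 2 * (indicator {0<..} l * emeasure lborel {x. l < h x})"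
    proof (cases "0 < l \<and> l < 1")
      case True
      have "emeasure lborel {x. l < f x} + emeasure lborel {x. l < g x} \<le> 2 * emeasure lborel {x. l < h x}"
      proof (rule midpoint_measure_1d)
        show "{x. l < f x} \<noteq> {}" "{x. l < g x} \<noteq> {}" using sf(2)[of l] sg(2)[of l] True by auto
        have "\<bar>x\<bar> \<le> R" if "l < f x" for x using bd(1)[of x] that True by auto
        then show "{x. l < f x} \<subseteq> {-R..R}" by (fastforce simp: abs_le_iff)
        have "\<bar>x\<bar> \<le> R" if "l < g x" for x using bd(2)[of x] that True by auto
        then show "{x. l < g x} \<subseteq> {-R..R}" by (fastforce simp: abs_le_iff)
        show "(a + b)/2 \<in> {x. l < h x}" if "a \<in> {x. l < f x}" "b \<in> {x. l < g x}" for a b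
        proof -
          have "l\<^sup>2 < f a * g b" using that True unfolding power2_eq_square by (intro mult_strict_mono) auto
          also note mid
          finally show ?thesis using True nn(3) power2_less_imp_less by blast
        qed
      qed measurable
      then show ?thesis using True by simp
    next
      case False
      then consider "l \<le> 0" | "l \<ge> 1" by linarith
      then show ?thesis
      proof cases
        case 2
        then have "{x. l < f x} = {}" "{x. l < g x} = {}" using sf(1) sg(1) by (auto simp: not_less intro: order_trans)
        then show ?thesis by (simp del: Collect_empty_eq)
      qed simp
    qed
  qed
  also have "\<dots> = 2 * (\<integral>\<^sup>+x. ennreal (h x) \<partial>lborel)"
    unfolding nn_integral_layers[OF assms(3) nn(3)] by (subst nn_integral_cmult) auto
  finally show ?thesis .
qed

text \<open>Dividing \<open>f\<close> and \<open>g\<close> by their suprema and \<open>h\<close> by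
  the geometric mean of these suprema reduces to the normalized case; the inequality of arithmetic
  and geometric means then turns the sum of integrals into a product. Values lie in
  \<open>ennreal\<close> because the induction on coordinates inserts slice integrals.\<close>

lemma prekopa_leindler_1d:
  fixes f g h :: "real \<Rightarrow> ennreal"
  assumes [measurable]: "f \<in> borel_measurable borel" "g \<in> borel_measurable borel" "h \<in> borel_measurable borel"
    and fin: "\<And>x. f x \<le> ennreal c" "\<And>x. g x \<le> ennreal c" "\<And>x. h x < \<infinity>"
    and bd: "\<And>x. f x \<noteq> 0 \<Longrightarrow> \<bar>x\<bar> \<le> R" "\<And>x. g x \<noteq> 0 \<Longrightarrow> \<bar>x\<bar> \<le> R"
    and mid: "\<And>x y. f x * g y \<le> (h ((x + y)/2))\<^sup>2"
  shows "(\<integral>\<^sup>+x. f x \<partial>lborel) * (\<integral>\<^sup>+x. g x \<partial>lborel) \<le> (\<integral>\<^sup>+x. h x \<partial>lborel)\<^sup>2"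
proof (cases "(\<forall>x. f x = 0) \<or> (\<forall>x. g x = 0)")
  case True
  then show ?thesis by auto
next
  case False
  define f' where "f' = (\<lambda>x. enn2real (f x))"
  define g' where "g' = (\<lambda>x. enn2real (g x))"
  define h' where "h' = (\<lambda>x. enn2real (h x))"
  have fi: "f x = ennreal (f' x)" "g x = ennreal (g' x)" "h x = ennreal (h' x)" for x
    using fin[of x] by (auto simp: f'_def g'_def h'_def top_unique less_top intro!: ennreal_enn2real[symmetric]
        dest: order_le_less_trans[OF _ ennreal_less_top])
  have [measurable]: "f' \<in> borel_measurable borel" "g' \<in> borel_measurable borel" "h' \<in> borel_measurable borel"
    unfolding f'_def g'_def h'_def by measurable
  have nn: "0 \<le> f' x" "0 \<le> g' x" "0 \<le> h' x" for x by (auto simp: f'_def g'_def h'_def)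
  obtain x0 y0 where xy: "f x0 \<noteq> 0" "g y0 \<noteq> 0" using False by auto
  then have pos0: "0 < f' x0" "0 < g' y0" using nn[of x0] nn[of y0] by (auto simp: fi less_le)
  have ble: "f' x \<le> max c 0" "g' x \<le> max c 0" for x
    using fin(1,2)[of x] nn[of x] by (auto simp: fi ennreal_le_iff2 max_def)
  have bdd: "bdd_above (range f')" "bdd_above (range g')" using ble by (auto simp: bdd_above_def)
  define F where "F = (SUP x. f' x)"
  define G where "G = (SUP x. g' x)"
  have FG: "0 < F" "0 < G" "f' x \<le> F" "g' x \<le> G" for x
    using cSUP_upper[OF _ bdd(1)] cSUP_upper[OF _ bdd(2)] pos0
    by (auto simp: F_def G_def intro: order.strict_trans2)
  have m': "f' x * g' y \<le> (h' ((x + y)/2))\<^sup>2" for x y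
    using mid[of x y] nn by (simp add: fi ennreal_mult[symmetric] ennreal_power)
  have main: "(\<integral>\<^sup>+x. ennreal (f' x / F) \<partial>lborel) + (\<integral>\<^sup>+x. ennreal (g' x / G) \<partial>lborel)
     \<le> 2 * (\<integral>\<^sup>+x. ennreal (h' x / sqrt (F * G)) \<partial>lborel)"
  proof (rule prekopa_leindler_1d_normalized[where R = R])
    show "\<exists>x. l < f' x / F" if "l < 1" for l
    proof -
      have "l * F < F" using that FG by simp
      then obtain x where "l * F < f' x" using less_cSUP_iff[OF _ bdd(1), of "l * F"] by (auto simp: F_def)
      then show ?thesis using FG by (auto simp: pos_less_divide_eq)
    qed
    show "\<exists>x. l < g' x / G" if "l < 1" for l
    proof -
      have "l * G < G" using that FG by simp
      then obtain x where "l * G < g' x" using less_cSUP_iff[OF _ bdd(2), of "l * G"] by (auto simp: G_def)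
      then show ?thesis using FG by (auto simp: pos_less_divide_eq)
    qed
    show "f' x / F * (g' y / G) \<le> (h' ((x + y)/2) / sqrt (F * G))\<^sup>2" for x y
      using m'[of x y] FG by (simp add: power_divide divide_right_mono)
    show "\<bar>x\<bar> \<le> R" if "f' x / F \<noteq> 0" for x using that bd(1)[of x] nn[of x] by (auto simp: fi)
    show "\<bar>x\<bar> \<le> R" if "g' x / G \<noteq> 0" for x using that bd(2)[of x] nn[of x] by (auto simp: fi)
  qed (use FG nn in \<open>auto simp: divide_le_eq_1\<close>)
  define a where "a = (\<integral>\<^sup>+x. f x \<partial>lborel)"
  define b where "b = (\<integral>\<^sup>+x. g x \<partial>lborel)"
  define e where "e = (\<integral>\<^sup>+x. h x \<partial>lborel)"
  have sc: "(\<integral>\<^sup>+x. ennreal (k x / v) \<partial>lborel) = (\<integral>\<^sup>+x. ennreal (k x) \<partial>lborel) / ennreal v"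
    if "v > 0" "\<And>x. 0 \<le> k x" "k \<in> borel_measurable borel" for k :: "real \<Rightarrow> real" and v
    using that by (subst nn_integral_divide[symmetric]) (auto simp: divide_ennreal)
  have main': "a / ennreal F + b / ennreal G \<le> 2 * (e / ennreal (sqrt (F * G)))"
    using main FG nn by (simp add: sc a_def b_def e_def fi)
  show ?thesis
  proof (cases "e = \<infinity>")
    case True
    then show ?thesis by (simp add: e_def power2_eq_square ennreal_top_mult)
  next
    case False
    then obtain e' where e': "e = ennreal e'" "0 \<le> e'" by (cases e) auto
    note main'
    also have "2 * (e / ennreal (sqrt (F * G))) < \<infinity>"
      using FG e' by (simp add: divide_ennreal flip: ennreal_numeral ennreal_mult)
    finally have "a / ennreal F + b / ennreal G < \<infinity>" .
    then have "a / ennreal F < \<infinity>" "b / ennreal G < \<infinity>" by (auto simp: less_top)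
    then have "a \<noteq> \<infinity>" "b \<noteq> \<infinity>" using FG by (auto simp: ennreal_top_divide)
    then obtain a' b' where ab: "a = ennreal a'" "0 \<le> a'" "b = ennreal b'" "0 \<le> b'" by (cases a; cases b) auto
    have 1: "a' / F + b' / G \<le> 2 * (e' / sqrt (F * G))"
      using main' ab e' FG by (simp add: divide_ennreal flip: ennreal_numeral ennreal_mult ennreal_plus)
    have "4 * (x * y) \<le> (x + y)\<^sup>2" for x y :: real
      using zero_le_power2[of "x - y"] by (simp add: power2_diff power2_sum algebra_simps)
    then have "4 * ((a' / F) * (b' / G)) \<le> (a' / F + b' / G)\<^sup>2" .
    also have "\<dots> \<le> (2 * (e' / sqrt (F * G)))\<^sup>2" using 1 ab FG by (intro power_mono) auto
    also have "\<dots> = 4 * (e'\<^sup>2 / (F * G))" using FG by (simp add: power_mult_distrib power_divide)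
    finally have "a' * b' \<le> e'\<^sup>2" using FG by (simp add: divide_simps)
    then have "a * b \<le> e\<^sup>2" using ab e' by (simp add: ennreal_mult[symmetric] ennreal_power)
    then show ?thesis by (simp add: a_def b_def e_def)
  qed
qed

section \<open>From the line to finitely many coordinates\<close>

definition leb :: "nat set \<Rightarrow> vec measure" where
  "leb I = (\<Pi>\<^sub>M i\<in>I. lborel)"

definition mid :: "vec \<Rightarrow> vec \<Rightarrow> vec" where
  "mid u v = (\<lambda>j. (u j + v j) / 2)"

definition lin :: "nat set \<Rightarrow> vec \<Rightarrow> vec \<Rightarrow> real" where
  "lin I c u = (\<Sum>j\<in>I. c j * u j)"

interpretation lebesgue: product_sigma_finite "\<lambda>_::nat. lborel :: real measure"
  by standard

lemma space_leb: "space (leb I) = extensional I"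
  by (auto simp: leb_def space_PiM PiE_def)

lemma mid_extensional: "u \<in> extensional I \<Longrightarrow> v \<in> extensional I \<Longrightarrow> mid u v \<in> extensional I"
  by (auto simp: extensional_def mid_def)

lemma mid_fun_upd: "mid (x(i := a)) (y(i := b)) = (mid x y)(i := (a + b) / 2)"
  by (auto simp: mid_def fun_eq_iff)

lemma lin_measurable[measurable]: "finite I \<Longrightarrow> lin I c \<in> borel_measurable (leb I)"
  unfolding lin_def leb_def by measurable

lemma lin_mid: "lin I c (mid u v) = (lin I c u + lin I c v) / 2"
  by (simp add: lin_def mid_def sum.distrib[symmetric] sum_divide_distrib add_divide_distrib distrib_left)

lemma measurable_leb_insert:
  assumes "f \<in> borel_measurable (leb (insert i I))"
  shows "(\<lambda>(x, y). f (x(i := y))) \<in> borel_measurable (leb I \<Otimes>\<^sub>M lborel)"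
  using measurable_comp[OF measurable_add_dim assms[unfolded leb_def]] by (simp add: leb_def comp_def case_prod_beta')

lemma measurable_leb_line:
  assumes "x \<in> extensional I" "i \<notin> I" "f \<in> borel_measurable (leb (insert i I))"
  shows "(\<lambda>y. f (x(i := y))) \<in> borel_measurable borel"
proof -
  have "(\<lambda>y. x(i := y)) \<in> measurable lborel (leb (insert i I))"
    unfolding leb_def using measurable_component_update[of x I "\<lambda>_. lborel" i] assms
    by (simp add: space_PiM PiE_def)
  from measurable_compose[OF this assms(3)] show ?thesis by simp
qed

lemma measurable_mid:
  assumes "p \<in> extensional I"
  shows "mid p \<in> measurable (leb I) (leb I)"
  unfolding leb_def
proof (rule measurable_PiM_single')
  show "(\<lambda>w. mid p w j) \<in> measurable (Pi\<^sub>M I (\<lambda>i. lborel)) lborel" if "j \<in> I" for j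
    unfolding mid_def measurable_lborel2 using that by measurable
  show "mid p \<in> space (Pi\<^sub>M I (\<lambda>i. lborel)) \<rightarrow> (\<Pi>\<^sub>E i\<in>I. space lborel)"
    using mid_extensional[OF assms] by (auto simp: space_PiM PiE_def)
qed

lemma nn_integral_leb_insert:
  assumes "finite I" "i \<notin> I" "f \<in> borel_measurable (leb (insert i I))"
  shows "(\<integral>\<^sup>+x. f x \<partial>leb (insert i I)) = (\<integral>\<^sup>+x. (\<integral>\<^sup>+y. f (x(i := y)) \<partial>lborel) \<partial>leb I)"
  using lebesgue.product_nn_integral_insert[OF assms(1,2) assms(3)[unfolded leb_def]] by (simp add: leb_def)

text \<open>Induction on the coordinates: the inequality on the line, applied above
  \<open>u\<close>, \<open>v\<close> and \<open>mid u v\<close>, is the hypothesis that the slice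
  integrals have to satisfy. The common bounds \<open>c\<close> and \<open>R\<close> keep slice
  integrals bounded, as the normalization by suprema requires.\<close>

lemma prekopa_leindler:
  fixes f g h :: "vec \<Rightarrow> ennreal"
  assumes "finite I"
    and "f \<in> borel_measurable (leb I)" "g \<in> borel_measurable (leb I)" "h \<in> borel_measurable (leb I)"
    and "\<And>u. u \<in> extensional I \<Longrightarrow> f u \<le> ennreal c" "\<And>u. u \<in> extensional I \<Longrightarrow> g u \<le> ennreal c"
      "\<And>u. u \<in> extensional I \<Longrightarrow> h u \<le> ennreal c"
    and "\<And>u j. u \<in> extensional I \<Longrightarrow> f u \<noteq> 0 \<Longrightarrow> j \<in> I \<Longrightarrow> \<bar>u j\<bar> \<le> R"
      "\<And>u j. u \<in> extensional I \<Longrightarrow> g u \<noteq> 0 \<Longrightarrow> j \<in> I \<Longrightarrow> \<bar>u j\<bar> \<le> R"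
      "\<And>u j. u \<in> extensional I \<Longrightarrow> h u \<noteq> 0 \<Longrightarrow> j \<in> I \<Longrightarrow> \<bar>u j\<bar> \<le> R"
    and "\<And>u v. u \<in> extensional I \<Longrightarrow> v \<in> extensional I \<Longrightarrow> f u * g v \<le> (h (mid u v))\<^sup>2"
  shows "(\<integral>\<^sup>+u. f u \<partial>leb I) * (\<integral>\<^sup>+u. g u \<partial>leb I) \<le> (\<integral>\<^sup>+u. h u \<partial>leb I)\<^sup>2"
  using assms
proof (induction I arbitrary: f g h c rule: finite_induct)
  case empty
  have "leb {} = count_space {\<lambda>_. undefined}" by (simp add: leb_def PiM_empty)
  moreover have "mid (\<lambda>_. undefined) (\<lambda>_. undefined) = (\<lambda>_. undefined)" by (simp add: mid_def)
  ultimately show ?case using empty(10)[of "\<lambda>_. undefined" "\<lambda>_. undefined"]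
    by (simp add: nn_integral_count_space_finite)
next
  case (insert i I)
  let ?up = "\<lambda>f x. (\<integral>\<^sup>+y. f (x(i := y)) \<partial>lborel)"
  have ext: "x(i := y) \<in> extensional (insert i I)" if "x \<in> extensional I" for x y
    using that by (auto simp: extensional_def)
  have line: "(\<lambda>y. k (x(i := y))) \<in> borel_measurable borel"
    if "x \<in> extensional I" "k \<in> borel_measurable (leb (insert i I))" for x and k :: "vec \<Rightarrow> ennreal"
    using measurable_leb_line[OF that(1) insert.hyps(2) that(2)] .
  have meas: "?up k \<in> borel_measurable (leb I)" if "k \<in> borel_measurable (leb (insert i I))" for k :: "vec \<Rightarrow> ennreal"
    using measurable_leb_insert[OF that] by (rule lborel.borel_measurable_nn_integral)
  have zero: "?up k x \<noteq> 0 \<Longrightarrow> \<exists>y. k (x(i := y)) \<noteq> 0" for k :: "vec \<Rightarrow> ennreal" and x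
    by (rule ccontr) simp
  \<comment> \<open>Height times length of the support; this is the new \<open>c\<close> for the
    remaining coordinates.\<close>
  have bound: "?up k x \<le> ennreal (max c 0 * (2 * \<bar>R\<bar>))"
    if "x \<in> extensional I" "\<And>u. u \<in> extensional (insert i I) \<Longrightarrow> k u \<le> ennreal c"
      "\<And>u j. u \<in> extensional (insert i I) \<Longrightarrow> k u \<noteq> 0 \<Longrightarrow> j \<in> insert i I \<Longrightarrow> \<bar>u j\<bar> \<le> R" for k :: "vec \<Rightarrow> ennreal" and x
  proof -
    have "?up k x \<le> (\<integral>\<^sup>+y. ennreal (max c 0) * indicator {-\<bar>R\<bar>..\<bar>R\<bar>} y \<partial>lborel)"
    proof (rule nn_integral_mono)
      fix y :: real
      show "k (x(i := y)) \<le> ennreal (max c 0) * indicator {-\<bar>R\<bar>..\<bar>R\<bar>} y"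
      proof (cases "k (x(i := y)) = 0")
        case False
        then have "\<bar>y\<bar> \<le> R" using that(3)[OF ext[OF that(1)] False, of i] by simp
        then have "y \<in> {-\<bar>R\<bar>..\<bar>R\<bar>}" by auto
        moreover have "ennreal c \<le> ennreal (max c 0)" by (intro ennreal_leI) simp
        ultimately show ?thesis using order_trans[OF that(2)[OF ext[OF that(1)], of y]] by simp
      qed simp
    qed
    also have "\<dots> = ennreal (max c 0 * (2 * \<bar>R\<bar>))" by (subst nn_integral_cmult) (auto simp: ennreal_mult)
    finally show ?thesis .
  qed
  show ?case
    unfolding nn_integral_leb_insert[OF insert.hyps insert.prems(1)]
      nn_integral_leb_insert[OF insert.hyps insert.prems(2)] nn_integral_leb_insert[OF insert.hyps insert.prems(3)]
  proof (rule insert.IH[where c = "max c 0 * (2 * \<bar>R\<bar>)"])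
    show "?up f \<in> borel_measurable (leb I)" "?up g \<in> borel_measurable (leb I)" "?up h \<in> borel_measurable (leb I)"
      using insert.prems(1-3) by (auto intro: meas)
    show "?up f u \<le> ennreal (max c 0 * (2 * \<bar>R\<bar>))" if "u \<in> extensional I" for u
      by (rule bound[of u f, OF that]) (erule insert.prems(4), erule (2) insert.prems(7))
    show "?up g u \<le> ennreal (max c 0 * (2 * \<bar>R\<bar>))" if "u \<in> extensional I" for u
      by (rule bound[of u g, OF that]) (erule insert.prems(5), erule (2) insert.prems(8))
    show "?up h u \<le> ennreal (max c 0 * (2 * \<bar>R\<bar>))" if "u \<in> extensional I" for u
      by (rule bound[of u h, OF that]) (erule insert.prems(6), erule (2) insert.prems(9))
    have sup: "\<bar>u j\<bar> \<le> R" if "u \<in> extensional I" "?up k u \<noteq> 0" "j \<in> I"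
      "\<And>u j. u \<in> extensional (insert i I) \<Longrightarrow> k u \<noteq> 0 \<Longrightarrow> j \<in> insert i I \<Longrightarrow> \<bar>u j\<bar> \<le> R" for k :: "vec \<Rightarrow> ennreal" and u j
      using zero[OF that(2)] that(4)[OF ext[OF that(1)]] that(3) insert.hyps(2) by (metis fun_upd_other insertCI)
    show "\<bar>u j\<bar> \<le> R" if "u \<in> extensional I" "?up f u \<noteq> 0" "j \<in> I" for u j
      by (rule sup[of u f, OF that]) (erule (2) insert.prems(7))
    show "\<bar>u j\<bar> \<le> R" if "u \<in> extensional I" "?up g u \<noteq> 0" "j \<in> I" for u j
      by (rule sup[of u g, OF that]) (erule (2) insert.prems(8))
    show "\<bar>u j\<bar> \<le> R" if "u \<in> extensional I" "?up h u \<noteq> 0" "j \<in> I" for u j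
      by (rule sup[of u h, OF that]) (erule (2) insert.prems(9))
    fix u v :: vec assume u: "u \<in> extensional I" and v: "v \<in> extensional I"
    have m: "mid u v \<in> extensional I" using u v by (rule mid_extensional)
    show "?up f u * ?up g v \<le> (?up h (mid u v))\<^sup>2"
    proof (rule prekopa_leindler_1d[where c = c and R = R])
      show "f (u(i := y)) \<le> ennreal c" "g (v(i := y)) \<le> ennreal c" for y
        by (rule insert.prems(4)[OF ext[OF u]], rule insert.prems(5)[OF ext[OF v]])
      show "h ((mid u v)(i := y)) < \<infinity>" for y
        by (rule order.strict_trans1[OF insert.prems(6)[OF ext[OF m]]]) simp
      show "\<bar>y\<bar> \<le> R" if "f (u(i := y)) \<noteq> 0" for y using insert.prems(7)[where j = i, OF ext[OF u] that] by simp
      show "\<bar>y\<bar> \<le> R" if "g (v(i := y)) \<noteq> 0" for y using insert.prems(8)[where j = i, OF ext[OF v] that] by simp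
      show "f (u(i := x)) * g (v(i := y)) \<le> (h ((mid u v)(i := (x + y) / 2)))\<^sup>2" for x y
        using insert.prems(10)[OF ext[OF u] ext[OF v], of x y] unfolding mid_fun_upd .
    qed (use line u v m insert.prems(1-3) in auto)
  qed
qed

text \<open>Change of variables for the contraction by 1/2 towards \<open>p\<close>, one coordinate
  at a time.\<close>

lemma nn_integral_leb_half:
  assumes "finite I" "f \<in> borel_measurable (leb I)" "p \<in> extensional I"
  shows "(\<integral>\<^sup>+u. f (mid p u) \<partial>leb I) = 2 ^ card I * (\<integral>\<^sup>+u. f u \<partial>leb I)"
  using assms
proof (induction I arbitrary: f p rule: finite_induct)
  case empty
  have "leb {} = count_space {\<lambda>_. undefined}" by (simp add: leb_def PiM_empty)
  moreover have "p = (\<lambda>_. undefined)" using empty by (auto simp: extensional_def fun_eq_iff)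
  ultimately show ?case by (simp add: nn_integral_count_space_finite mid_def)
next
  case (insert i I)
  let ?q = "p(i := undefined)"
  have q: "?q \<in> extensional I" using insert.prems(2) by (auto simp: extensional_def)
  have fm: "(\<lambda>u. f (mid p u)) \<in> borel_measurable (leb (insert i I))"
    by (rule measurable_compose[OF measurable_mid[OF insert.prems(2)] insert.prems(1)])
  note line = measurable_leb_line[OF _ insert.hyps(2) insert.prems(1)]
  have up: "mid p (x(i := y)) = (mid ?q x)(i := (p i + y) / 2)" for x y
    by (auto simp: mid_def fun_eq_iff)
  have one: "(\<integral>\<^sup>+y. f (x(i := (p i + y) / 2)) \<partial>lborel) = 2 * (\<integral>\<^sup>+y. f (x(i := y)) \<partial>lborel)"
    if "x \<in> extensional I" for x
  proof -
    have "(\<integral>\<^sup>+y. f (x(i := (p i + y) / 2)) \<partial>lborel)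
      = ennreal \<bar>2\<bar> * (\<integral>\<^sup>+y. f (x(i := (p i + (- p i + 2 * y)) / 2)) \<partial>lborel)"
    proof (rule nn_integral_real_affine[where t = "- p i" and c = 2 and f = "\<lambda>y. f (x(i := (p i + y) / 2))"])
      show "(\<lambda>y. f (x(i := (p i + y) / 2))) \<in> borel_measurable borel"
        by (rule measurable_compose[OF _ line[OF that], of "\<lambda>y. (p i + y) / 2" borel]) simp
    qed simp
    then show ?thesis by simp
  qed
  have "(\<integral>\<^sup>+u. f (mid p u) \<partial>leb (insert i I)) = (\<integral>\<^sup>+x. 2 * (\<integral>\<^sup>+y. f ((mid ?q x)(i := y)) \<partial>lborel) \<partial>leb I)"
    unfolding nn_integral_leb_insert[OF insert.hyps fm] up
    by (intro nn_integral_cong one mid_extensional[OF q]) (simp add: space_leb)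
  also have "\<dots> = 2 ^ card I * (\<integral>\<^sup>+x. 2 * (\<integral>\<^sup>+y. f (x(i := y)) \<partial>lborel) \<partial>leb I)"
    by (rule insert.IH[OF _ q, of "\<lambda>x. 2 * (\<integral>\<^sup>+y. f (x(i := y)) \<partial>lborel)"])
      (intro borel_measurable_times_ennreal borel_measurable_const lborel.borel_measurable_nn_integral measurable_leb_insert insert.prems)
  also have "\<dots> = 2 ^ card I * (2 * (\<integral>\<^sup>+x. \<integral>\<^sup>+y. f (x(i := y)) \<partial>lborel \<partial>leb I))"
    by (subst nn_integral_cmult)
      (intro lborel.borel_measurable_nn_integral measurable_leb_insert insert.prems, simp)
  also have "\<dots> = 2 ^ card (insert i I) * (\<integral>\<^sup>+x. f x \<partial>leb (insert i I))"
    unfolding nn_integral_leb_insert[OF insert.hyps insert.prems(1)] using insert.hyps by (simp add: ac_simps)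
  finally show ?case .
qed

section \<open>Exponential densities on convex bodies\<close>

text \<open>Points are total functions; the body constrains only the coordinates in \<open>I\<close>.\<close>

locale convex_body =
  fixes I :: "nat set" and R :: real and B :: "vec set"
  assumes finI: "finite I"
    and meas: "{u \<in> extensional I. u \<in> B} \<in> sets (leb I)"
    and bounded: "u \<in> B \<Longrightarrow> j \<in> I \<Longrightarrow> \<bar>u j\<bar> \<le> R"
    and midpoint: "u \<in> B \<Longrightarrow> v \<in> B \<Longrightarrow> mid u v \<in> B"
    and local: "u \<in> B \<Longrightarrow> (\<And>j. j \<in> I \<Longrightarrow> u j = v j) \<Longrightarrow> v \<in> B"

definition wt :: "nat set \<Rightarrow> vec set \<Rightarrow> vec \<Rightarrow> vec \<Rightarrow> real" where
  "wt I B \<theta> u = indicator B u * exp (lin I \<theta> u)"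

definition mass :: "nat set \<Rightarrow> vec set \<Rightarrow> vec \<Rightarrow> real" where
  "mass I B \<theta> = (\<integral>u. wt I B \<theta> u \<partial>leb I)"

definition centre :: "nat set \<Rightarrow> vec set \<Rightarrow> vec \<Rightarrow> vec" where
  "centre I B \<theta> j = (\<integral>u. u j * wt I B \<theta> u \<partial>leb I) / mass I B \<theta>"

lemma wt_nonneg: "0 \<le> wt I B \<theta> u"
  by (simp add: wt_def)

lemma lin_cong: "(\<And>j. j \<in> I \<Longrightarrow> u j = v j) \<Longrightarrow> lin I c u = lin I c v"
  by (simp add: lin_def)

lemma lin_add: "lin I (\<lambda>j. a j + b j) u = lin I a u + lin I b u"
  by (simp add: lin_def distrib_right sum.distrib)

lemma lin_scale: "lin I (\<lambda>j. k * a j) u = k * lin I a u"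
  by (simp add: lin_def sum_distrib_left mult.assoc)

lemma abs_lin_le:
  assumes "\<And>j. j \<in> I \<Longrightarrow> \<bar>u j\<bar> \<le> R"
  shows "\<bar>lin I c u\<bar> \<le> R * (\<Sum>j\<in>I. \<bar>c j\<bar>)"
proof -
  have "\<bar>lin I c u\<bar> \<le> (\<Sum>j\<in>I. \<bar>c j * u j\<bar>)" unfolding lin_def by (rule sum_abs)
  also have "\<dots> \<le> (\<Sum>j\<in>I. R * \<bar>c j\<bar>)"
    using mult_right_mono[OF assms abs_ge_zero] by (intro sum_mono) (simp add: abs_mult mult.commute)
  finally show ?thesis by (simp add: sum_distrib_left)
qed

lemma emeasure_leb_box:
  assumes "finite I" "\<And>j. j \<in> I \<Longrightarrow> a j \<le> b j"
  shows "emeasure (leb I) (\<Pi>\<^sub>E j\<in>I. {a j..b j}) = ennreal (\<Prod>j\<in>I. b j - a j)"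
  unfolding leb_def using assms by (subst lebesgue.emeasure_PiM) (auto simp: prod_ennreal)

context convex_body
begin

lemma abs_lin_bounded: "u \<in> B \<Longrightarrow> \<bar>lin I c u\<bar> \<le> R * (\<Sum>j\<in>I. \<bar>c j\<bar>)"
  by (rule abs_lin_le) (rule bounded)

lemma coord_measurable[measurable]: "j \<in> I \<Longrightarrow> (\<lambda>u. u j) \<in> borel_measurable (leb I)"
  unfolding leb_def by measurable

lemma lin_meas[measurable]: "lin I c \<in> borel_measurable (leb I)"
  using finI by simp

lemma indicator_measurable[measurable]: "(indicator B :: vec \<Rightarrow> real) \<in> borel_measurable (leb I)"
proof -
  have "(indicator {u \<in> extensional I. u \<in> B} :: vec \<Rightarrow> real) \<in> borel_measurable (leb I)"
    using meas by simp
  then show ?thesis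
    by (subst measurable_cong[where g = "indicator {u \<in> extensional I. u \<in> B}"])
      (auto simp: space_leb indicator_def)
qed

lemma wt_measurable[measurable]: "wt I B \<theta> \<in> borel_measurable (leb I)"
  unfolding wt_def[abs_def] by measurable

lemma integrable_wt_mult:
  assumes [measurable]: "f \<in> borel_measurable (leb I)" and "\<And>u. u \<in> B \<Longrightarrow> \<bar>f u\<bar> \<le> c"
  shows "integrable (leb I) (\<lambda>u. f u * wt I B \<theta> u)"
proof (rule Bochner_Integration.integrable_bound)
  let ?K = "\<Pi>\<^sub>E j\<in>I. {-\<bar>R\<bar>..\<bar>R\<bar>}"
  have K: "?K \<in> sets (leb I)" unfolding leb_def using finI by measurable
  have "emeasure (leb I) ?K = ennreal (\<Prod>j\<in>I. \<bar>R\<bar> - (-\<bar>R\<bar>))"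
    using emeasure_leb_box[OF finI, of "\<lambda>_. -\<bar>R\<bar>" "\<lambda>_. \<bar>R\<bar>"] by simp
  then have "emeasure (leb I) ?K < \<infinity>" by simp
  then show "integrable (leb I) (\<lambda>u. c * exp (R * (\<Sum>j\<in>I. \<bar>\<theta> j\<bar>)) * indicator ?K u)"
    using K by (intro integrable_mult_right integrable_real_indicator) auto
  show "AE u in leb I. norm (f u * wt I B \<theta> u) \<le> norm (c * exp (R * (\<Sum>j\<in>I. \<bar>\<theta> j\<bar>)) * indicator ?K u)"
  proof (rule AE_I2)
    fix u assume u: "u \<in> space (leb I)"
    show "norm (f u * wt I B \<theta> u) \<le> norm (c * exp (R * (\<Sum>j\<in>I. \<bar>\<theta> j\<bar>)) * indicator ?K u)"
    proof (cases "u \<in> B")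
      case True
      have K1: "indicator ?K u = (1::real)"
      proof -
        have "- \<bar>R\<bar> \<le> u j \<and> u j \<le> \<bar>R\<bar>" if "j \<in> I" for j using bounded[OF True that] by linarith
        then show ?thesis using u by (simp add: space_leb PiE_def)
      qed
      have "exp (lin I \<theta> u) \<le> exp (R * (\<Sum>j\<in>I. \<bar>\<theta> j\<bar>))"
        using abs_lin_bounded[OF True, of \<theta>] by simp
      then have "\<bar>f u\<bar> * exp (lin I \<theta> u) \<le> \<bar>c\<bar> * exp (R * (\<Sum>j\<in>I. \<bar>\<theta> j\<bar>))"
        using assms(2)[OF True] by (intro mult_mono) auto
      then show ?thesis unfolding K1 using True by (simp add: wt_def abs_mult)
    qed (simp add: wt_def)
  qed
qed simp

lemma integrable_wt[simp, intro]: "integrable (leb I) (wt I B \<theta>)"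
  using integrable_wt_mult[of "\<lambda>_. 1" 1] by simp

lemma integrable_coord[intro]: "j \<in> I \<Longrightarrow> integrable (leb I) (\<lambda>u. u j * wt I B \<theta> u)"
  by (rule integrable_wt_mult) (use bounded in auto)

lemma integrable_lin[intro]: "integrable (leb I) (\<lambda>u. lin I c u * wt I B \<theta> u)"
  by (rule integrable_wt_mult) (use abs_lin_bounded in auto)

lemma mass_nonneg: "0 \<le> mass I B \<theta>"
  unfolding mass_def by (intro integral_nonneg_AE) (simp add: wt_nonneg)

lemma integral_lin:
  assumes "0 < mass I B \<theta>"
  shows "(\<integral>u. lin I c u * wt I B \<theta> u \<partial>leb I) = lin I c (centre I B \<theta>) * mass I B \<theta>"
proof -
  have "(\<integral>u. lin I c u * wt I B \<theta> u \<partial>leb I) = (\<integral>u. (\<Sum>j\<in>I. c j * (u j * wt I B \<theta> u)) \<partial>leb I)"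
    by (simp add: lin_def sum_distrib_right mult.assoc)
  also have "\<dots> = (\<Sum>j\<in>I. c j * (\<integral>u. u j * wt I B \<theta> u \<partial>leb I))"
    by (subst Bochner_Integration.integral_sum) auto
  also have "\<dots> = lin I c (centre I B \<theta>) * mass I B \<theta>"
    using assms by (simp add: lin_def centre_def sum_distrib_right)
  finally show ?thesis .
qed

lemma centre_bounds:
  assumes "0 < mass I B \<theta>" "j \<in> I" "\<And>u. u \<in> B \<Longrightarrow> lo \<le> u j \<and> u j \<le> hi"
  shows "lo \<le> centre I B \<theta> j" "centre I B \<theta> j \<le> hi"
proof -
  have le: "lo * wt I B \<theta> u \<le> u j * wt I B \<theta> u" "u j * wt I B \<theta> u \<le> hi * wt I B \<theta> u" for u
    using assms(3)[of u] by (auto simp: wt_def indicator_def)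
  have "(\<integral>u. lo * wt I B \<theta> u \<partial>leb I) \<le> (\<integral>u. u j * wt I B \<theta> u \<partial>leb I)"
    using assms(2) le by (intro integral_mono) auto
  then show "lo \<le> centre I B \<theta> j" using assms(1) by (simp add: centre_def mass_def pos_le_divide_eq)
  have "(\<integral>u. u j * wt I B \<theta> u \<partial>leb I) \<le> (\<integral>u. hi * wt I B \<theta> u \<partial>leb I)"
    using assms(2) le by (intro integral_mono) auto
  then show "centre I B \<theta> j \<le> hi" using assms(1) by (simp add: centre_def mass_def pos_divide_le_eq)
qed

section \<open>The weight of a halfspace\<close>

abbreviation tail_wt :: "vec \<Rightarrow> vec \<Rightarrow> real \<Rightarrow> vec \<Rightarrow> real" where
  "tail_wt c \<theta> a u \<equiv> indicator {u. a \<le> lin I c u} u * wt I B \<theta> u"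

definition T :: "vec \<Rightarrow> vec \<Rightarrow> real \<Rightarrow> real" where
  "T c \<theta> a = (\<integral>u. tail_wt c \<theta> a u \<partial>leb I)"

text \<open>Midpoints of points of the two outer halfspaces lie in the middle one, and the
  exponential of a linear functional at a midpoint is the geometric mean of its values at the ends.
  This is the pointwise hypothesis of \<open>prekopa_leindler\<close>.\<close>

lemma tail_log_concave:
  shows "T c \<theta> a * T c \<theta> b \<le> (T c \<theta> ((a + b)/2))\<^sup>2"
proof -
  let ?f = "\<lambda>a (u::vec). tail_wt c \<theta> a u"
  have m: "?f a \<in> borel_measurable (leb I)" for a :: real by measurable
  have int: "integrable (leb I) (?f a)" for a
    by (rule integrable_wt_mult[where c = 1]) auto
  have nn: "0 \<le> ?f a u" for a u by (simp add: wt_nonneg)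
  have eq: "(\<integral>\<^sup>+u. ennreal (?f a u) \<partial>leb I) = ennreal (T c \<theta> a)" for a
    unfolding T_def using nn by (intro nn_integral_eq_integral int) auto
  have T0: "0 \<le> T c \<theta> a" for a unfolding T_def by (intro integral_nonneg_AE) (simp add: nn)
  have bd: "?f a u \<le> exp (R * (\<Sum>j\<in>I. \<bar>\<theta> j\<bar>))" for a u
    using abs_lin_bounded[of u \<theta>] by (auto simp: wt_def indicator_def)
  have supp: "\<bar>u j\<bar> \<le> R" if "ennreal (?f a u) \<noteq> 0" "j \<in> I" for u j a
    using that bounded[of u j] by (auto simp: wt_def indicator_def split: if_splits)
  have "(\<integral>\<^sup>+u. ennreal (?f a u) \<partial>leb I) * (\<integral>\<^sup>+u. ennreal (?f b u) \<partial>leb I)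
     \<le> (\<integral>\<^sup>+u. ennreal (?f ((a+b)/2) u) \<partial>leb I)\<^sup>2"
  proof (rule prekopa_leindler[OF finI, where c = "exp (R * (\<Sum>j\<in>I. \<bar>\<theta> j\<bar>))" and R = R])
    show "ennreal (?f a u) * ennreal (?f b v) \<le> (ennreal (?f ((a+b)/2) (mid u v)))\<^sup>2" for u v
    proof (cases "u \<in> B \<and> v \<in> B \<and> a \<le> lin I c u \<and> b \<le> lin I c v")
      case True
      then have "mid u v \<in> B" "(a+b)/2 \<le> lin I c (mid u v)" by (auto simp: midpoint lin_mid)
      moreover have "(exp ((lin I \<theta> u + lin I \<theta> v) / 2))\<^sup>2 = exp (lin I \<theta> u) * exp (lin I \<theta> v)"
        by (simp add: exp_double[symmetric] exp_add[symmetric])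
      ultimately show ?thesis using True
        by (simp add: wt_def ennreal_mult[symmetric] ennreal_power lin_mid)
    qed (auto simp: wt_def indicator_def)
  qed (rule measurable_compose[OF m measurable_ennreal] | rule ennreal_leI[OF bd] | erule (1) supp)+
  then show ?thesis unfolding eq using T0 by (simp add: ennreal_mult[symmetric] ennreal_power)
qed


lemma T_nonneg: "0 \<le> T c \<theta> a"
  unfolding T_def by (intro integral_nonneg_AE) (simp add: wt_nonneg)

lemma integrable_tail: "integrable (leb I) (\<lambda>u. tail_wt c \<theta> a u)"
  by (rule integrable_wt_mult[where c = 1]) auto

lemma T_mono: "a \<le> b \<Longrightarrow> T c \<theta> b \<le> T c \<theta> a"
  unfolding T_def by (intro integral_mono integrable_tail) (auto simp: indicator_def wt_nonneg)

text \<open>Left continuity of the tail, which holds because the halfspaces are closed. It makes the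
  search for a dyadic scale in \<open>tail_ge_sixth\<close> end.\<close>

lemma T_scale_limit: "(\<lambda>k. T c \<theta> (m - H / 2 ^ k)) \<longlonglongrightarrow> T c \<theta> m" if "0 < H"
  unfolding T_def
proof (rule integral_dominated_convergence[where w = "wt I B \<theta>"])
  show "AE u in leb I. (\<lambda>k. tail_wt c \<theta> (m - H / 2 ^ k) u)
      \<longlonglongrightarrow> tail_wt c \<theta> m u"
  proof (rule AE_I2)
    fix u :: vec
    have lim: "(\<lambda>k. m - H / 2 ^ k) \<longlonglongrightarrow> m"
      using tendsto_diff[OF tendsto_const[of m] tendsto_mult[OF tendsto_const[of H] LIMSEQ_realpow_zero[of "1/2::real"]]]
      by (simp add: power_one_over field_simps)
    have "eventually (\<lambda>k. indicator {u. m - H / 2 ^ k \<le> lin I c u} u = (indicator {u. m \<le> lin I c u} u :: real)) sequentially"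
    proof (cases "m \<le> lin I c u")
      case True
      have "m - H / 2 ^ k \<le> lin I c u" for k :: nat using True that by (smt (verit) divide_nonneg_pos zero_less_power)
      then show ?thesis using True by simp
    next
      case False
      then have "eventually (\<lambda>k. lin I c u < m - H / 2 ^ k) sequentially" using order_tendstoD(1)[OF lim] by simp
      then show ?thesis by eventually_elim (use False in auto)
    qed
    then have "eventually (\<lambda>k. tail_wt c \<theta> (m - H / 2 ^ k) u =
       tail_wt c \<theta> m u) sequentially" by eventually_elim simp
    then show "(\<lambda>k. tail_wt c \<theta> (m - H / 2 ^ k) u)
      \<longlonglongrightarrow> tail_wt c \<theta> m u" by (rule tendsto_eventually)
  qed
  show "AE u in leb I. norm (tail_wt c \<theta> (m - H / 2 ^ k) u) \<le> wt I B \<theta> u" for k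
    by (auto simp: indicator_def wt_nonneg)
qed auto

text \<open>Log-concavity of the tail makes the upper side of the centre light: if a halfspace beyond the
  centre had less than a sixth of the weight, a geometric series would bound the positive part of the
  functional by less than its negative part, although both have the same integral.\<close>

lemma tail_ge_sixth:
  assumes Z: "0 < mass I B \<theta>"
  shows "mass I B \<theta> / 6 \<le> T c \<theta> (lin I c (centre I B \<theta>))"
proof (rule ccontr)
  define m where "m = lin I c (centre I B \<theta>)"
  define Z where "Z = mass I B \<theta>"
  assume "\<not> ?thesis"
  then have small: "T c \<theta> m < Z / 6" by (simp add: m_def Z_def)
  have Z0: "0 < Z" using Z by (simp add: Z_def)
  \<comment> \<open>The halfspace that starts \<open>H\<close> below \<open>m\<close> contains the
    whole body; the search over the scales \<open>H / 2 ^ k\<close> begins there.\<close>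
  define H where "H = R * (\<Sum>j\<in>I. \<bar>c j\<bar>) + \<bar>m\<bar> + 1"
  have lb: "\<bar>lin I c u\<bar> \<le> R * (\<Sum>j\<in>I. \<bar>c j\<bar>)" if "u \<in> B" for u using abs_lin_bounded[OF that] .
  have "B \<noteq> {}"
  proof
    assume "B = {}"
    then have "mass I B \<theta> = 0" by (simp add: mass_def wt_def)
    then show False using Z by simp
  qed
  then have H0: "0 < H" using lb by (fastforce simp: H_def)
  have full: "T c \<theta> (m - H) = Z"
    unfolding T_def Z_def mass_def using lb
    by (intro Bochner_Integration.integral_cong) (force simp: indicator_def wt_def H_def)+
  have "\<exists>k. T c \<theta> (m - H / 2 ^ k) < Z / 2"
    using order_tendstoD(2)[OF T_scale_limit[OF H0, of c \<theta> m], of "Z / 2"] small Z0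
    by (auto simp: eventually_sequentially)
  then obtain k where k: "T c \<theta> (m - H / 2 ^ k) < Z / 2" "\<And>j. j < k \<Longrightarrow> \<not> T c \<theta> (m - H / 2 ^ j) < Z / 2"
    using exists_least_iff[of "\<lambda>k. T c \<theta> (m - H / 2 ^ k) < Z / 2"] by auto
  have "k \<noteq> 0" using k(1) full Z0 by (cases k) auto
  then obtain k' where k': "k = Suc k'" by (cases k) auto
  \<comment> \<open>The last scale before the tail falls under \<open>Z / 2\<close>. The tail at
    \<open>m - h\<close> is at least \<open>Z / 2\<close>, which gives the decay factor 3; more than
    \<open>Z / 2\<close> of the mass lies over \<open>h / 2\<close> below the mean, which gives the
    negative part.\<close>
  define h where "h = H / 2 ^ k'"
  have h0: "0 < h" using H0 by (simp add: h_def)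
  have th: "Z / 2 \<le> T c \<theta> (m - h)" "T c \<theta> (m - h / 2) < Z / 2"
    using k(2)[of k'] k(1) by (auto simp: k' h_def mult.commute)
  \<comment> \<open>By log-concavity the ratio of consecutive tails does not increase, and the first
    ratio is below \<open>(Z / 6) / (Z / 2)\<close>.\<close>
  have step: "T c \<theta> (m + real n * h) \<le> T c \<theta> (m + real n * h - h) / 3" for n
  proof (induction n)
    case 0
    then show ?case using th(1) small by simp
  next
    case (Suc n)
    let ?t = "\<lambda>x. T c \<theta> (m + x * h)"
    have e: "m + real (Suc n) * h - h = m + real n * h" by (simp add: algebra_simps)
    show ?case
    proof (cases "?t (real n) = 0")
      case True
      have "?t (real (Suc n)) \<le> ?t (real n)" using h0 by (intro T_mono) simp
      then show ?thesis unfolding e True using True by simp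
    next
      case False
      then have pos: "0 < ?t (real n)" using T_nonneg[of c \<theta> "m + real n * h"] by simp
      have "(m + real n * h - h + (m + real (Suc n) * h)) / 2 = m + real n * h" by (simp add: field_simps)
      then have "T c \<theta> (m + real n * h - h) * ?t (real (Suc n)) \<le> (?t (real n))\<^sup>2"
        using tail_log_concave[of c \<theta> "m + real n * h - h" "m + real (Suc n) * h"] by (simp only:)
      moreover have "3 * ?t (real n) * ?t (real (Suc n)) \<le> T c \<theta> (m + real n * h - h) * ?t (real (Suc n))"
        using Suc T_nonneg by (intro mult_right_mono) auto
      ultimately have "?t (real n) * (3 * ?t (real (Suc n))) \<le> ?t (real n) * ?t (real n)"
        by (simp add: power2_eq_square algebra_simps)
      then have "3 * ?t (real (Suc n)) \<le> ?t (real n)" using pos by simp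
      then show ?thesis unfolding e by simp
    qed
  qed
  have geo: "T c \<theta> (m + real n * h) \<le> T c \<theta> m * (1/3) ^ n" for n
  proof (induction n)
    case (Suc n)
    have e: "m + real (Suc n) * h - h = m + real n * h" by (simp add: algebra_simps)
    show ?case using step[of "Suc n"] Suc unfolding e by simp
  qed simp
  have gsum: "(\<Sum>n<N. (1/3::real) ^ n) \<le> 3/2" for N
    by (subst geometric_sum) (auto simp: field_simps)
  obtain N :: nat where N: "H \<le> real N * h" using h0 by (metis reals_Archimedean3 less_imp_le mult.commute)
  \<comment> \<open>A value is covered by one summand \<open>h\<close> for each threshold
    \<open>k * h\<close> that it reaches, starting with \<open>k = 0\<close>.\<close>
  have pw: "min y (real n * h) \<le> h * (\<Sum>k<n. indicator {x. real k * h \<le> x} y)" for y :: real and n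
  proof (induction n)
    case (Suc n)
    show ?case
    proof (cases "real n * h \<le> y")
      case True
      then have "min y (real n * h) = real n * h" by simp
      then have "real (Suc n) * h \<le> h * (\<Sum>k<Suc n. indicator {x. real k * h \<le> x} y)"
        using Suc True by (simp add: distrib_left distrib_right)
      then show ?thesis by linarith
    next
      case False
      then have "min y (real (Suc n) * h) = min y (real n * h)" using h0 by (simp add: algebra_simps min_def)
      then show ?thesis using Suc False by simp
    qed
  qed (simp add: min_def)
  have pt: "(lin I c u - m) * wt I B \<theta> u \<le>
      h * (\<Sum>k<N. tail_wt c \<theta> (m + real k * h) u)
      - h / 2 * (wt I B \<theta> u - tail_wt c \<theta> (m - h / 2) u)" for u
  proof (cases "u \<in> B")
    case True
    have y: "lin I c u - m \<le> real N * h" using lb[OF True] N by (simp add: H_def)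
    have ind: "indicator {x. real k * h \<le> x} (lin I c u - m) = (indicator {u. m + real k * h \<le> lin I c u} u :: real)" for k
      by (auto simp: indicator_def)
    have "lin I c u - m \<le> h * (\<Sum>k<N. indicator {x. real k * h \<le> x} (lin I c u - m)) - h / 2 * (1 - indicator {u. m - h / 2 \<le> lin I c u} u)"
    proof (cases "m - h / 2 \<le> lin I c u")
      case True
      then show ?thesis using pw[of "lin I c u - m" N] y by simp
    next
      case False
      have "0 \<le> h * (\<Sum>k<N. indicator {x. real k * h \<le> x} (lin I c u - m))"
        using h0 by (intro mult_nonneg_nonneg sum_nonneg) auto
      then show ?thesis using False by simp
    qed
    note this[unfolded ind]
    then have "(lin I c u - m) * wt I B \<theta> u \<le> (h * (\<Sum>k<N. indicator {u. m + real k * h \<le> lin I c u} u) - h / 2 * (1 - indicator {u. m - h / 2 \<le> lin I c u} u)) * wt I B \<theta> u"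
      by (intro mult_right_mono wt_nonneg)
    then show ?thesis by (simp add: algebra_simps sum_distrib_left)
  qed (simp add: wt_def)
  have "0 = (\<integral>u. (lin I c u - m) * wt I B \<theta> u \<partial>leb I)"
    using integral_lin[OF Z, of c] by (simp add: left_diff_distrib integrable_lin m_def mass_def)
  also have "\<dots> \<le> (\<integral>u. h * (\<Sum>k<N. tail_wt c \<theta> (m + real k * h) u)
      - h / 2 * (wt I B \<theta> u - tail_wt c \<theta> (m - h / 2) u) \<partial>leb I)"
    by (intro integral_mono pt Bochner_Integration.integrable_diff integrable_mult_right
        Bochner_Integration.integrable_sum integrable_tail integrable_wt)
      (auto simp: left_diff_distrib)
  also have "\<dots> = h * (\<Sum>k<N. T c \<theta> (m + real k * h)) - h / 2 * (Z - T c \<theta> (m - h / 2))"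
  proof -
    have 1: "(\<integral>u. (\<Sum>k<N. tail_wt c \<theta> (m + real k * h) u) \<partial>leb I)
        = (\<Sum>k<N. T c \<theta> (m + real k * h))"
      unfolding T_def by (rule Bochner_Integration.integral_sum) (rule integrable_tail)
    have 2: "(\<integral>u. wt I B \<theta> u - tail_wt c \<theta> (m - h / 2) u \<partial>leb I)
        = Z - T c \<theta> (m - h / 2)"
      unfolding T_def Z_def mass_def by (rule Bochner_Integration.integral_diff) (auto intro: integrable_tail)
    have "integrable (leb I) (\<lambda>u. h * (\<Sum>k<N. tail_wt c \<theta> (m + real k * h) u))"
      by (intro integrable_mult_right Bochner_Integration.integrable_sum integrable_tail)
    moreover have "integrable (leb I) (\<lambda>u. h / 2 * (wt I B \<theta> u - tail_wt c \<theta> (m - h / 2) u))"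
      by (intro integrable_mult_right Bochner_Integration.integrable_diff integrable_tail integrable_wt)
    ultimately show ?thesis unfolding 1[symmetric] 2[symmetric]
      by (simp only: Bochner_Integration.integral_diff integral_mult_right_zero)
  qed
  \<comment> \<open>The positive part is below \<open>h * (3 / 2) * (Z / 6)\<close> by the geometric
    series, the negative part is at least \<open>h / 2\<close> on mass at least
    \<open>Z / 2\<close>; both bounds equal \<open>h * Z / 4\<close>.\<close>
  also have "\<dots> < h * (Z / 4) - h / 2 * (Z / 2)"
  proof -
    have "(\<Sum>k<N. T c \<theta> (m + real k * h)) \<le> (\<Sum>k<N. T c \<theta> m * (1/3) ^ k)" by (intro sum_mono geo)
    also have "\<dots> = T c \<theta> m * (\<Sum>k<N. (1/3) ^ k)" by (simp add: sum_distrib_left)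
    also have "\<dots> \<le> T c \<theta> m * (3/2)" by (intro mult_left_mono gsum T_nonneg)
    finally have "(\<Sum>k<N. T c \<theta> (m + real k * h)) < Z / 4" using small by simp
    then have "h * (\<Sum>k<N. T c \<theta> (m + real k * h)) < h * (Z / 4)" using h0 by simp
    moreover have "h / 2 * (Z / 2) \<le> h / 2 * (Z - T c \<theta> (m - h / 2))" using h0 th(2) by (intro mult_left_mono) auto
    ultimately show ?thesis by linarith
  qed
  also have "\<dots> = 0" by simp
  finally show False by simp
qed

text \<open>A Gruenbaum-type inequality: \<open>C\<close> misses the closed halfspace through the
  centre, and that halfspace carries at least a sixth of the mass.\<close>

lemma mass_cut:
  assumes Z: "0 < mass I B \<theta>" and C: "convex_body I R' C" and sub: "C \<subseteq> B"
    and cut: "\<And>u. u \<in> C \<Longrightarrow> lin I c u < lin I c (centre I B \<theta>)"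
  shows "mass I C \<theta> \<le> 5 / 6 * mass I B \<theta>"
proof -
  interpret C: convex_body I R' C by (rule C)
  let ?m = "lin I c (centre I B \<theta>)"
  have "mass I C \<theta> \<le> (\<integral>u. wt I B \<theta> u - tail_wt c \<theta> (?m) u \<partial>leb I)"
    unfolding mass_def
  proof (rule integral_mono)
    show "wt I C \<theta> u \<le> wt I B \<theta> u - tail_wt c \<theta> (?m) u" for u
      using cut[of u] sub by (auto simp: wt_def indicator_def)
  qed (auto intro: integrable_tail)
  also have "\<dots> = mass I B \<theta> - T c \<theta> ?m"
    unfolding T_def mass_def by (rule Bochner_Integration.integral_diff) (auto intro: integrable_tail)
  finally show ?thesis using tail_ge_sixth[OF Z, of c] by simp
qed


text \<open>Replacing \<open>u\<close> by its midpoint with \<open>p\<close> multiplies the integral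
  of the weight by \<open>2 ^ card I\<close>. By convexity of \<open>exp\<close> it also multiplies
  it by at least \<open>exp X\<close>, where \<open>2 * X\<close> is the gap in question. So
  \<open>exp X\<close> is at most \<open>2 ^ card I\<close>.\<close>

lemma linear_gap:
  assumes Z: "0 < mass I B \<theta>" and p: "p \<in> B"
  shows "lin I \<theta> p \<le> lin I \<theta> (centre I B \<theta>) + 2 * real (card I)"
proof -
  define q where "q = (\<lambda>j. if j \<in> I then p j else undefined)"
  have q: "q \<in> extensional I" "q \<in> B" "lin I \<theta> q = lin I \<theta> p"
    using local[OF p, of q] by (auto simp: q_def extensional_def lin_def)
  define X where "X = (lin I \<theta> p - lin I \<theta> (centre I B \<theta>)) / 2"
  \<comment> \<open>The tangent of \<open>exp\<close> at \<open>X\<close> is a pointwise form of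
    Jensen's inequality: \<open>X\<close> is the mean of the exponent under the density, so the
    linear term integrates to zero.\<close>
  have pt: "exp X * ((1 + (lin I \<theta> p - lin I \<theta> u) / 2 - X) * wt I B \<theta> u) \<le> wt I B \<theta> (mid q u)" for u
  proof (cases "u \<in> B")
    case True
    have "exp X * (1 + (lin I \<theta> p - lin I \<theta> u) / 2 - X) \<le> exp X * exp ((lin I \<theta> p - lin I \<theta> u) / 2 - X)"
      using exp_ge_add_one_self[of "(lin I \<theta> p - lin I \<theta> u) / 2 - X"] by (intro mult_left_mono exp_ge_zero) linarith
    also have "\<dots> = exp ((lin I \<theta> p - lin I \<theta> u) / 2)" by (simp add: exp_add[symmetric])
    finally have "exp X * (1 + (lin I \<theta> p - lin I \<theta> u) / 2 - X) * exp (lin I \<theta> u)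
       \<le> exp ((lin I \<theta> p - lin I \<theta> u) / 2) * exp (lin I \<theta> u)" by (rule mult_right_mono) simp
    also have "\<dots> = exp ((lin I \<theta> p + lin I \<theta> u) / 2)" by (simp add: exp_add[symmetric] field_simps)
    finally show ?thesis using True midpoint[OF q(2) True] q by (simp add: wt_def lin_mid mult.assoc)
  qed (simp add: wt_def)
  have half: "integrable (leb I) (\<lambda>u. wt I B \<theta> (mid q u))"
    "(\<integral>u. wt I B \<theta> (mid q u) \<partial>leb I) = 2 ^ card I * mass I B \<theta>"
  proof -
    have "(\<integral>\<^sup>+u. ennreal (wt I B \<theta> (mid q u)) \<partial>leb I) = 2 ^ card I * (\<integral>\<^sup>+u. ennreal (wt I B \<theta> u) \<partial>leb I)"
      using nn_integral_leb_half[OF finI _ q(1), of "\<lambda>u. ennreal (wt I B \<theta> u)"] by simp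
    also have "(\<integral>\<^sup>+u. ennreal (wt I B \<theta> u) \<partial>leb I) = ennreal (mass I B \<theta>)"
      unfolding mass_def by (intro nn_integral_eq_integral) (auto simp: wt_nonneg)
    also have "2 ^ card I * ennreal (mass I B \<theta>) = ennreal (2 ^ card I * mass I B \<theta>)"
      by (simp add: ennreal_mult mass_nonneg flip: ennreal_numeral ennreal_power)
    finally have e: "(\<integral>\<^sup>+u. ennreal (wt I B \<theta> (mid q u)) \<partial>leb I) = ennreal (2 ^ card I * mass I B \<theta>)" .
    have m: "(\<lambda>u. wt I B \<theta> (mid q u)) \<in> borel_measurable (leb I)"
      by (rule measurable_compose[OF measurable_mid[OF q(1)] wt_measurable])
    have "has_bochner_integral (leb I) (\<lambda>u. wt I B \<theta> (mid q u)) (2 ^ card I * mass I B \<theta>)"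
      by (rule has_bochner_integral_nn_integral[OF m _ _ e]) (auto simp: wt_nonneg mass_nonneg)
    then show "integrable (leb I) (\<lambda>u. wt I B \<theta> (mid q u))"
      "(\<integral>u. wt I B \<theta> (mid q u) \<partial>leb I) = 2 ^ card I * mass I B \<theta>"
      by (auto simp: has_bochner_integral_iff)
  qed
  have dec: "(1 + (lin I \<theta> p - lin I \<theta> u) / 2 - X) * wt I B \<theta> u
      = (1 + lin I \<theta> p / 2 - X) * wt I B \<theta> u - (1/2) * (lin I \<theta> u * wt I B \<theta> u)" for u
    by (simp add: algebra_simps diff_divide_distrib)
  have "(\<integral>u. exp X * ((1 + (lin I \<theta> p - lin I \<theta> u) / 2 - X) * wt I B \<theta> u) \<partial>leb I)
    = exp X * ((1 + lin I \<theta> p / 2 - X) * mass I B \<theta> - (1/2) * (\<integral>u. lin I \<theta> u * wt I B \<theta> u \<partial>leb I))"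
    unfolding dec by (simp add: integrable_lin mass_def)
  also have "\<dots> = exp X * mass I B \<theta>"
    by (simp add: integral_lin[OF Z] X_def field_simps)
  finally have "exp X * mass I B \<theta> \<le> (\<integral>u. wt I B \<theta> (mid q u) \<partial>leb I)"
    using integral_mono[OF _ half(1) pt] dec integrable_lin by simp
  then have "exp X \<le> 2 ^ card I" using Z half(2) by simp
  also have "(2::real) ^ card I \<le> exp 1 ^ card I" using exp_ge_add_one_self[of 1] by (intro power_mono) auto
  also have "\<dots> = exp (real (card I))" by (simp add: exp_of_nat_mult[symmetric])
  finally have "X \<le> real (card I)" by simp
  then show ?thesis by (simp add: X_def field_simps)
qed

text \<open>Inside the box, the corner of side \<open>r / 2\<close> towards which the exponent grows
  already has this mass. The gain linear in the absolute values of the tilt is what makes the primal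
  minimization coercive.\<close>

lemma mass_lower:
  assumes r: "0 < r" and box: "\<And>u. (\<And>j. j \<in> I \<Longrightarrow> \<bar>u j - p j\<bar> \<le> r) \<Longrightarrow> u \<in> B"
  shows "exp (lin I \<theta> p + r / 2 * (\<Sum>j\<in>I. \<bar>\<theta> j\<bar>)) * (r / 2) ^ card I \<le> mass I B \<theta>"
proof -
  define a where "a = (\<lambda>j. if 0 \<le> \<theta> j then p j + r / 2 else p j - r)"
  define b where "b = (\<lambda>j. if 0 \<le> \<theta> j then p j + r else p j - r / 2)"
  let ?K = "\<Pi>\<^sub>E j\<in>I. {a j..b j}"
  let ?e = "exp (lin I \<theta> p + r / 2 * (\<Sum>j\<in>I. \<bar>\<theta> j\<bar>))"
  have K: "?K \<in> sets (leb I)" unfolding leb_def using finI by measurable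
  have "emeasure (leb I) ?K = ennreal (\<Prod>j\<in>I. b j - a j)"
    using r by (intro emeasure_leb_box finI) (auto simp: a_def b_def)
  also have "(\<Prod>j\<in>I. b j - a j) = (\<Prod>j\<in>I. r / 2)"
    by (intro prod.cong) (auto simp: a_def b_def)
  finally have eK: "emeasure (leb I) ?K = ennreal ((r / 2) ^ card I)" by simp
  have "?e * (r / 2) ^ card I = (\<integral>u. ?e * indicator ?K u \<partial>leb I)"
    using eK r K by (simp add: measure_def)
  also have "\<dots> \<le> (\<integral>u. wt I B \<theta> u \<partial>leb I)"
  proof (rule integral_mono)
    show "integrable (leb I) (\<lambda>u. ?e * indicator ?K u)" using K eK by (intro integrable_mult_right integrable_real_indicator) auto
    show "?e * indicator ?K u \<le> wt I B \<theta> u" for u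
    proof (cases "u \<in> ?K")
      case True
      have uj: "a j \<le> u j \<and> u j \<le> b j" if "j \<in> I" for j using True that by (auto simp: PiE_def Pi_def)
      have "u \<in> B"
      proof (rule box)
        show "\<bar>u j - p j\<bar> \<le> r" if "j \<in> I" for j using uj[OF that] r by (auto simp: a_def b_def split: if_splits)
      qed
      moreover have "lin I \<theta> p + r / 2 * (\<Sum>j\<in>I. \<bar>\<theta> j\<bar>) \<le> lin I \<theta> u"
        unfolding lin_def sum_distrib_left sum.distrib[symmetric]
      proof (rule sum_mono)
        fix j assume j: "j \<in> I"
        show "\<theta> j * p j + r / 2 * \<bar>\<theta> j\<bar> \<le> \<theta> j * u j"
        proof (cases "0 \<le> \<theta> j")
          case True
          then have "\<theta> j * (p j + r / 2) \<le> \<theta> j * u j" using uj[OF j] by (intro mult_left_mono) (auto simp: a_def)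
          then show ?thesis using True by (simp add: algebra_simps)
        next
          case False
          then have "\<theta> j * (p j - r / 2) \<le> \<theta> j * u j" using uj[OF j] by (intro mult_left_mono_neg) (auto simp: b_def)
          then show ?thesis using False by (simp add: algebra_simps)
        qed
      qed
      ultimately show ?thesis using True by (simp add: wt_def)
    qed (simp add: wt_nonneg)
  qed auto
  finally show ?thesis by (simp add: mass_def)
qed

lemma mass_upper:
  assumes "\<And>u. u \<in> B \<Longrightarrow> lin I \<theta> u \<le> b" and R: "0 \<le> R"
  shows "mass I B \<theta> \<le> exp b * (2 * R) ^ card I"
proof -
  let ?K = "\<Pi>\<^sub>E j\<in>I. {-R..R}"
  have K: "?K \<in> sets (leb I)" unfolding leb_def using finI by measurable
  have "emeasure (leb I) ?K = ennreal (\<Prod>j\<in>I. R - (-R))"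
    using R by (intro emeasure_leb_box finI) auto
  then have eK: "emeasure (leb I) ?K = ennreal ((2 * R) ^ card I)" by simp
  have "mass I B \<theta> \<le> (\<integral>u. exp b * indicator ?K u \<partial>leb I)"
    unfolding mass_def
  proof (rule integral_mono_AE)
    show "integrable (leb I) (\<lambda>u. exp b * indicator ?K u)" using K eK by (intro integrable_mult_right integrable_real_indicator) auto
    show "AE u in leb I. wt I B \<theta> u \<le> exp b * indicator ?K u"
    proof (rule AE_I2)
      fix u assume u: "u \<in> space (leb I)"
      show "wt I B \<theta> u \<le> exp b * indicator ?K u"
      proof (cases "u \<in> B")
        case True
        have "- R \<le> u j \<and> u j \<le> R" if "j \<in> I" for j using bounded[OF True that] by linarith
        then show ?thesis using True u assms(1)[OF True] by (simp add: space_leb PiE_def wt_def)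
      qed (simp add: wt_def)
    qed
  qed auto
  also have "\<dots> = exp b * (2 * R) ^ card I" using eK R K by (simp add: measure_def)
  finally show ?thesis .
qed

text \<open>Doubling the tilt multiplies each weight by the exponential of the old exponent, and
  \<open>linear_gap\<close> bounds that exponent by its value at the centre.\<close>

lemma mass_double:
  assumes Z: "0 < mass I B \<theta>"
  shows "mass I B (\<lambda>j. 2 * \<theta> j) \<le> exp (lin I \<theta> (centre I B \<theta>) + 2 * real (card I)) * mass I B \<theta>"
proof -
  let ?b = "lin I \<theta> (centre I B \<theta>) + 2 * real (card I)"
  have "mass I B (\<lambda>j. 2 * \<theta> j) \<le> (\<integral>u. exp ?b * wt I B \<theta> u \<partial>leb I)"
    unfolding mass_def
  proof (rule integral_mono)
    show "wt I B (\<lambda>j. 2 * \<theta> j) u \<le> exp ?b * wt I B \<theta> u" for u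
    proof (cases "u \<in> B")
      case True
      then show ?thesis using linear_gap[OF Z True]
        by (simp add: wt_def lin_scale exp_add[symmetric])
    qed (simp add: wt_def)
  qed auto
  then show ?thesis by (simp add: mass_def)
qed

lemma mass_shift_lower:
  "exp (- (R * (\<Sum>j\<in>I. \<bar>\<eta> j\<bar>))) * mass I B \<theta> \<le> mass I B (\<lambda>j. \<theta> j + \<eta> j)"
proof -
  let ?q = "R * (\<Sum>j\<in>I. \<bar>\<eta> j\<bar>)"
  have "exp (- ?q) * mass I B \<theta> = (\<integral>u. exp (- ?q) * wt I B \<theta> u \<partial>leb I)" by (simp add: mass_def)
  also have "\<dots> \<le> mass I B (\<lambda>j. \<theta> j + \<eta> j)"
    unfolding mass_def
  proof (rule integral_mono)
    show "exp (- ?q) * wt I B \<theta> u \<le> wt I B (\<lambda>j. \<theta> j + \<eta> j) u" for u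
    proof (cases "u \<in> B")
      case True
      then show ?thesis using abs_lin_bounded[OF True, of \<eta>]
        by (simp add: wt_def lin_add exp_add[symmetric])
    qed (simp add: wt_def)
  qed auto
  finally show ?thesis .
qed

text \<open>A first-order expansion with quadratic error, as an inequality, so that no integral is
  differentiated. It rests on \<open>exp x \<le> 1 + x + x * x\<close> for \<open>x\<close> between
  -1 and 1.\<close>

lemma ln_mass_perturb:
  assumes Z: "0 < mass I B \<theta>" and small: "R * (\<Sum>j\<in>I. \<bar>\<eta> j\<bar>) \<le> 1"
  shows "ln (mass I B (\<lambda>j. \<theta> j + \<eta> j)) \<le> ln (mass I B \<theta>) + lin I \<eta> (centre I B \<theta>) + (R * (\<Sum>j\<in>I. \<bar>\<eta> j\<bar>))\<^sup>2"
proof -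
  let ?q = "R * (\<Sum>j\<in>I. \<bar>\<eta> j\<bar>)"
  have "mass I B (\<lambda>j. \<theta> j + \<eta> j) \<le> (\<integral>u. (1 + ?q\<^sup>2) * wt I B \<theta> u + lin I \<eta> u * wt I B \<theta> u \<partial>leb I)"
    unfolding mass_def
  proof (rule integral_mono)
    show "wt I B (\<lambda>j. \<theta> j + \<eta> j) u \<le> (1 + ?q\<^sup>2) * wt I B \<theta> u + lin I \<eta> u * wt I B \<theta> u" for u
    proof (cases "u \<in> B")
      case True
      let ?x = "lin I \<eta> u"
      have x: "\<bar>?x\<bar> \<le> ?q" by (rule abs_lin_bounded[OF True])
      have "exp ?x \<le> 1 + ?x + ?x\<^sup>2"
      proof (cases "0 \<le> ?x")
        case True
        then show ?thesis using exp_bound[of ?x] x small by simp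
      next
        case False
        \<comment> \<open>The product is \<open>1 - ?x ^ 3\<close>, and its first factor is at most
          \<open>exp (- ?x)\<close>.\<close>
        have "1 \<le> (1 - ?x) * (1 + ?x + ?x\<^sup>2)" using False
          by (simp add: algebra_simps power2_eq_square) (simp add: mult_le_0_iff zero_le_mult_iff)
        moreover have "1 - ?x \<le> exp (- ?x)" using exp_ge_add_one_self[of "- ?x"] by simp
        moreover have "0 \<le> 1 + ?x + ?x\<^sup>2" using x small by (smt (verit) zero_le_power2)
        ultimately have "1 \<le> exp (- ?x) * (1 + ?x + ?x\<^sup>2)" by (meson mult_right_mono order_trans)
        then have "exp ?x * 1 \<le> exp ?x * (exp (- ?x) * (1 + ?x + ?x\<^sup>2))" by (intro mult_left_mono) auto
        then show ?thesis by (simp add: mult.assoc[symmetric] exp_add[symmetric])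
      qed
      also have "?x\<^sup>2 \<le> ?q\<^sup>2" using x by (simp add: abs_le_square_iff[symmetric])
      finally have "exp ?x * exp (lin I \<theta> u) \<le> (1 + ?x + ?q\<^sup>2) * exp (lin I \<theta> u)" by (intro mult_right_mono) auto
      then show ?thesis using True by (simp add: wt_def lin_add exp_add algebra_simps)
    qed (simp add: wt_def)
  qed (auto intro: integrable_lin)
  also have "\<dots> = (1 + ?q\<^sup>2) * mass I B \<theta> + lin I \<eta> (centre I B \<theta>) * mass I B \<theta>"
    using integral_lin[OF Z] integrable_lin by (simp add: mass_def)
  also have "\<dots> = mass I B \<theta> * (1 + (lin I \<eta> (centre I B \<theta>) + ?q\<^sup>2))" by (simp add: algebra_simps)
  also have "\<dots> \<le> mass I B \<theta> * exp (lin I \<eta> (centre I B \<theta>) + ?q\<^sup>2)"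
    using Z exp_ge_add_one_self by (intro mult_left_mono) auto
  finally have le: "mass I B (\<lambda>j. \<theta> j + \<eta> j) \<le> mass I B \<theta> * exp (lin I \<eta> (centre I B \<theta>) + ?q\<^sup>2)" .
  have "exp (- ?q) * mass I B \<theta> \<le> mass I B (\<lambda>j. \<theta> j + \<eta> j)"
    using mass_shift_lower .
  then have pos: "0 < mass I B (\<lambda>j. \<theta> j + \<eta> j)" using Z by (smt (verit) exp_gt_zero mult_pos_pos)
  have "ln (mass I B (\<lambda>j. \<theta> j + \<eta> j)) \<le> ln (mass I B \<theta> * exp (lin I \<eta> (centre I B \<theta>) + ?q\<^sup>2))"
    using le pos by (subst ln_le_cancel_iff) auto
  then show ?thesis using Z by (simp add: ln_mult)
qed

end

section \<open>Decision trees and protocols\<close>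

text \<open>Protocols are built as finite trees so that parts can be glued at the leaves by
  induction. The blackboard is the path from the root, hence everybody knows the current
  node.\<close>

datatype dtree = Done vec | Ask nat "bool oracle_prog" dtree dtree

primrec out :: "(nat \<Rightarrow> vec \<Rightarrow> vec) \<Rightarrow> dtree \<Rightarrow> vec" where
  "out g (Done v) = v"
| "out g (Ask i p l r) = (if run (g i) p then out g l else out g r)"

primrec cost :: "(nat \<Rightarrow> vec \<Rightarrow> vec) \<Rightarrow> dtree \<Rightarrow> nat" where
  "cost g (Done v) = 0"
| "cost g (Ask i p l r) = Suc (if run (g i) p then cost g l else cost g r)"

primrec speakers :: "dtree \<Rightarrow> nat set" where
  "speakers (Done v) = {}"
| "speakers (Ask i p l r) = insert i (speakers l \<union> speakers r)"

primrec child :: "bool \<Rightarrow> dtree \<Rightarrow> dtree" where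
  "child x (Done v) = Done v"
| "child x (Ask i p l r) = (if x then l else r)"

definition walk :: "dtree \<Rightarrow> bool list \<Rightarrow> dtree" where
  "walk tr b = fold child b tr"

text \<open>The defaults sit where they are never read: no bit is requested at a leaf, and a final
  blackboard never leads to an inner node.\<close>

definition tree_protocol :: "dtree \<Rightarrow> protocol" where
  "tree_protocol tr =
    \<lparr>speaker = \<lambda>b. (case walk tr b of Done v \<Rightarrow> None | Ask i p l r \<Rightarrow> Some i),
     next_bit = \<lambda>i b. (case walk tr b of Done v \<Rightarrow> Return False | Ask i p l r \<Rightarrow> p),
     result = \<lambda>i b. (case walk tr b of Done v \<Rightarrow> Return v | Ask i p l r \<Rightarrow> Return (\<lambda>_. 0))\<rparr>"

lemma speakers_walk: "speakers (walk tr b) \<subseteq> speakers tr"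
proof (induction b arbitrary: tr)
  case (Cons x b)
  have "speakers (child x tr) \<subseteq> speakers tr" by (cases tr) auto
  then show ?case using Cons[of "child x tr"] by (auto simp: walk_def)
qed (simp add: walk_def)

lemma is_protocol_tree: "speakers tr \<subseteq> {..<s} \<Longrightarrow> is_protocol s (tree_protocol tr)"
proof (unfold is_protocol_def, intro allI impI)
  fix b i assume s: "speakers tr \<subseteq> {..<s}" and "speaker (tree_protocol tr) b = Some i"
  then have "i \<in> speakers (walk tr b)" by (cases "walk tr b") (auto simp: tree_protocol_def)
  then show "i < s" using s speakers_walk[of tr b] by auto
qed

text \<open>Generalized from the root to every reachable blackboard, so that induction over the
  remaining subtree applies.\<close>

lemma tree_protocol_final:
  assumes "blackboard (tree_protocol tr) g b"
  shows "\<exists>b'. final_blackboard (tree_protocol tr) g (b @ b') \<and> length b' = cost g (walk tr b)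
     \<and> walk tr (b @ b') = Done (out g (walk tr b))"
  using assms
proof (induction "walk tr b" arbitrary: b)
  case (Done v)
  have w: "walk tr b = Done v" using Done(1) by simp
  show ?case by (rule exI[of _ "[]"]) (simp add: final_blackboard_def tree_protocol_def w Done(2)[unfolded tree_protocol_def])
next
  case (Ask i p l r)
  let ?x = "run (g i) p"
  have sp: "speaker (tree_protocol tr) b = Some i" "next_bit (tree_protocol tr) i b = p"
    using Ask(3)[symmetric] by (auto simp: tree_protocol_def)
  have bb: "blackboard (tree_protocol tr) g (b @ [?x])"
    using blackboard.write_bit[OF Ask(4) sp(1)] sp(2) by simp
  have w: "walk tr (b @ [?x]) = (if ?x then l else r)" using Ask(3)[symmetric] by (simp add: walk_def)
  have "\<exists>b'. final_blackboard (tree_protocol tr) g ((b @ [?x]) @ b') \<and> length b' = cost g (walk tr (b @ [?x]))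
     \<and> walk tr ((b @ [?x]) @ b') = Done (out g (walk tr (b @ [?x])))"
  proof (cases ?x)
    case True
    show ?thesis by (rule Ask(1)[OF _ bb]) (use w in \<open>simp add: True\<close>)
  next
    case False
    show ?thesis by (rule Ask(2)[OF _ bb]) (use w in \<open>simp add: False\<close>)
  qed
  then obtain b' where "final_blackboard (tree_protocol tr) g ((b @ [?x]) @ b')"
    "length b' = cost g (walk tr (b @ [?x]))" "walk tr ((b @ [?x]) @ b') = Done (out g (walk tr (b @ [?x])))" by blast
  then show ?case unfolding Ask(3)[symmetric] w by (intro exI[of _ "?x # b'"]) simp
qed

lemma tree_protocol_run:
  "\<exists>b. final_blackboard (tree_protocol tr) g b \<and> length b = cost g tr
    \<and> (\<forall>i. run (g i) (result (tree_protocol tr) i b) = out g tr)"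
  using tree_protocol_final[OF blackboard.blank, of tr g]
  by (auto simp: walk_def tree_protocol_def)

section \<open>Oracle programs that tabulate finitely many answers\<close>

primrec ask_all :: "vec list \<Rightarrow> ((vec \<Rightarrow> vec) \<Rightarrow> bool) \<Rightarrow> (vec \<Rightarrow> vec) \<Rightarrow> bool oracle_prog" where
  "ask_all [] F tab = Return (F tab)"
| "ask_all (x # xs) F tab = Query x (\<lambda>v. ask_all xs F (tab(x := v)))"

lemma run_ask_all: "run g (ask_all xs F tab) = F (\<lambda>x. if x \<in> set xs then g x else tab x)"
proof (induction xs arbitrary: tab)
  case (Cons x xs)
  show ?case by (simp add: Cons) (rule arg_cong[of _ _ F], auto)
qed simp

definition determined_on :: "vec set \<Rightarrow> ((vec \<Rightarrow> vec) \<Rightarrow> 'a) \<Rightarrow> bool" where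
  "determined_on G F \<longleftrightarrow> (\<forall>g g'. (\<forall>x\<in>G. g x = g' x) \<longrightarrow> F g = F g')"

lemma determined_on_comp: "determined_on G F \<Longrightarrow> determined_on G (\<lambda>g. k (F g))"
  unfolding determined_on_def by metis

text \<open>Query all of \<open>G\<close>, then apply \<open>F\<close> to the table of answers.
  Local computations may therefore use choice and exact real arithmetic as long as they look at
  finitely many answers.\<close>

lemma determined_on_run:
  assumes "finite G" "determined_on G F"
  shows "\<exists>p. \<forall>g. run g p = (F g :: bool)"
proof -
  obtain xs where xs: "set xs = G" using assms(1) finite_list by auto
  have "run g (ask_all xs F (\<lambda>_ _. 0)) = F g" for g
    unfolding run_ask_all by (rule assms(2)[unfolded determined_on_def, rule_format]) (simp add: xs)
  then show ?thesis by blast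
qed

text \<open>\<open>Q\<close> collects the oracle tuples that are still possible, \<open>b\<close> bounds the number of further bits.\<close>

definition solvable :: "nat \<Rightarrow> ((nat \<Rightarrow> vec \<Rightarrow> vec) \<Rightarrow> vec \<Rightarrow> bool) \<Rightarrow> (nat \<Rightarrow> vec \<Rightarrow> vec) set \<Rightarrow> real \<Rightarrow> bool" where
  "solvable s good Q b \<longleftrightarrow>
    (\<exists>tr. speakers tr \<subseteq> {..<s} \<and> (\<forall>g\<in>Q. good g (out g tr) \<and> real (cost g tr) \<le> b))"

lemma solvable_empty: "solvable s good {} b"
  unfolding solvable_def by (rule exI[of _ "Done (\<lambda>_. 0)"]) simp

lemma solvable_output: "(\<And>g. g \<in> Q \<Longrightarrow> good g \<theta>) \<Longrightarrow> 0 \<le> b \<Longrightarrow> solvable s good Q b"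
  unfolding solvable_def by (rule exI[of _ "Done \<theta>"]) simp

lemma solvable_mono: "solvable s good Q b \<Longrightarrow> b \<le> b' \<Longrightarrow> solvable s good Q b'"
  unfolding solvable_def by (meson order_trans)

lemma solvable_bit:
  assumes "finite G" "determined_on G F" "i < s"
    and "solvable s good {g \<in> Q. F (g i)} b" "solvable s good {g \<in> Q. \<not> F (g i)} b"
  shows "solvable s good Q (b + 1)"
proof -
  obtain p where p: "run g p = F g" for g using determined_on_run[OF assms(1,2)] by blast
  obtain l r where "speakers l \<subseteq> {..<s}" "speakers r \<subseteq> {..<s}"
    "\<And>g. g \<in> Q \<Longrightarrow> F (g i) \<Longrightarrow> good g (out g l) \<and> real (cost g l) \<le> b"
    "\<And>g. g \<in> Q \<Longrightarrow> \<not> F (g i) \<Longrightarrow> good g (out g r) \<and> real (cost g r) \<le> b"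
    using assms(4,5) unfolding solvable_def by blast
  then show ?thesis using assms(3) p unfolding solvable_def
    by (intro exI[of _ "Ask i p l r"]) auto
qed

text \<open>Transmission by bisection: each bit tells whether the message lies in a chosen subset
  \<open>V1\<close>, and both parts are small enough for one bit less.\<close>

lemma solvable_message:
  assumes "finite G" "determined_on G m" "i < s"
    and "finite V" "card V \<le> 2 ^ k" "\<And>g. g \<in> Q \<Longrightarrow> m (g i) \<in> V"
    and "\<And>v. v \<in> V \<Longrightarrow> solvable s good {g \<in> Q. m (g i) = v} b"
  shows "solvable s good Q (b + real k)"
  using assms(4-7)
proof (induction k arbitrary: V Q)
  case 0
  show ?case
  proof (cases "V = {}")
    case True
    then have "Q = {}" using 0(3) by auto
    then show ?thesis by (simp add: solvable_empty)
  next
    case False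
    then have "card V = 1" using 0(1,2) by (simp add: card_gt_0_iff le_antisym Suc_leI)
    then obtain v where v: "V = {v}" using card_1_singletonE by blast
    then have "{g \<in> Q. m (g i) = v} = Q" using 0(3) by auto
    then show ?thesis using 0(4)[of v] v by simp
  qed
next
  case (Suc k)
  obtain V1 where V1: "V1 \<subseteq> V" "card V1 = min (card V) (2 ^ k)"
    using obtain_subset_with_card_n[of "min (card V) (2 ^ k)" V] by auto
  have V2: "card (V - V1) \<le> 2 ^ k" using V1 Suc(2,3) finite_subset[OF V1(1)] by (simp add: card_Diff_subset)
  have "solvable s good Q (b + real k + 1)"
  proof (rule solvable_bit[OF assms(1) _ assms(3)])
    show "determined_on G (\<lambda>g. m g \<in> V1)" using assms(2) by (rule determined_on_comp)
    show "solvable s good {g \<in> Q. m (g i) \<in> V1} (b + real k)"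
    proof (rule Suc.IH)
      fix v assume v: "v \<in> V1"
      then have "{g \<in> {g \<in> Q. m (g i) \<in> V1}. m (g i) = v} = {g \<in> Q. m (g i) = v}" by auto
      then show "solvable s good {g \<in> {g \<in> Q. m (g i) \<in> V1}. m (g i) = v} b" using Suc(5)[of v] v V1 by auto
    qed (use V1 finite_subset[OF V1(1) Suc(2)] in auto)
    show "solvable s good {g \<in> Q. m (g i) \<notin> V1} (b + real k)"
    proof (rule Suc.IH)
      fix v assume v: "v \<in> V - V1"
      then have "{g \<in> {g \<in> Q. m (g i) \<notin> V1}. m (g i) = v} = {g \<in> Q. m (g i) = v}" by auto
      then show "solvable s good {g \<in> {g \<in> Q. m (g i) \<notin> V1}. m (g i) = v} b" using Suc(5)[of v] v by auto
    qed (use V2 Suc(2) Suc(4) in auto)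
  qed
  then show ?case by (simp add: ac_simps)
qed

section \<open>Minimizers\<close>

text \<open>A box with zeros outside \<open>E\<close> is compact by Tychonoff, and a Lipschitz bound
  in finitely many coordinates implies continuity in the product topology. The index type stays open
  since pairs and single coordinates both occur.\<close>

lemma attains_min:
  fixes F :: "('k \<Rightarrow> real) \<Rightarrow> real"
  assumes "finite E" and lip: "\<And>a b. \<bar>F a - F b\<bar> \<le> L * (\<Sum>e\<in>E. \<bar>a e - b e\<bar>)"
    and cl: "closed W" and a0: "a0 \<in> W" "\<And>e. e \<in> E \<Longrightarrow> \<bar>a0 e\<bar> \<le> C" "\<And>e. e \<notin> E \<Longrightarrow> a0 e = 0"
  shows "\<exists>a\<in>W. (\<forall>e\<in>E. \<bar>a e\<bar> \<le> C) \<and> (\<forall>e. e \<notin> E \<longrightarrow> a e = 0) \<and>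
    (\<forall>b\<in>W. (\<forall>e\<in>E. \<bar>b e\<bar> \<le> C) \<longrightarrow> (\<forall>e. e \<notin> E \<longrightarrow> b e = 0) \<longrightarrow> F a \<le> F b)"
proof -
  let ?X = "\<lambda>e. if e \<in> E then {-C..C} else {0::real}"
  have "compactin (product_topology (\<lambda>_::'k. euclidean) UNIV) (\<Pi>\<^sub>E e\<in>UNIV. ?X e)"
    by (subst compactin_PiE) auto
  then have comp: "compact (\<Pi>\<^sub>E e\<in>UNIV. ?X e)" by (simp add: euclidean_product_topology)
  let ?S = "(\<Pi>\<^sub>E e\<in>UNIV. ?X e) \<inter> W"
  have cS: "compact ?S" using comp cl by (rule compact_Int_closed)
  have mem: "b \<in> ?S \<longleftrightarrow> b \<in> W \<and> (\<forall>e\<in>E. \<bar>b e\<bar> \<le> C) \<and> (\<forall>e. e \<notin> E \<longrightarrow> b e = 0)" for b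
    by (auto simp: PiE_iff abs_le_iff split: if_splits)
  have "continuous_on UNIV F"
    unfolding continuous_on_def
  proof
    fix a :: "'k \<Rightarrow> real"
    have co: "((\<lambda>b. b e) \<longlongrightarrow> a e) (at a within UNIV)" for e
      using continuous_on_product_coordinates[of e] unfolding continuous_on_def by auto
    have "((\<lambda>b. L * (\<Sum>e\<in>E. \<bar>b e - a e\<bar>)) \<longlongrightarrow> L * (\<Sum>e\<in>E. \<bar>a e - a e\<bar>)) (at a within UNIV)"
      by (intro tendsto_intros co)
    then have lim: "((\<lambda>b. L * (\<Sum>e\<in>E. \<bar>b e - a e\<bar>)) \<longlongrightarrow> 0) (at a within UNIV)" by simp
    have "\<forall>\<^sub>F b in at a within UNIV. norm (F b - F a) \<le> L * (\<Sum>e\<in>E. \<bar>b e - a e\<bar>)"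
      by (rule always_eventually) (simp add: lip)
    then have "((\<lambda>b. F b - F a) \<longlongrightarrow> 0) (at a within UNIV)" using lim by (rule Lim_null_comparison)
    then show "(F \<longlongrightarrow> F a) (at a within UNIV)" by (rule LIM_zero_cancel)
  qed
  then have cont: "continuous_on ?S F" by (rule continuous_on_subset) simp
  have "a0 \<in> ?S" unfolding mem using a0 by simp
  then have "?S \<noteq> {}" by (metis empty_iff)
  from continuous_attains_inf[OF cS this cont]
  obtain a where a: "a \<in> ?S" "\<And>b. b \<in> ?S \<Longrightarrow> F a \<le> F b" by (elim bexE) (rule that, assumption, erule (1) bspec)
  show ?thesis
  proof (intro bexI[of _ a] conjI ballI impI)
    fix b assume "b \<in> W" "\<forall>e\<in>E. \<bar>b e\<bar> \<le> C" "\<forall>e. e \<notin> E \<longrightarrow> b e = 0"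
    then have "b \<in> ?S" unfolding mem by simp
    then show "F a \<le> F b" by (rule a(2))
  qed (use a(1)[unfolded mem] in blast)+
qed

text \<open>For small \<open>s\<close> the quadratic error cannot outweigh a negative slope; the
  chosen \<open>s\<close> keeps it below half of the slope.\<close>

lemma first_order_nonneg:
  fixes G c :: real
  assumes "0 < s0" "\<And>s. 0 < s \<Longrightarrow> s \<le> s0 \<Longrightarrow> 0 \<le> s * G + s\<^sup>2 * c"
  shows "0 \<le> G"
proof (rule ccontr)
  assume n: "\<not> 0 \<le> G"
  define s where "s = min s0 (- G / (2 * (\<bar>c\<bar> + 1)))"
  have s: "0 < s" "s \<le> s0" using n assms(1) by (auto simp: s_def intro!: divide_neg_pos)
  have "s * \<bar>c\<bar> \<le> - G / (2 * (\<bar>c\<bar> + 1)) * (\<bar>c\<bar> + 1)" using s n by (intro mult_mono) (auto simp: s_def)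
  also have "\<dots> = - G / 2" by (simp add: field_simps)
  finally have sc: "s * \<bar>c\<bar> \<le> - G / 2" .
  have "0 \<le> s * (G + s * c)" using assms(2)[OF s] by (simp add: power2_eq_square algebra_simps)
  then have "0 \<le> G + s * c" using s by (simp add: zero_le_mult_iff)
  moreover have "s * c \<le> s * \<bar>c\<bar>" using s by (intro mult_left_mono) auto
  ultimately show False using sc n by linarith
qed

section \<open>Cuts\<close>

context convex_body
begin

text \<open>Halfspaces are preimages of intervals under a linear functional, so open and closed cuts
  share one proof.\<close>

lemma cut_convex:
  assumes S: "S \<in> sets borel" "\<And>x y. x \<in> S \<Longrightarrow> y \<in> S \<Longrightarrow> (x + y) / 2 \<in> S"
  shows "convex_body I R (B \<inter> {u. lin I c u \<in> S})"
proof
  have "{u \<in> extensional I. u \<in> B \<inter> {u. lin I c u \<in> S}} = {u \<in> extensional I. u \<in> B} \<inter> (lin I c -` S \<inter> space (leb I))"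
    by (auto simp: space_leb)
  also have "\<dots> \<in> sets (leb I)" by (rule sets.Int[OF meas measurable_sets[OF lin_meas S(1)]])
  finally show "{u \<in> extensional I. u \<in> B \<inter> {u. lin I c u \<in> S}} \<in> sets (leb I)" .
  show "mid u v \<in> B \<inter> {u. lin I c u \<in> S}" if "u \<in> B \<inter> {u. lin I c u \<in> S}" "v \<in> B \<inter> {u. lin I c u \<in> S}" for u v
    using that S(2) by (auto simp: midpoint lin_mid)
  show "v \<in> B \<inter> {u. lin I c u \<in> S}" if "u \<in> B \<inter> {u. lin I c u \<in> S}" "\<And>j. j \<in> I \<Longrightarrow> u j = v j" for u v
    using that local[of u v] lin_cong[of I u v c] by auto
qed (use finI bounded in auto)

lemma cut_lt: "convex_body I R (B \<inter> {u. lin I c u < b})"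
  using cut_convex[of "{..<b}" c] by simp

lemma cut_le: "convex_body I R (B \<inter> {u. lin I c u \<le> b})"
  using cut_convex[of "{..b}" c] by simp

lemma ln_mass_lipschitz:
  assumes Z: "0 < mass I B \<theta>" "0 < mass I B \<eta>"
  shows "\<bar>ln (mass I B \<theta>) - ln (mass I B \<eta>)\<bar> \<le> R * (\<Sum>j\<in>I. \<bar>\<theta> j - \<eta> j\<bar>)"
proof -
  have one: "ln (mass I B \<theta>) - ln (mass I B \<eta>) \<le> R * (\<Sum>j\<in>I. \<bar>\<theta> j - \<eta> j\<bar>)"
    if Z: "0 < mass I B \<theta>" "0 < mass I B \<eta>" for \<theta> \<eta>
  proof -
    let ?q = "R * (\<Sum>j\<in>I. \<bar>\<eta> j - \<theta> j\<bar>)"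
    have "exp (- ?q) * mass I B \<theta> \<le> mass I B \<eta>" using mass_shift_lower[of "\<lambda>j. \<eta> j - \<theta> j" \<theta>] by simp
    then have "ln (exp (- ?q) * mass I B \<theta>) \<le> ln (mass I B \<eta>)" using Z by (subst ln_le_cancel_iff) auto
    then show ?thesis using Z by (simp add: ln_mult abs_minus_commute)
  qed
  show ?thesis using one[OF Z] one[OF Z(2,1)] by (simp add: abs_le_iff abs_minus_commute)
qed

end

lemma convex_body_box:
  assumes "finite I" "\<And>j. j \<in> I \<Longrightarrow> c j \<le> R"
  shows "convex_body I R {u. \<forall>j\<in>I. \<bar>u j\<bar> \<le> c j}"
proof
  have "{u \<in> extensional I. u \<in> {u. \<forall>j\<in>I. \<bar>u j\<bar> \<le> c j}} = (\<Pi>\<^sub>E j\<in>I. {- c j..c j})"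
    by (auto simp: PiE_def Pi_def abs_le_iff minus_le_iff)
  then show "{u \<in> extensional I. u \<in> {u. \<forall>j\<in>I. \<bar>u j\<bar> \<le> c j}} \<in> sets (leb I)"
    unfolding leb_def using assms(1) by simp
  show "mid u v \<in> {u. \<forall>j\<in>I. \<bar>u j\<bar> \<le> c j}" if "u \<in> {u. \<forall>j\<in>I. \<bar>u j\<bar> \<le> c j}" "v \<in> {u. \<forall>j\<in>I. \<bar>u j\<bar> \<le> c j}" for u v
    unfolding mid_def
  proof (clarify)
    fix j assume "j \<in> I"
    then have "\<bar>u j\<bar> \<le> c j" "\<bar>v j\<bar> \<le> c j" using that by auto
    then have "\<bar>u j + v j\<bar> \<le> 2 * c j" by linarith
    then show "\<bar>(u j + v j) / 2\<bar> \<le> c j" by simp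
  qed
qed (use assms in \<open>auto intro: order_trans\<close>)

section \<open>Centres of the primal and the dual bodies\<close>

text \<open>Machine \<open>i\<close> works with the coordinates \<open>T i\<close> and the additional coordinate \<open>d\<close>, which carries
  the function value. The weight \<open>w i\<close> is proportional to the number of bits of a message of \<open>i\<close>.\<close>

locale game =
  fixes A :: "nat set" and T :: "nat \<Rightarrow> nat set" and w :: "nat \<Rightarrow> real" and d :: nat
  assumes finA: "finite A" and T_sub: "i \<in> A \<Longrightarrow> T i \<subseteq> {..<d}"
    and w1: "i \<in> A \<Longrightarrow> 1 \<le> w i" and card_T: "i \<in> A \<Longrightarrow> real (card (T i)) \<le> w i"
begin

definition I :: "nat \<Rightarrow> nat set" where
  "I i = insert d (T i)"

text \<open>The division by \<open>w i\<close> cancels the weight in \<open>psi\<close>, so that the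
  derivative of \<open>psi\<close> adds the centres of all machines with the same factor
  \<open>t\<close>.\<close>

definition tilt :: "real \<Rightarrow> (nat \<Rightarrow> vec) \<Rightarrow> nat \<Rightarrow> vec" where
  "tilt t \<alpha> i = (\<lambda>j. t / w i * (if j = d then -1 else \<alpha> i j))"

abbreviation Z :: "(nat \<Rightarrow> vec set) \<Rightarrow> real \<Rightarrow> (nat \<Rightarrow> vec) \<Rightarrow> nat \<Rightarrow> real" where
  "Z B t \<alpha> i \<equiv> mass (I i) (B i) (tilt t \<alpha> i)"

definition psi :: "(nat \<Rightarrow> vec set) \<Rightarrow> real \<Rightarrow> (nat \<Rightarrow> vec) \<Rightarrow> real" where
  "psi B t \<alpha> = (\<Sum>i\<in>A. w i * ln (Z B t \<alpha> i))"

text \<open>Lagrange multipliers for the constraint that all machines sharing a coordinate use the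
  same value there.\<close>

definition bal :: "(nat \<Rightarrow> vec) set" where
  "bal = {a. \<forall>j. (\<Sum>i | i \<in> A \<and> j \<in> T i. a i j) = 0}"

text \<open>Points within Euclidean distance \<open>D\<close> of the start lie in a cube of
  half-width \<open>D\<close>; this is that cube after rescaling.\<close>

definition cube :: "vec set" where
  "cube = {x. (\<forall>j<d. \<bar>x j\<bar> \<le> 1) \<and> (\<forall>j\<ge>d. x j = 0)}"

definition cen :: "(nat \<Rightarrow> vec set) \<Rightarrow> real \<Rightarrow> (nat \<Rightarrow> vec) \<Rightarrow> nat \<Rightarrow> vec" where
  "cen B t \<alpha> i = centre (I i) (B i) (tilt t \<alpha> i)"

definition bodies :: "(nat \<Rightarrow> vec set) \<Rightarrow> bool" where
  "bodies B \<longleftrightarrow> (\<forall>i\<in>A. convex_body (I i) (8 * w i) (B i))"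

text \<open>A box in every body makes all masses positive, as the logarithms in \<open>psi\<close>
  require.\<close>

definition fat :: "(nat \<Rightarrow> vec set) \<Rightarrow> bool" where
  "fat B \<longleftrightarrow> (\<forall>i\<in>A. \<exists>p r. 0 < r \<and> (\<forall>u. (\<forall>j\<in>I i. \<bar>u j - p j\<bar> \<le> r) \<longrightarrow> u \<in> B i))"

lemma finT: "i \<in> A \<Longrightarrow> finite (T i)"
  using T_sub finite_subset by blast

lemma d_notin: "i \<in> A \<Longrightarrow> d \<notin> T i"
  using T_sub by fastforce

lemma card_I: "i \<in> A \<Longrightarrow> real (card (I i)) \<le> 2 * w i"
  using finT d_notin card_T[of i] w1[of i] by (simp add: I_def)

lemma w_pos: "i \<in> A \<Longrightarrow> 0 < w i"
  using w1 by fastforce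

lemma bodyD: "bodies B \<Longrightarrow> i \<in> A \<Longrightarrow> convex_body (I i) (8 * w i) (B i)"
  by (simp add: bodies_def)

lemma mass_pos: "bodies B \<Longrightarrow> fat B \<Longrightarrow> i \<in> A \<Longrightarrow> 0 < mass (I i) (B i) \<theta>"
proof -
  assume b: "bodies B" "fat B" "i \<in> A"
  then interpret convex_body "I i" "8 * w i" "B i" by (simp add: bodyD)
  obtain p r where r: "0 < r" "\<And>u. (\<And>j. j \<in> I i \<Longrightarrow> \<bar>u j - p j\<bar> \<le> r) \<Longrightarrow> u \<in> B i"
    using b unfolding fat_def by blast
  have "0 < exp (lin (I i) \<theta> p + r / 2 * (\<Sum>j\<in>I i. \<bar>\<theta> j\<bar>)) * (r / 2) ^ card (I i)" using r(1) by simp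
  also have "\<dots> \<le> mass (I i) (B i) \<theta>" by (rule mass_lower[OF r])
  finally show ?thesis .
qed

lemma sum_I: "i \<in> A \<Longrightarrow> (\<Sum>j\<in>I i. f j) = f d + (\<Sum>j\<in>T i. f j)" for f :: "nat \<Rightarrow> real"
  using finT d_notin by (simp add: I_def)

lemma lin_I: "i \<in> A \<Longrightarrow> lin (I i) c u = c d * u d + lin (T i) c u"
  by (simp add: lin_def sum_I)

lemma lin_tilt: "i \<in> A \<Longrightarrow> lin (I i) (tilt t \<alpha> i) u = t / w i * (lin (T i) (\<alpha> i) u - u d)"
proof -
  assume i: "i \<in> A"
  have "lin (T i) (tilt t \<alpha> i) u = (\<Sum>j\<in>T i. t / w i * (\<alpha> i j * u j))"
    unfolding lin_def tilt_def using d_notin[OF i] by (intro sum.cong) auto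
  also have "\<dots> = t / w i * lin (T i) (\<alpha> i) u" unfolding lin_def sum_distrib_left[symmetric] ..
  finally show ?thesis unfolding lin_I[OF i] by (simp add: tilt_def right_diff_distrib)
qed

lemma psi_cong: "(\<And>i j. i \<in> A \<Longrightarrow> j \<in> T i \<Longrightarrow> a i j = b i j) \<Longrightarrow> psi B t a = psi B t b"
proof -
  assume e: "\<And>i j. i \<in> A \<Longrightarrow> j \<in> T i \<Longrightarrow> a i j = b i j"
  have "wt (I i) (B i) (tilt t a i) = wt (I i) (B i) (tilt t b i)" if "i \<in> A" for i
  proof
    fix u
    have "lin (T i) (a i) u = lin (T i) (b i) u" using e[OF that] by (simp add: lin_def)
    then show "wt (I i) (B i) (tilt t a i) u = wt (I i) (B i) (tilt t b i) u"
      by (simp add: wt_def lin_tilt[OF that])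
  qed
  then show ?thesis by (simp add: psi_def mass_def)
qed

lemma psi_lipschitz:
  assumes b: "bodies B" "fat B" and t: "0 \<le> t"
  shows "\<bar>psi B t a - psi B t b\<bar> \<le> (\<Sum>i\<in>A. 8 * t * w i) * (\<Sum>(i, j)\<in>Sigma A T. \<bar>a i j - b i j\<bar>)"
proof -
  have "\<bar>psi B t a - psi B t b\<bar> \<le> (\<Sum>i\<in>A. \<bar>w i * (ln (Z B t a i) - ln (Z B t b i))\<bar>)"
    unfolding psi_def sum_subtractf[symmetric] right_diff_distrib[symmetric] by (rule sum_abs)
  also have "\<dots> \<le> (\<Sum>i\<in>A. (\<Sum>i\<in>A. 8 * t * w i) * (\<Sum>j\<in>T i. \<bar>a i j - b i j\<bar>))"
  proof (rule sum_mono)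
    fix i assume i: "i \<in> A"
    interpret convex_body "I i" "8 * w i" "B i" using b i by (simp add: bodyD)
    have "\<bar>ln (Z B t a i) - ln (Z B t b i)\<bar>
        \<le> 8 * w i * (\<Sum>j\<in>I i. \<bar>tilt t a i j - tilt t b i j\<bar>)"
      by (intro ln_mass_lipschitz mass_pos b i)
    also have "(\<Sum>j\<in>I i. \<bar>tilt t a i j - tilt t b i j\<bar>) = (\<Sum>j\<in>T i. t / w i * \<bar>a i j - b i j\<bar>)"
    proof -
      have df: "tilt t a i j - tilt t b i j = (if j = d then 0 else t / w i * (a i j - b i j))" for j
        by (simp add: tilt_def right_diff_distrib)
      show ?thesis unfolding sum_I[OF i] df using d_notin[OF i] t w_pos[OF i]
        by (simp add: abs_mult) (intro sum.cong, auto simp: abs_mult)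
    qed
    also have "\<dots> = t / w i * (\<Sum>j\<in>T i. \<bar>a i j - b i j\<bar>)" by (rule sum_distrib_left[symmetric])
    finally have "w i * \<bar>ln (Z B t a i) - ln (Z B t b i)\<bar>
       \<le> w i * (8 * w i * (t / w i * (\<Sum>j\<in>T i. \<bar>a i j - b i j\<bar>)))"
      using w_pos[OF i] by (intro mult_left_mono) auto
    also have "\<dots> = (8 * t * w i) * (\<Sum>j\<in>T i. \<bar>a i j - b i j\<bar>)" using w_pos[OF i] by simp
    also have "\<dots> \<le> (\<Sum>i\<in>A. 8 * t * w i) * (\<Sum>j\<in>T i. \<bar>a i j - b i j\<bar>)"
    proof (rule mult_right_mono)
      show "8 * t * w i \<le> (\<Sum>i\<in>A. 8 * t * w i)"
        using t w_pos by (intro member_le_sum[OF i _ finA]) (auto simp: less_imp_le)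
    qed (simp add: sum_nonneg)
    finally show "\<bar>w i * (ln (Z B t a i) - ln (Z B t b i))\<bar>
       \<le> (\<Sum>i\<in>A. 8 * t * w i) * (\<Sum>j\<in>T i. \<bar>a i j - b i j\<bar>)"
      using w_pos[OF i] by (simp add: abs_mult)
  qed
  also have "\<dots> = (\<Sum>i\<in>A. 8 * t * w i) * (\<Sum>(i, j)\<in>Sigma A T. \<bar>a i j - b i j\<bar>)"
    using finA finT by (simp add: sum_distrib_left[symmetric] sum.Sigma)
  finally show ?thesis .
qed

text \<open>The expansion \<open>ln_mass_perturb\<close> is summed over the machines; the tilt moves
  by \<open>t / w i\<close> times the direction, so the weights cancel in the linear term.\<close>

lemma first_order:
  assumes b: "bodies B" "fat B" and t: "0 < t"
    and min: "\<And>s. 0 < s \<Longrightarrow> s \<le> 1 \<Longrightarrow> psi B t \<alpha> \<le> psi B t (\<lambda>i j. \<alpha> i j + s * \<beta> i j)"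
  shows "0 \<le> (\<Sum>i\<in>A. lin (T i) (\<beta> i) (cen B t \<alpha> i))"
proof -
  define e where "e = (\<lambda>i. 8 * w i * (t / w i * (\<Sum>j\<in>T i. \<bar>\<beta> i j\<bar>)))"
  have e0: "0 \<le> e i" if "i \<in> A" for i using w_pos[OF that] t by (simp add: e_def sum_nonneg)
  \<comment> \<open>Small enough that \<open>s * e i \<le> 1\<close> for all machines at once, as
    the expansion demands.\<close>
  define s0 where "s0 = 1 / (1 + (\<Sum>i\<in>A. e i))"
  have se: "0 \<le> (\<Sum>i\<in>A. e i)" using e0 by (intro sum_nonneg)
  have s0: "0 < s0" "s0 \<le> 1" using se by (auto simp: s0_def)
  have "0 \<le> t * (\<Sum>i\<in>A. lin (T i) (\<beta> i) (cen B t \<alpha> i))"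
  proof (rule first_order_nonneg[OF s0(1)])
    fix s :: real assume s: "0 < s" "s \<le> s0"
    have "psi B t (\<lambda>i j. \<alpha> i j + s * \<beta> i j) \<le>
      (\<Sum>i\<in>A. w i * ln (Z B t \<alpha> i) + (s * (t * lin (T i) (\<beta> i) (cen B t \<alpha> i)) + s\<^sup>2 * (w i * (e i)\<^sup>2)))"
      unfolding psi_def
    proof (rule sum_mono)
      fix i assume i: "i \<in> A"
      interpret convex_body "I i" "8 * w i" "B i" using b i by (simp add: bodyD)
      let ?\<eta> = "\<lambda>j. if j = d then 0 else s * (t / w i * \<beta> i j)"
      have tl: "tilt t (\<lambda>i j. \<alpha> i j + s * \<beta> i j) i = (\<lambda>j. tilt t \<alpha> i j + ?\<eta> j)"
        by (auto simp: tilt_def fun_eq_iff algebra_simps add_divide_distrib)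
      have "(\<Sum>j\<in>I i. \<bar>?\<eta> j\<bar>) = (\<Sum>j\<in>T i. \<bar>s * (t / w i * \<beta> i j)\<bar>)"
        unfolding sum_I[OF i] using d_notin[OF i] by (simp, intro sum.cong) auto
      also have "\<dots> = s * (t / w i * (\<Sum>j\<in>T i. \<bar>\<beta> i j\<bar>))"
        using s t w_pos[OF i] by (simp add: abs_mult sum_distrib_left)
      finally have q: "8 * w i * (\<Sum>j\<in>I i. \<bar>?\<eta> j\<bar>) = s * e i" by (simp add: e_def)
      have "s * e i \<le> s0 * (\<Sum>i\<in>A. e i)"
        using s s0 e0 i finA by (intro mult_mono member_le_sum) auto
      also have "\<dots> \<le> 1" using se by (simp add: s0_def divide_simps)
      finally have "ln (mass (I i) (B i) (\<lambda>j. tilt t \<alpha> i j + ?\<eta> j)) \<le> ln (Z B t \<alpha> i)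
         + lin (I i) ?\<eta> (cen B t \<alpha> i) + (s * e i)\<^sup>2"
        using ln_mass_perturb[OF mass_pos[OF b i], of ?\<eta>] unfolding q cen_def by blast
      also have "lin (I i) ?\<eta> (cen B t \<alpha> i) = s * (t / w i * lin (T i) (\<beta> i) (cen B t \<alpha> i))"
        unfolding lin_I[OF i] using d_notin[OF i]
        by (simp add: lin_def sum_distrib_left) (intro sum.cong, auto)
      finally have "w i * ln (mass (I i) (B i) (\<lambda>j. tilt t \<alpha> i j + ?\<eta> j)) \<le>
        w i * (ln (Z B t \<alpha> i) + s * (t / w i * lin (T i) (\<beta> i) (cen B t \<alpha> i)) + (s * e i)\<^sup>2)"
        using w_pos[OF i] by (intro mult_left_mono) auto
      also have "\<dots> = w i * ln (Z B t \<alpha> i) + (s * (t * lin (T i) (\<beta> i) (cen B t \<alpha> i)) + s\<^sup>2 * (w i * (e i)\<^sup>2))"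
        using w_pos[OF i] by (simp add: field_simps power_mult_distrib)
      finally show "w i * ln (Z B t (\<lambda>i j. \<alpha> i j + s * \<beta> i j) i) \<le> \<dots>" unfolding tl .
    qed
    also have "\<dots> = psi B t \<alpha> + (s * (t * (\<Sum>i\<in>A. lin (T i) (\<beta> i) (cen B t \<alpha> i))) + s\<^sup>2 * (\<Sum>i\<in>A. w i * (e i)\<^sup>2))"
      by (simp add: psi_def sum.distrib sum_distrib_left)
    finally show "0 \<le> s * (t * (\<Sum>i\<in>A. lin (T i) (\<beta> i) (cen B t \<alpha> i))) + s\<^sup>2 * (\<Sum>i\<in>A. w i * (e i)\<^sup>2)"
      using min[of s] s s0 by linarith
  qed
  then show ?thesis using t by (simp add: zero_le_mult_iff)
qed

text \<open>Coercivity confines the search to a box: a multiplier with an entry beyond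
  \<open>C\<close> has a larger value than the zero multiplier. Inside the box
  \<open>attains_min\<close> applies.\<close>

lemma bal_minimizer:
  assumes b: "bodies B" "fat B" and t: "0 < t" and r: "0 < r"
    and coercive: "\<And>a. a \<in> bal \<Longrightarrow> c0 + r * (\<Sum>(i, j)\<in>Sigma A T. \<bar>a i j\<bar>) \<le> psi B t a"
  shows "\<exists>a\<in>bal. \<forall>b\<in>bal. psi B t a \<le> psi B t b"
proof -
  let ?E = "Sigma A T"
  have finE: "finite ?E" using finA finT by auto
  let ?W = "{a :: nat \<times> nat \<Rightarrow> real. \<forall>j. (\<Sum>i | i \<in> A \<and> j \<in> T i. a (i, j)) = 0}"
  let ?F = "\<lambda>a :: nat \<times> nat \<Rightarrow> real. psi B t (\<lambda>i j. a (i, j))"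
  define C where "C = max 0 ((psi B t (\<lambda>_ _. 0) - c0) / r)"
  have cl: "closed ?W"
    by (intro closed_Collect_all closed_Collect_eq continuous_intros continuous_on_product_coordinates)
  have "\<exists>a\<in>?W. (\<forall>e\<in>?E. \<bar>a e\<bar> \<le> C) \<and> (\<forall>e. e \<notin> ?E \<longrightarrow> a e = 0) \<and>
    (\<forall>b\<in>?W. (\<forall>e\<in>?E. \<bar>b e\<bar> \<le> C) \<longrightarrow> (\<forall>e. e \<notin> ?E \<longrightarrow> b e = 0) \<longrightarrow> ?F a \<le> ?F b)"
  proof (rule attains_min[OF finE _ cl, where L = "\<Sum>i\<in>A. 8 * t * w i" and ?a0.0 = "\<lambda>_. 0"])
    show "\<bar>?F a - ?F b\<bar> \<le> (\<Sum>i\<in>A. 8 * t * w i) * (\<Sum>e\<in>?E. \<bar>a e - b e\<bar>)" for a b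
      using psi_lipschitz[OF b, of t "\<lambda>i j. a (i, j)" "\<lambda>i j. b (i, j)"] t by (simp add: case_prod_beta)
  qed (auto simp: C_def)
  then obtain a where a: "a \<in> ?W" "\<And>b. b \<in> ?W \<Longrightarrow> (\<And>e. e \<in> ?E \<Longrightarrow> \<bar>b e\<bar> \<le> C) \<Longrightarrow> (\<And>e. e \<notin> ?E \<Longrightarrow> b e = 0) \<Longrightarrow> ?F a \<le> ?F b"
    by auto
  have zero: "?F a \<le> psi B t (\<lambda>_ _. 0)" using a(2)[of "\<lambda>_. 0"] by (simp add: C_def)
  show ?thesis
  proof (intro bexI[of _ "\<lambda>i j. a (i, j)"] ballI)
    show "(\<lambda>i j. a (i, j)) \<in> bal" using a(1) by (simp add: bal_def)
    fix b' assume b': "b' \<in> bal"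
    show "?F a \<le> psi B t b'"
    proof (cases "\<forall>(i, j)\<in>?E. \<bar>b' i j\<bar> \<le> C")
      case True
      let ?b = "\<lambda>e. if e \<in> ?E then b' (fst e) (snd e) else 0"
      have "?F a \<le> ?F ?b"
      proof (rule a(2))
        have "(\<Sum>i | i \<in> A \<and> j \<in> T i. ?b (i, j)) = (\<Sum>i | i \<in> A \<and> j \<in> T i. b' i j)" for j
          by (intro sum.cong) auto
        then show "?b \<in> ?W" using b' by (simp add: bal_def)
      qed (use True in auto)
      also have "?F ?b = psi B t b'" by (rule psi_cong) auto
      finally show ?thesis .
    next
      case False
      then obtain i j where ij: "(i, j) \<in> ?E" "C < \<bar>b' i j\<bar>" by auto
      have "(\<lambda>(i, j). \<bar>b' i j\<bar>) (i, j) \<le> (\<Sum>(i, j)\<in>?E. \<bar>b' i j\<bar>)"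
        by (rule member_le_sum[OF ij(1)]) (use finE in auto)
      then have "C < (\<Sum>(i, j)\<in>?E. \<bar>b' i j\<bar>)" using ij(2) by simp
      then have "r * C < r * (\<Sum>(i, j)\<in>?E. \<bar>b' i j\<bar>)" using r by simp
      moreover have "psi B t (\<lambda>_ _. 0) - c0 \<le> r * C" using r by (simp add: C_def max_def field_simps)
      ultimately show ?thesis using coercive[OF b'] zero by linarith
    qed
  qed
qed

lemma cube_minimizer:
  assumes b: "bodies B" "fat B" and t: "0 < t"
  shows "\<exists>x\<in>cube. \<forall>y\<in>cube. psi B t (\<lambda>_. x) \<le> psi B t (\<lambda>_. y)"
proof -
  let ?F = "\<lambda>x. psi B t (\<lambda>_. x)"
  let ?L = "(\<Sum>i\<in>A. 8 * t * w i) * real (card A)"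
  have "\<exists>x\<in>UNIV. (\<forall>e\<in>{..<d}. \<bar>x e\<bar> \<le> 1) \<and> (\<forall>e. e \<notin> {..<d} \<longrightarrow> x e = 0) \<and>
    (\<forall>b\<in>UNIV. (\<forall>e\<in>{..<d}. \<bar>b e\<bar> \<le> 1) \<longrightarrow> (\<forall>e. e \<notin> {..<d} \<longrightarrow> b e = 0) \<longrightarrow> ?F x \<le> ?F b)"
  proof (rule attains_min[where L = ?L and ?a0.0 = "\<lambda>_. 0"])
    fix x y :: vec
    have "(\<Sum>(i, j)\<in>Sigma A T. \<bar>x j - y j\<bar>) = (\<Sum>i\<in>A. \<Sum>j\<in>T i. \<bar>x j - y j\<bar>)"
      using finA finT by (simp add: sum.Sigma)
    also have "\<dots> \<le> (\<Sum>i\<in>A. \<Sum>j<d. \<bar>x j - y j\<bar>)"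
      using T_sub by (intro sum_mono sum_mono2) auto
    finally have le: "(\<Sum>(i, j)\<in>Sigma A T. \<bar>x j - y j\<bar>) \<le> real (card A) * (\<Sum>j<d. \<bar>x j - y j\<bar>)" by simp
    have "\<bar>?F x - ?F y\<bar> \<le> (\<Sum>i\<in>A. 8 * t * w i) * (\<Sum>(i, j)\<in>Sigma A T. \<bar>x j - y j\<bar>)"
      using psi_lipschitz[OF b, of t] t by auto
    also have "\<dots> \<le> (\<Sum>i\<in>A. 8 * t * w i) * (real (card A) * (\<Sum>j<d. \<bar>x j - y j\<bar>))"
      using le t w_pos by (intro mult_left_mono sum_nonneg) (auto simp: less_imp_le)
    finally show "\<bar>?F x - ?F y\<bar> \<le> ?L * (\<Sum>j<d. \<bar>x j - y j\<bar>)" by (simp add: mult.assoc)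
  qed auto
  then show ?thesis unfolding cube_def by (auto simp: not_less)
qed

text \<open>In the linear space \<open>bal\<close> both \<open>c\<close> and \<open>- c\<close> are
  admissible directions, hence equality. The multiplier that is 1 for one machine and -1 for another
  on a shared coordinate then shows that their centres agree there, which defines a common point
  \<open>X\<close>.\<close>

lemma bal_centre:
  assumes b: "bodies B" "fat B" and t: "0 < t" and a: "a \<in> bal" "\<And>b. b \<in> bal \<Longrightarrow> psi B t a \<le> psi B t b"
  shows "c \<in> bal \<Longrightarrow> (\<Sum>i\<in>A. lin (T i) (c i) (cen B t a i)) = 0"
    and "\<exists>X. (\<forall>i\<in>A. \<forall>j\<in>T i. cen B t a i j = X j) \<and> (\<forall>j. (\<forall>i\<in>A. j \<notin> T i) \<longrightarrow> X j = 0)"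
proof -
  have nn: "0 \<le> (\<Sum>i\<in>A. lin (T i) (c i) (cen B t a i))" if "c \<in> bal" for c
  proof (rule first_order[OF b t])
    fix s :: real
    have "(\<lambda>i j. a i j + s * c i j) \<in> bal"
      using a(1) that by (simp add: bal_def sum.distrib sum_distrib_left[symmetric])
    then show "psi B t a \<le> psi B t (\<lambda>i j. a i j + s * c i j)" by (rule a(2))
  qed
  show z: "(\<Sum>i\<in>A. lin (T i) (c i) (cen B t a i)) = 0" if "c \<in> bal" for c
  proof -
    have "(\<lambda>i j. - c i j) \<in> bal" using that by (simp add: bal_def sum_negf)
    from nn[OF this] have "0 \<le> - (\<Sum>i\<in>A. lin (T i) (c i) (cen B t a i))" by (simp add: lin_def sum_negf)
    then show ?thesis using nn[OF that] by simp
  qed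
  have eq: "cen B t a i j = cen B t a i' j" if ij: "i \<in> A" "i' \<in> A" "j \<in> T i" "j \<in> T i'" for i i' j
  proof (cases "i = i'")
    case False
    let ?c = "\<lambda>k l. if l = j then (if k = i then 1 else if k = i' then -1 else 0) else (0::real)"
    have "(\<Sum>k | k \<in> A \<and> l \<in> T k. ?c k l) = 0" for l
    proof (cases "l = j")
      case True
      have "(\<Sum>k | k \<in> A \<and> l \<in> T k. ?c k l) = (\<Sum>k\<in>{i, i'}. ?c k l)"
        using finA ij True by (intro sum.mono_neutral_right) auto
      then show ?thesis using False True by simp
    qed simp
    then have "?c \<in> bal" by (simp add: bal_def)
    from z[OF this] have 0: "(\<Sum>k\<in>A. lin (T k) (?c k) (cen B t a k)) = 0" .
    have lk: "lin (T k) (?c k) (cen B t a k) = (if j \<in> T k then ?c k j * cen B t a k j else 0)" if "k \<in> A" for k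
    proof -
      have "lin (T k) (?c k) (cen B t a k) = (\<Sum>l\<in>T k. if l = j then ?c k j * cen B t a k j else 0)"
        unfolding lin_def by (intro sum.cong) auto
      then show ?thesis using finT[OF that] by simp
    qed
    have "(\<Sum>k\<in>A. lin (T k) (?c k) (cen B t a k)) = (\<Sum>k\<in>{i, i'}. if j \<in> T k then ?c k j * cen B t a k j else 0)"
    proof (rule sum.mono_neutral_cong_right)
      show "\<forall>k\<in>A - {i, i'}. lin (T k) (?c k) (cen B t a k) = 0" using lk by auto
      show "lin (T k) (?c k) (cen B t a k) = (if j \<in> T k then ?c k j * cen B t a k j else 0)" if "k \<in> {i, i'}" for k
        using lk ij that by blast
    qed (use finA ij in auto)
    then show ?thesis using 0 False ij by simp
  qed simp
  let ?X = "\<lambda>j. if \<exists>i\<in>A. j \<in> T i then cen B t a (SOME i. i \<in> A \<and> j \<in> T i) j else 0"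
  show "\<exists>X. (\<forall>i\<in>A. \<forall>j\<in>T i. cen B t a i j = X j) \<and> (\<forall>j. (\<forall>i\<in>A. j \<notin> T i) \<longrightarrow> X j = 0)"
  proof (intro exI[of _ ?X] conjI ballI allI impI)
    fix i j assume ij: "i \<in> A" "j \<in> T i"
    then have "(SOME i. i \<in> A \<and> j \<in> T i) \<in> A \<and> j \<in> T (SOME i. i \<in> A \<and> j \<in> T i)"
      using someI[of "\<lambda>i. i \<in> A \<and> j \<in> T i" i] by blast
    then show "cen B t a i j = ?X j" using eq[of i "SOME i. i \<in> A \<and> j \<in> T i" j] ij by auto
  qed auto
qed

text \<open>The segment from \<open>x\<close> to \<open>y\<close> stays in the convex cube, so only
  a one-sided condition results: \<open>x\<close> minimizes the linear functional given by the sum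
  of the dual centres.\<close>

lemma cube_centre:
  assumes b: "bodies B" "fat B" and t: "0 < t" and x: "x \<in> cube" "\<And>y. y \<in> cube \<Longrightarrow> psi B t (\<lambda>_. x) \<le> psi B t (\<lambda>_. y)"
    and y: "y \<in> cube"
  shows "(\<Sum>i\<in>A. lin (T i) x (cen B t (\<lambda>_. x) i)) \<le> (\<Sum>i\<in>A. lin (T i) y (cen B t (\<lambda>_. x) i))"
proof -
  have "0 \<le> (\<Sum>i\<in>A. lin (T i) (\<lambda>j. y j - x j) (cen B t (\<lambda>_. x) i))"
  proof (rule first_order[OF b t])
    fix s :: real assume s: "0 < s" "s \<le> 1"
    have "\<bar>x j + s * (y j - x j)\<bar> \<le> 1" if "j < d" for j
    proof -
      have "\<bar>(1 - s) * x j + s * y j\<bar> \<le> (1 - s) * \<bar>x j\<bar> + s * \<bar>y j\<bar>"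
        using s by (intro order_trans[OF abs_triangle_ineq]) (simp add: abs_mult)
      also have "\<dots> \<le> (1 - s) * 1 + s * 1" using s x(1) y that by (intro add_mono mult_left_mono) (auto simp: cube_def)
      finally show ?thesis by (simp add: algebra_simps)
    qed
    then have "(\<lambda>j. x j + s * (y j - x j)) \<in> cube" using x(1) y by (simp add: cube_def)
    then show "psi B t (\<lambda>_. x) \<le> psi B t (\<lambda>i j. x j + s * (y j - x j))" by (rule x(2))
  qed
  then show ?thesis by (simp add: lin_def left_diff_distrib sum_subtractf)
qed

end

section \<open>The potential\<close>

lemma (in convex_body) ln_mass_lower:
  assumes r: "0 < r" and box: "\<And>u. (\<And>j. j \<in> I \<Longrightarrow> \<bar>u j - p j\<bar> \<le> r) \<Longrightarrow> u \<in> B"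
  shows "lin I \<theta> p + r / 2 * (\<Sum>j\<in>I. \<bar>\<theta> j\<bar>) + real (card I) * ln (r / 2) \<le> ln (mass I B \<theta>)"
proof -
  have "lin I \<theta> p + r / 2 * (\<Sum>j\<in>I. \<bar>\<theta> j\<bar>) + real (card I) * ln (r / 2)
     = ln (exp (lin I \<theta> p + r / 2 * (\<Sum>j\<in>I. \<bar>\<theta> j\<bar>)) * (r / 2) ^ card I)"
    using r by (simp add: ln_mult ln_realpow)
  also have "\<dots> \<le> ln (mass I B \<theta>)"
  proof -
    have le: "exp (lin I \<theta> p + r / 2 * (\<Sum>j\<in>I. \<bar>\<theta> j\<bar>)) * (r / 2) ^ card I \<le> mass I B \<theta>"
      by (rule mass_lower[OF r]) (rule box)
    have pos: "0 < exp (lin I \<theta> p + r / 2 * (\<Sum>j\<in>I. \<bar>\<theta> j\<bar>)) * (r / 2) ^ card I" using r by simp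
    show ?thesis by (rule ln_mono[OF le pos])
  qed
  finally show ?thesis .
qed

context game
begin

text \<open>Normalized convex functions with a choice of subgradients. As the subgradient inequality
  involves only coordinates in \<open>T i\<close>, it also makes \<open>h\<close> depend on these
  alone.\<close>

definition adm :: "nat \<Rightarrow> (vec \<Rightarrow> real) \<Rightarrow> (vec \<Rightarrow> vec) \<Rightarrow> bool" where
  "adm i h \<gamma> \<longleftrightarrow> (\<forall>x y. h x + lin (T i) (\<gamma> x) (\<lambda>j. y j - x j) \<le> h y) \<and>
    (\<forall>x. \<forall>j\<in>T i. \<bar>\<gamma> x j\<bar> \<le> 1) \<and> \<bar>h (\<lambda>_. 0)\<bar> \<le> 1"

text \<open>Slopes of size at most 1 keep \<open>h\<close> within \<open>1 + w i\<close> on the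
  cube. The boxes placed below into this set and into \<open>conj_epi\<close> reach height at most
  \<open>6 * w i\<close>, since \<open>1 \<le> w i\<close>; hence the truncation at
  \<open>8 * w i\<close>.\<close>

definition epi :: "nat \<Rightarrow> (vec \<Rightarrow> real) \<Rightarrow> vec set" where
  "epi i h = {u. (\<forall>j\<in>T i. \<bar>u j\<bar> \<le> 1) \<and> \<bar>u d\<bar> \<le> 8 * w i \<and> h u \<le> u d}"

text \<open>The bound 2 leaves room for a box around each subgradient, whose coordinates are at most 1.\<close>

definition conj_epi :: "nat \<Rightarrow> (vec \<Rightarrow> real) \<Rightarrow> vec set" where
  "conj_epi i h = {v. (\<forall>j\<in>T i. \<bar>v j\<bar> \<le> 2) \<and> \<bar>v d\<bar> \<le> 8 * w i \<and>
    (\<forall>x. (\<forall>j\<in>T i. \<bar>x j\<bar> \<le> 1) \<longrightarrow> lin (T i) x v - h x \<le> v d)}"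

lemma admD:
  assumes "adm i h \<gamma>"
  shows "h x + lin (T i) (\<gamma> x) (\<lambda>j. y j - x j) \<le> h y" "j \<in> T i \<Longrightarrow> \<bar>\<gamma> x j\<bar> \<le> 1" "\<bar>h (\<lambda>_. 0)\<bar> \<le> 1"
  using assms by (auto simp: adm_def)

lemma lin_diff: "lin J c (\<lambda>j. y j - x j) = lin J c y - lin J c x"
  by (simp add: lin_def right_diff_distrib sum_subtractf)

lemma lin_commute: "lin J c u = lin J u c"
  by (simp add: lin_def mult.commute)

lemma abs_lin_le_sum: "(\<And>j. j \<in> J \<Longrightarrow> \<bar>c j\<bar> \<le> 1) \<Longrightarrow> \<bar>lin J c u\<bar> \<le> (\<Sum>j\<in>J. \<bar>u j\<bar>)"
  using abs_lin_le[of J c 1 u] by (simp add: lin_commute)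

lemma sum_T_le: "i \<in> A \<Longrightarrow> (\<And>j. j \<in> T i \<Longrightarrow> f j \<le> r) \<Longrightarrow> 0 \<le> r \<Longrightarrow> (\<Sum>j\<in>T i. f j) \<le> r * w i" for f :: "nat \<Rightarrow> real"
proof -
  assume i: "i \<in> A" and f: "\<And>j. j \<in> T i \<Longrightarrow> f j \<le> r" and r: "0 \<le> r"
  have "(\<Sum>j\<in>T i. f j) \<le> real (card (T i)) * r" using f sum_bounded_above[of "T i" f r] by simp
  also have "\<dots> \<le> w i * r" using card_T[OF i] r by (rule mult_right_mono)
  finally show ?thesis by (simp add: mult.commute)
qed

lemma adm_lipschitz: "adm i h \<gamma> \<Longrightarrow> h u \<le> h v + (\<Sum>j\<in>T i. \<bar>u j - v j\<bar>)"
proof -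
  assume a: "adm i h \<gamma>"
  have "\<bar>lin (T i) (\<gamma> u) (\<lambda>j. v j - u j)\<bar> \<le> (\<Sum>j\<in>T i. \<bar>v j - u j\<bar>)"
    by (rule abs_lin_le_sum) (rule admD(2)[OF a])
  then show ?thesis using admD(1)[OF a, of u v] by (simp add: abs_minus_commute)
qed

lemma adm_bound:
  assumes "i \<in> A" "adm i h \<gamma>" "\<And>j. j \<in> T i \<Longrightarrow> \<bar>x j\<bar> \<le> 1"
  shows "\<bar>h x\<bar> \<le> 1 + w i"
proof -
  have "(\<Sum>j\<in>T i. \<bar>x j\<bar>) \<le> 1 * w i" using assms by (intro sum_T_le) auto
  then show ?thesis
    using adm_lipschitz[OF assms(2), of x "\<lambda>_. 0"] adm_lipschitz[OF assms(2), of "\<lambda>_. 0" x] admD(3)[OF assms(2)]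
    by (simp add: abs_le_iff)
qed

text \<open>Shrinking \<open>x\<close> by the factor \<open>1 - r\<close> leaves room in the cube,
  and lifting by \<open>r * w i + r\<close> absorbs the Lipschitz variation and the radius of the
  box.\<close>

lemma epi_contains_box:
  assumes i: "i \<in> A" and a: "adm i h \<gamma>" and x: "x \<in> cube" and r: "0 < r" "r \<le> 1"
    and u: "\<And>j. j \<in> I i \<Longrightarrow> \<bar>u j - (if j = d then h (\<lambda>j. (1 - r) * x j) + r * w i + r else (1 - r) * x j)\<bar> \<le> r"
  shows "u \<in> epi i h"
proof -
  let ?y = "\<lambda>j. (1 - r) * x j"
  have xj: "\<bar>x j\<bar> \<le> 1" if "j \<in> T i" for j using x T_sub[OF i] that by (auto simp: cube_def)
  have yj: "\<bar>?y j\<bar> \<le> 1 - r" if "j \<in> T i" for j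
    using mult_left_mono[OF xj[OF that], of "1 - r"] r by (simp add: abs_mult)
  have uj: "\<bar>u j - ?y j\<bar> \<le> r" if "j \<in> T i" for j
  proof -
    have "j \<noteq> d" using that d_notin[OF i] by blast
    then show ?thesis using u[of j] that by (simp add: I_def)
  qed
  have ud: "\<bar>u d - (h ?y + r * w i + r)\<bar> \<le> r" using u[of d] by (simp add: I_def)
  have "(\<Sum>j\<in>T i. \<bar>u j - ?y j\<bar>) \<le> r * w i" using uj r by (intro sum_T_le[OF i]) auto
  then have hu: "h u \<le> h ?y + r * w i" using adm_lipschitz[OF a, of u ?y] by simp
  have "\<bar>?y j\<bar> \<le> 1" if "j \<in> T i" for j using yj[OF that] r by linarith
  then have hy: "\<bar>h ?y\<bar> \<le> 1 + w i" by (rule adm_bound[OF i a])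
  have rw: "0 \<le> r * w i" "r * w i \<le> w i" using r w_pos[OF i] by auto
  show ?thesis
    unfolding epi_def
  proof (intro CollectI conjI ballI)
    show "\<bar>u j\<bar> \<le> 1" if "j \<in> T i" for j using uj[OF that] yj[OF that] by linarith
    show "\<bar>u d\<bar> \<le> 8 * w i" using ud hy rw r w1[OF i] by linarith
    show "h u \<le> u d" using hu ud by linarith
  qed
qed

text \<open>The box is centred above the slope \<open>\<gamma> x\<close>, where the conjugate has
  the known value \<open>lin (T i) (\<gamma> x) x - h x\<close>. Changing the slope by
  \<open>r\<close> changes its pairing with cube points by at most \<open>r * w i\<close>, which the
  lift covers.\<close>

lemma conj_epi_contains_box:
  assumes i: "i \<in> A" and a: "adm i h \<gamma>" and x: "x \<in> cube" and r: "0 < r" "r \<le> 1"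
    and u: "\<And>j. j \<in> I i \<Longrightarrow> \<bar>u j - (if j = d then lin (T i) (\<gamma> x) x - h x + r * w i + r else \<gamma> x j)\<bar> \<le> r"
  shows "u \<in> conj_epi i h"
proof -
  have xj: "\<bar>x j\<bar> \<le> 1" if "j \<in> T i" for j using x T_sub[OF i] that by (auto simp: cube_def)
  have uj: "\<bar>u j - \<gamma> x j\<bar> \<le> r" if "j \<in> T i" for j
  proof -
    have "j \<noteq> d" using that d_notin[OF i] by blast
    then show ?thesis using u[of j] that by (simp add: I_def)
  qed
  have ud: "\<bar>u d - (lin (T i) (\<gamma> x) x - h x + r * w i + r)\<bar> \<le> r" using u[of d] by (simp add: I_def)
  have "\<bar>lin (T i) (\<gamma> x) x\<bar> \<le> (\<Sum>j\<in>T i. \<bar>x j\<bar>)" by (rule abs_lin_le_sum) (rule admD(2)[OF a])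
  also have "\<dots> \<le> 1 * w i" using xj by (intro sum_T_le[OF i]) auto
  finally have gx: "\<bar>lin (T i) (\<gamma> x) x\<bar> \<le> w i" by simp
  have hx: "\<bar>h x\<bar> \<le> 1 + w i" using xj by (intro adm_bound[OF i a])
  have rw: "0 \<le> r * w i" "r * w i \<le> w i" using r w_pos[OF i] by auto
  show ?thesis
    unfolding conj_epi_def
  proof (intro CollectI conjI ballI allI impI)
    show "\<bar>u j\<bar> \<le> 2" if "j \<in> T i" for j using uj[OF that] admD(2)[OF a that, of x] r by linarith
    show "\<bar>u d\<bar> \<le> 8 * w i" using ud gx hx rw r w1[OF i] by linarith
    fix y :: vec assume y: "\<forall>j\<in>T i. \<bar>y j\<bar> \<le> 1"
    have "\<bar>lin (T i) y (\<lambda>j. u j - \<gamma> x j)\<bar> \<le> (\<Sum>j\<in>T i. \<bar>u j - \<gamma> x j\<bar>)" by (rule abs_lin_le_sum) (use y in auto)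
    also have "\<dots> \<le> r * w i" using uj r by (intro sum_T_le[OF i]) auto
    finally have "lin (T i) y u \<le> lin (T i) y (\<gamma> x) + r * w i" by (simp add: lin_diff)
    moreover have "h x + (lin (T i) (\<gamma> x) y - lin (T i) (\<gamma> x) x) \<le> h y" using admD(1)[OF a, of x y] by (simp add: lin_diff)
    ultimately show "lin (T i) y u - h y \<le> u d" using ud by (simp add: lin_commute[of _ y] abs_le_iff)
  qed
qed

text \<open>The scale of the total cost: machine \<open>i\<close> contributes a dimension of order
  \<open>w i\<close>, counted with weight \<open>w i\<close>.\<close>

definition M :: real where
  "M = (\<Sum>i\<in>A. (w i)\<^sup>2)"

lemma sum_w_card: "(\<Sum>i\<in>A. w i * real (card (I i))) \<le> 2 * M"
proof -
  have "(\<Sum>i\<in>A. w i * real (card (I i))) \<le> (\<Sum>i\<in>A. 2 * (w i)\<^sup>2)"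
  proof (rule sum_mono)
    fix i assume i: "i \<in> A"
    show "w i * real (card (I i)) \<le> 2 * (w i)\<^sup>2"
      using mult_left_mono[OF card_I[OF i], of "w i"] w_pos[OF i] by (simp add: power2_eq_square mult.left_commute)
  qed
  then show ?thesis by (simp add: M_def sum_distrib_left)
qed

lemma sum_w_le: "(\<Sum>i\<in>A. w i) \<le> M"
  unfolding M_def
proof (rule sum_mono)
  fix i assume i: "i \<in> A"
  show "w i \<le> (w i)\<^sup>2" using mult_left_mono[OF w1[OF i], of "w i"] w_pos[OF i] by (simp add: power2_eq_square)
qed

lemma bal_sum:
  assumes "a \<in> bal"
  shows "(\<Sum>i\<in>A. lin (T i) (a i) x) = 0"
proof -
  have "(\<Sum>i\<in>A. lin (T i) (a i) x) = (\<Sum>i\<in>A. \<Sum>j<d. if j \<in> T i then a i j * x j else 0)"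
  proof (rule sum.cong)
    fix i assume i: "i \<in> A"
    have "(\<Sum>j<d. if j \<in> T i then a i j * x j else 0) = (\<Sum>j\<in>{..<d} \<inter> T i. a i j * x j)"
      by (simp add: sum.inter_restrict)
    also have "{..<d} \<inter> T i = T i" using T_sub[OF i] by auto
    finally show "lin (T i) (a i) x = (\<Sum>j<d. if j \<in> T i then a i j * x j else 0)" by (simp add: lin_def)
  qed simp
  also have "\<dots> = (\<Sum>j<d. \<Sum>i\<in>A. if j \<in> T i then a i j * x j else 0)" by (rule sum.swap)
  also have "\<dots> = (\<Sum>j<d. 0)"
  proof (rule sum.cong)
    fix j
    have "(\<Sum>i\<in>A. if j \<in> T i then a i j * x j else 0) = (\<Sum>i | i \<in> A \<and> j \<in> T i. a i j * x j)"
      using finA by (simp add: sum.inter_filter)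
    also have "\<dots> = (\<Sum>i | i \<in> A \<and> j \<in> T i. a i j) * x j" by (simp add: sum_distrib_right)
    also have "\<dots> = 0" using assms by (simp add: bal_def)
    finally show "(\<Sum>i\<in>A. if j \<in> T i then a i j * x j else 0) = 0" .
  qed simp
  finally show ?thesis by simp
qed

definition valid :: "(nat \<Rightarrow> vec set) \<Rightarrow> (nat \<Rightarrow> vec set) \<Rightarrow> (nat \<Rightarrow> vec \<Rightarrow> real) \<Rightarrow> (nat \<Rightarrow> vec \<Rightarrow> vec) \<Rightarrow> bool" where
  "valid P J h \<gamma> \<longleftrightarrow> (\<forall>i\<in>A. adm i (h i) (\<gamma> i) \<and> epi i (h i) \<subseteq> P i \<and> conj_epi i (h i) \<subseteq> J i)"

lemma zero_cube: "(\<lambda>_. 0) \<in> cube"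
  by (simp add: cube_def)

lemma valid_fat:
  assumes v: "valid P J h \<gamma>"
  shows "fat P" "fat J"
proof -
  show "fat P"
    unfolding fat_def
  proof
    fix i assume i: "i \<in> A"
    have a: "adm i (h i) (\<gamma> i)" "epi i (h i) \<subseteq> P i" using v i by (auto simp: valid_def)
    show "\<exists>p r. 0 < r \<and> (\<forall>u. (\<forall>j\<in>I i. \<bar>u j - p j\<bar> \<le> r) \<longrightarrow> u \<in> P i)"
      using epi_contains_box[OF i a(1) zero_cube, of 1] a(2)
      by (intro exI[of _ "\<lambda>j. if j = d then h i (\<lambda>j. (1 - 1) * 0) + 1 * w i + 1 else (1 - 1) * 0"] exI[of _ 1]) auto
  qed
  show "fat J"
    unfolding fat_def
  proof
    fix i assume i: "i \<in> A"
    have a: "adm i (h i) (\<gamma> i)" "conj_epi i (h i) \<subseteq> J i" using v i by (auto simp: valid_def)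
    show "\<exists>p r. 0 < r \<and> (\<forall>u. (\<forall>j\<in>I i. \<bar>u j - p j\<bar> \<le> r) \<longrightarrow> u \<in> J i)"
      using conj_epi_contains_box[OF i a(1) zero_cube, of 1] a(2)
      by (intro exI[of _ "\<lambda>j. if j = d then lin (T i) (\<gamma> i (\<lambda>_. 0)) (\<lambda>_. 0) - h i (\<lambda>_. 0) + 1 * w i + 1 else \<gamma> i (\<lambda>_. 0) j"] exI[of _ 1]) auto
  qed
qed

text \<open>The bound has two uses: with \<open>r = 1\<close> the term in the multipliers gives
  coercivity, with small \<open>r\<close> the other terms bound the potential. The multipliers leave
  no linear contribution because they are evaluated at one common point.\<close>

lemma primal_lower:
  assumes b: "bodies P" and v: "valid P J h \<gamma>" and x: "x \<in> cube" and r: "0 < r" "r \<le> 1" and t: "0 < t" and a: "a \<in> bal"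
  shows "- t * (\<Sum>i\<in>A. h i x + 3 * r * w i) + (\<Sum>i\<in>A. w i * real (card (I i))) * ln (r / 2)
      + r * t / 2 * (\<Sum>(i, j)\<in>Sigma A T. \<bar>a i j\<bar>) \<le> psi P t a"
proof -
  let ?y = "\<lambda>j. (1 - r) * x j"
  have "(\<Sum>i\<in>A. t * (lin (T i) (a i) ?y - (h i x + 3 * r * w i)) + w i * real (card (I i)) * ln (r / 2)
      + r * t / 2 * (\<Sum>j\<in>T i. \<bar>a i j\<bar>)) \<le> psi P t a"
    unfolding psi_def
  proof (rule sum_mono)
    fix i assume i: "i \<in> A"
    have ad: "adm i (h i) (\<gamma> i)" "epi i (h i) \<subseteq> P i" using v i by (auto simp: valid_def)
    interpret convex_body "I i" "8 * w i" "P i" using b i by (simp add: bodyD)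
    let ?p = "\<lambda>j. if j = d then h i ?y + r * w i + r else ?y j"
    have "lin (I i) (tilt t a i) ?p + r / 2 * (\<Sum>j\<in>I i. \<bar>tilt t a i j\<bar>) + real (card (I i)) * ln (r / 2)
       \<le> ln (mass (I i) (P i) (tilt t a i))"
      by (rule ln_mass_lower[OF r(1)]) (use epi_contains_box[OF i ad(1) x r] ad(2) in blast)
    then have "w i * (lin (I i) (tilt t a i) ?p + r / 2 * (\<Sum>j\<in>I i. \<bar>tilt t a i j\<bar>) + real (card (I i)) * ln (r / 2))
       \<le> w i * ln (mass (I i) (P i) (tilt t a i))"
      using w_pos[OF i] by (intro mult_left_mono) auto
    moreover have "w i * lin (I i) (tilt t a i) ?p = t * (lin (T i) (a i) ?y - (h i ?y + r * w i + r))"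
    proof -
      have "lin (T i) (a i) ?p = lin (T i) (a i) ?y" using d_notin[OF i] by (intro lin_cong) auto
      then show ?thesis using w_pos[OF i] by (simp add: lin_tilt[OF i])
    qed
    moreover have "w i * (r / 2 * (\<Sum>j\<in>I i. \<bar>tilt t a i j\<bar>)) \<ge> r * t / 2 * (\<Sum>j\<in>T i. \<bar>a i j\<bar>)"
    proof -
      have "(\<Sum>j\<in>T i. \<bar>tilt t a i j\<bar>) = (\<Sum>j\<in>T i. t / w i * \<bar>a i j\<bar>)"
        using d_notin[OF i] t w_pos[OF i] by (intro sum.cong) (auto simp: tilt_def abs_mult)
      also have "\<dots> = t / w i * (\<Sum>j\<in>T i. \<bar>a i j\<bar>)" by (simp add: sum_distrib_left)
      finally have "(\<Sum>j\<in>I i. \<bar>tilt t a i j\<bar>) \<ge> t / w i * (\<Sum>j\<in>T i. \<bar>a i j\<bar>)" by (simp add: sum_I[OF i])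
      then have "w i * (r / 2 * (\<Sum>j\<in>I i. \<bar>tilt t a i j\<bar>)) \<ge> w i * (r / 2 * (t / w i * (\<Sum>j\<in>T i. \<bar>a i j\<bar>)))"
        using r w_pos[OF i] by (intro mult_left_mono) auto
      then show ?thesis using w_pos[OF i] by simp
    qed
    moreover have "h i ?y + r * w i + r \<le> h i x + 3 * r * w i"
    proof -
      have "(\<Sum>j\<in>T i. \<bar>?y j - x j\<bar>) \<le> r * w i"
      proof (rule sum_T_le[OF i])
        fix j assume j: "j \<in> T i"
        then have "\<bar>x j\<bar> \<le> 1" using x T_sub[OF i] by (auto simp: cube_def)
        then have "r * \<bar>x j\<bar> \<le> r * 1" using r by (intro mult_left_mono) auto
        moreover have "?y j - x j = - (r * x j)" by (simp add: algebra_simps)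
        ultimately show "\<bar>?y j - x j\<bar> \<le> r" using r by (simp add: abs_mult)
      qed (use r in simp)
      moreover have "r \<le> r * w i" using r w1[OF i] by simp
      ultimately show ?thesis using adm_lipschitz[OF ad(1), of ?y x] by linarith
    qed
    then have "t * (lin (T i) (a i) ?y - (h i x + 3 * r * w i)) \<le> t * (lin (T i) (a i) ?y - (h i ?y + r * w i + r))"
      using t by (intro mult_left_mono) auto
    ultimately show "t * (lin (T i) (a i) ?y - (h i x + 3 * r * w i)) + w i * real (card (I i)) * ln (r / 2)
      + r * t / 2 * (\<Sum>j\<in>T i. \<bar>a i j\<bar>) \<le> w i * ln (mass (I i) (P i) (tilt t a i))"
      by (simp add: distrib_left mult.assoc)
  qed
  also have "(\<Sum>i\<in>A. t * (lin (T i) (a i) ?y - (h i x + 3 * r * w i)) + w i * real (card (I i)) * ln (r / 2)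
      + r * t / 2 * (\<Sum>j\<in>T i. \<bar>a i j\<bar>))
     = t * ((\<Sum>i\<in>A. lin (T i) (a i) ?y) - (\<Sum>i\<in>A. h i x + 3 * r * w i)) + (\<Sum>i\<in>A. w i * real (card (I i))) * ln (r / 2)
      + r * t / 2 * (\<Sum>i\<in>A. \<Sum>j\<in>T i. \<bar>a i j\<bar>)"
  proof -
    have "(\<Sum>i\<in>A. t * (L i - H i) + W i * c + k * S i) = t * ((\<Sum>i\<in>A. L i) - (\<Sum>i\<in>A. H i)) + (\<Sum>i\<in>A. W i) * c + k * (\<Sum>i\<in>A. S i)"
      for L H W S :: "nat \<Rightarrow> real" and c k
      by (simp add: sum.distrib sum_subtractf sum_distrib_left sum_distrib_right right_diff_distrib)
    then show ?thesis .
  qed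
  also have "(\<Sum>i\<in>A. \<Sum>j\<in>T i. \<bar>a i j\<bar>) = (\<Sum>(i, j)\<in>Sigma A T. \<bar>a i j\<bar>)"
    using finA finT by (simp add: sum.Sigma)
  finally show ?thesis using bal_sum[OF a, of ?y] by simp
qed

text \<open>At the slope \<open>\<gamma> i x\<close> and the height of the conjugate there, pairing
  with \<open>x\<close> returns \<open>h i x\<close>, so no supremum has to be evaluated.\<close>

lemma dual_lower:
  assumes b: "bodies J" and v: "valid P J h \<gamma>" and x: "x \<in> cube" and r: "0 < r" "r \<le> 1" and t: "0 < t"
  shows "t * (\<Sum>i\<in>A. h i x - 2 * r * w i) + (\<Sum>i\<in>A. w i * real (card (I i))) * ln (r / 2) \<le> psi J t (\<lambda>_. x)"
proof -
  have "(\<Sum>i\<in>A. t * (h i x - 2 * r * w i) + w i * real (card (I i)) * ln (r / 2)) \<le> psi J t (\<lambda>_. x)"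
    unfolding psi_def
  proof (rule sum_mono)
    fix i assume i: "i \<in> A"
    have ad: "adm i (h i) (\<gamma> i)" "conj_epi i (h i) \<subseteq> J i" using v i by (auto simp: valid_def)
    interpret convex_body "I i" "8 * w i" "J i" using b i by (simp add: bodyD)
    let ?g = "\<gamma> i x"
    let ?p = "\<lambda>j. if j = d then lin (T i) ?g x - h i x + r * w i + r else ?g j"
    have "lin (I i) (tilt t (\<lambda>_. x) i) ?p + r / 2 * (\<Sum>j\<in>I i. \<bar>tilt t (\<lambda>_. x) i j\<bar>) + real (card (I i)) * ln (r / 2)
       \<le> ln (mass (I i) (J i) (tilt t (\<lambda>_. x) i))"
      by (rule ln_mass_lower[OF r(1)]) (use conj_epi_contains_box[OF i ad(1) x r] ad(2) in blast)
    moreover have "0 \<le> r / 2 * (\<Sum>j\<in>I i. \<bar>tilt t (\<lambda>_. x) i j\<bar>)" using r by (intro mult_nonneg_nonneg sum_nonneg) auto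
    ultimately have "lin (I i) (tilt t (\<lambda>_. x) i) ?p + real (card (I i)) * ln (r / 2)
       \<le> ln (mass (I i) (J i) (tilt t (\<lambda>_. x) i))" by linarith
    then have "w i * (lin (I i) (tilt t (\<lambda>_. x) i) ?p + real (card (I i)) * ln (r / 2))
       \<le> w i * ln (mass (I i) (J i) (tilt t (\<lambda>_. x) i))"
      using w_pos[OF i] by (intro mult_left_mono) auto
    moreover have "w i * lin (I i) (tilt t (\<lambda>_. x) i) ?p = t * (h i x - r * w i - r)"
    proof -
      have "lin (T i) x ?p = lin (T i) x ?g" using d_notin[OF i] by (intro lin_cong) auto
      then show ?thesis using w_pos[OF i] by (simp add: lin_tilt[OF i] lin_commute[of _ x])
    qed
    moreover have "r \<le> r * w i" using r w1[OF i] by simp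
    then have "t * (h i x - 2 * r * w i) \<le> t * (h i x - r * w i - r)"
      using t by (intro mult_left_mono) auto
    ultimately show "t * (h i x - 2 * r * w i) + w i * real (card (I i)) * ln (r / 2) \<le> w i * ln (mass (I i) (J i) (tilt t (\<lambda>_. x) i))"
      by (simp add: distrib_left mult.assoc)
  qed
  then show ?thesis by (simp add: sum.distrib sum_distrib_left sum_distrib_right)
qed

text \<open>The primal bound contains \<open>- t * h i x\<close> and the dual one
  \<open>t * h i x\<close> at the same \<open>x\<close>, so the unknown functions cancel. The radius
  \<open>1 / 2 ^ K\<close> keeps \<open>t * r\<close> at most 1, at the price of its
  logarithm.\<close>

lemma potential_lower:
  assumes b: "bodies P" "bodies J" and v: "valid P J h \<gamma>" and x: "x \<in> cube" and a: "a \<in> bal" and t: "0 < t" "t \<le> 2 ^ K"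
  shows "- 5 * M - 4 * M * (real K + 1) * ln 2 \<le> psi P t a + psi J t (\<lambda>_. x)"
proof -
  define r :: real where "r = 1 / 2 ^ K"
  have r: "0 < r" "r \<le> 1" by (auto simp: r_def)
  have tr: "t * r \<le> 1" using t by (simp add: r_def divide_le_eq)
  have lnr: "ln (r / 2) = - ((real K + 1) * ln 2)"
    by (simp add: r_def ln_div ln_mult ln_realpow algebra_simps)
  have "0 \<le> r * t / 2 * (\<Sum>(i, j)\<in>Sigma A T. \<bar>a i j\<bar>)" using r t by (intro mult_nonneg_nonneg sum_nonneg) auto
  then have "- t * (\<Sum>i\<in>A. h i x + 3 * r * w i) + t * (\<Sum>i\<in>A. h i x - 2 * r * w i)
     + 2 * ((\<Sum>i\<in>A. w i * real (card (I i))) * ln (r / 2)) \<le> psi P t a + psi J t (\<lambda>_. x)"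
    using primal_lower[OF b(1) v x r t(1) a] dual_lower[OF b(2) v x r t(1)] by linarith
  moreover have "- t * (\<Sum>i\<in>A. h i x + 3 * r * w i) + t * (\<Sum>i\<in>A. h i x - 2 * r * w i) = - (5 * (t * r * (\<Sum>i\<in>A. w i)))"
  proof -
    have e: "(\<Sum>i\<in>A. c * r * w i) = c * r * (\<Sum>i\<in>A. w i)" for c by (simp add: sum_distrib_left)
    show ?thesis unfolding sum.distrib sum_subtractf e by (simp add: algebra_simps)
  qed
  moreover have "t * r * (\<Sum>i\<in>A. w i) \<le> 1 * M"
    using tr r t sum_w_le w_pos by (intro mult_mono sum_nonneg) (auto simp: less_imp_le)
  moreover have "(\<Sum>i\<in>A. w i * real (card (I i))) * ((real K + 1) * ln 2) \<le> 2 * M * ((real K + 1) * ln 2)"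
    using sum_w_card by (intro mult_right_mono) auto
  ultimately show ?thesis unfolding lnr by (simp add: algebra_simps)
qed

section \<open>How doubling the inverse temperature and cutting change the potential\<close>

lemma sum_gap_bound: "(\<Sum>i\<in>A. w i * (2 * real (card (I i)))) \<le> 4 * M"
proof -
  have "(\<Sum>i\<in>A. w i * (2 * real (card (I i)))) = 2 * (\<Sum>i\<in>A. w i * real (card (I i)))"
    by (simp add: sum_distrib_left mult.left_commute)
  then show ?thesis using sum_w_card by simp
qed

lemma sum_lin_tilt: "(\<Sum>i\<in>A. w i * lin (I i) (tilt t \<alpha> i) (u i)) = t * (\<Sum>i\<in>A. lin (T i) (\<alpha> i) (u i) - u i d)"
  unfolding sum_distrib_left
proof (rule sum.cong)
  fix i assume i: "i \<in> A"
  show "w i * lin (I i) (tilt t \<alpha> i) (u i) = t * (lin (T i) (\<alpha> i) (u i) - u i d)"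
    using w_pos[OF i] by (simp add: lin_tilt[OF i])
qed simp

lemma psi_double:
  assumes b: "bodies B" "fat B"
  shows "psi B (2 * t) \<alpha> \<le> psi B t \<alpha> + t * (\<Sum>i\<in>A. lin (T i) (\<alpha> i) (cen B t \<alpha> i) - cen B t \<alpha> i d) + 4 * M"
proof -
  have "psi B (2 * t) \<alpha> \<le> (\<Sum>i\<in>A. w i * ln (Z B t \<alpha> i) + w i * lin (I i) (tilt t \<alpha> i) (cen B t \<alpha> i)
     + w i * (2 * real (card (I i))))"
    unfolding psi_def
  proof (rule sum_mono)
    fix i assume i: "i \<in> A"
    interpret convex_body "I i" "8 * w i" "B i" using b i by (simp add: bodyD)
    note pos = mass_pos[OF b i]
    have e: "tilt (2 * t) \<alpha> i = (\<lambda>j. 2 * tilt t \<alpha> i j)" by (simp add: tilt_def mult.assoc)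
    have "ln (Z B (2 * t) \<alpha> i) \<le> ln (exp (lin (I i) (tilt t \<alpha> i) (cen B t \<alpha> i) + 2 * real (card (I i))) * Z B t \<alpha> i)"
      unfolding e cen_def by (rule ln_mono[OF mass_double[OF pos] pos])
    also have "\<dots> = ln (Z B t \<alpha> i) + lin (I i) (tilt t \<alpha> i) (cen B t \<alpha> i) + 2 * real (card (I i))"
      using pos[of "tilt t \<alpha> i"] by (simp add: ln_mult)
    finally have "w i * ln (Z B (2 * t) \<alpha> i) \<le> w i * (ln (Z B t \<alpha> i) + lin (I i) (tilt t \<alpha> i) (cen B t \<alpha> i) + 2 * real (card (I i)))"
      using w_pos[OF i] by (intro mult_left_mono) auto
    then show "w i * ln (Z B (2 * t) \<alpha> i) \<le> w i * ln (Z B t \<alpha> i) + w i * lin (I i) (tilt t \<alpha> i) (cen B t \<alpha> i)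
     + w i * (2 * real (card (I i)))" by (simp only: distrib_left)
  qed
  then show ?thesis unfolding sum.distrib sum_lin_tilt using sum_gap_bound by (simp add: psi_def)
qed

lemma psi_gap:
  assumes b: "bodies B" "fat B" and u: "\<And>i. i \<in> A \<Longrightarrow> u i \<in> B i"
  shows "t * (\<Sum>i\<in>A. lin (T i) (\<alpha> i) (u i) - u i d)
    \<le> t * (\<Sum>i\<in>A. lin (T i) (\<alpha> i) (cen B t \<alpha> i) - cen B t \<alpha> i d) + 4 * M"
proof -
  have "(\<Sum>i\<in>A. w i * lin (I i) (tilt t \<alpha> i) (u i)) \<le>
    (\<Sum>i\<in>A. w i * lin (I i) (tilt t \<alpha> i) (cen B t \<alpha> i) + w i * (2 * real (card (I i))))"
  proof (rule sum_mono)
    fix i assume i: "i \<in> A"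
    interpret convex_body "I i" "8 * w i" "B i" using b i by (simp add: bodyD)
    show "w i * lin (I i) (tilt t \<alpha> i) (u i) \<le> w i * lin (I i) (tilt t \<alpha> i) (cen B t \<alpha> i) + w i * (2 * real (card (I i)))"
      unfolding distrib_left[symmetric] cen_def
      using w_pos[OF i] linear_gap[OF mass_pos[OF b i] u[OF i]] by (intro mult_left_mono) auto
  qed
  then show ?thesis unfolding sum.distrib sum_lin_tilt using sum_gap_bound by simp
qed

lemma bodies_upd: "bodies B \<Longrightarrow> i \<in> A \<Longrightarrow> convex_body (I i) (8 * w i) C \<Longrightarrow> bodies (B(i := C))"
  by (simp add: bodies_def)

lemma psi_cut:
  assumes b: "bodies B" "fat B" and i: "i \<in> A" and C: "convex_body (I i) (8 * w i) C" "C \<subseteq> B i"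
    and f: "fat (B(i := C))"
    and cut: "\<And>u. u \<in> C \<Longrightarrow> lin (I i) c u < lin (I i) c (cen B t \<alpha> i)"
  shows "psi (B(i := C)) t \<alpha> \<le> psi B t \<alpha> - w i * ln (6 / 5)"
proof -
  interpret convex_body "I i" "8 * w i" "B i" using b i by (simp add: bodyD)
  let ?\<theta> = "tilt t \<alpha> i"
  note pos = mass_pos[OF b i, of ?\<theta>]
  have posC: "0 < mass (I i) C ?\<theta>" using mass_pos[OF bodies_upd[OF b(1) i C(1)] f i, of ?\<theta>] by simp
  have "mass (I i) C ?\<theta> \<le> 5 / 6 * mass (I i) (B i) ?\<theta>"
    by (rule mass_cut[OF pos C]) (use cut in \<open>simp add: cen_def\<close>)
  then have "ln (mass (I i) C ?\<theta>) \<le> ln (5 / 6 * mass (I i) (B i) ?\<theta>)" using posC by (rule ln_mono)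
  also have "\<dots> = ln (5 / 6) + ln (mass (I i) (B i) ?\<theta>)" using pos by (intro ln_mult_pos) auto
  also have "ln (5 / 6 :: real) = - ln (6 / 5)" using ln_inverse[of "6 / 5 :: real"] by simp
  finally have "w i * ln (mass (I i) C ?\<theta>) \<le> w i * (- ln (6 / 5) + ln (mass (I i) (B i) ?\<theta>))"
    using w_pos[OF i] by (intro mult_left_mono) auto
  moreover have "psi D t \<alpha> = w i * ln (mass (I i) (D i) ?\<theta>) + (\<Sum>k\<in>A - {i}. w k * ln (mass (I k) (D k) (tilt t \<alpha> k)))" for D
    unfolding psi_def using finA i by (rule sum.remove)
  moreover have "(\<Sum>k\<in>A - {i}. w k * ln (mass (I k) ((B(i := C)) k) (tilt t \<alpha> k))) = (\<Sum>k\<in>A - {i}. w k * ln (mass (I k) (B k) (tilt t \<alpha> k)))"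
    by (intro sum.cong) auto
  ultimately show ?thesis by (simp add: algebra_simps)
qed

definition P0 :: "nat \<Rightarrow> vec set" where
  "P0 i = {u. \<forall>j\<in>I i. \<bar>u j\<bar> \<le> (if j = d then 8 * w i else 1)}"

definition J0 :: "nat \<Rightarrow> vec set" where
  "J0 i = {u. \<forall>j\<in>I i. \<bar>u j\<bar> \<le> (if j = d then 8 * w i else 2)}"

lemma bodies0: "bodies P0" "bodies J0"
proof -
  have fin: "finite (I i)" if "i \<in> A" for i using finT[OF that] by (simp add: I_def)
  show "bodies P0"
    unfolding bodies_def P0_def using w1 by (intro ballI convex_body_box fin) force+
  show "bodies J0"
    unfolding bodies_def J0_def using w1 by (intro ballI convex_body_box fin) force+
qed

text \<open>Minimality against \<open>a0\<close> and \<open>x0\<close> keeps the potential from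
  rising. The primal centres have a common extension \<open>X\<close> in the cube, and the
  optimality of \<open>x\<close> is tested against this \<open>X\<close>.\<close>

lemma centres:
  assumes b: "bodies P" "bodies J" and v: "valid P J h \<gamma>" and P: "\<And>i. i \<in> A \<Longrightarrow> P i \<subseteq> P0 i"
    and t: "0 < t" and a0: "a0 \<in> bal" and x0: "x0 \<in> cube"
  obtains a x where "a \<in> bal" "x \<in> cube"
    "psi P t a + psi J t (\<lambda>_. x) \<le> psi P t a0 + psi J t (\<lambda>_. x0)"
    "(\<Sum>i\<in>A. lin (T i) (a i) (cen P t a i)) = 0"
    "(\<Sum>i\<in>A. lin (T i) x (cen J t (\<lambda>_. x) i)) \<le> (\<Sum>i\<in>A. lin (T i) (cen P t a i) (cen J t (\<lambda>_. x) i))"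
    "\<And>i j. i \<in> A \<Longrightarrow> j \<in> T i \<Longrightarrow> \<bar>cen P t a i j\<bar> \<le> 1"
proof -
  note fat = valid_fat[OF v]
  let ?c0 = "- t * (\<Sum>i\<in>A. h i (\<lambda>_. 0) + 3 * 1 * w i) + (\<Sum>i\<in>A. w i * real (card (I i))) * ln (1 / 2)"
  have "\<exists>a\<in>bal. \<forall>b\<in>bal. psi P t a \<le> psi P t b"
  proof (rule bal_minimizer[OF b(1) fat(1) t, where ?c0.0 = ?c0 and r = "1 * t / 2"])
    show "?c0 + 1 * t / 2 * (\<Sum>(i, j)\<in>Sigma A T. \<bar>a i j\<bar>) \<le> psi P t a" if "a \<in> bal" for a
      using primal_lower[OF b(1) v zero_cube _ _ t that, of 1] by simp
  qed (use t in simp)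
  then obtain a where a: "a \<in> bal" "\<And>b. b \<in> bal \<Longrightarrow> psi P t a \<le> psi P t b" by blast
  obtain x where x: "x \<in> cube" "\<And>y. y \<in> cube \<Longrightarrow> psi J t (\<lambda>_. x) \<le> psi J t (\<lambda>_. y)"
    using cube_minimizer[OF b(2) fat(2) t] by blast
  have bd: "\<bar>cen P t a i j\<bar> \<le> 1" if ij: "i \<in> A" "j \<in> T i" for i j
  proof -
    interpret convex_body "I i" "8 * w i" "P i" using b ij by (simp add: bodyD)
    have "- 1 \<le> u j \<and> u j \<le> 1" if "u \<in> P i" for u
    proof -
      have "u \<in> P0 i" using that P[OF ij(1)] by blast
      moreover have "j \<noteq> d" using ij d_notin[OF ij(1)] by blast
      ultimately have "\<bar>u j\<bar> \<le> 1" using ij(2) by (auto simp: P0_def I_def)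
      then show ?thesis by (simp add: abs_le_iff)
    qed
    then show ?thesis using centre_bounds[OF mass_pos[OF b(1) fat(1) ij(1)], of j "- 1" 1 "tilt t a i"] ij(2)
      by (simp add: cen_def I_def abs_le_iff)
  qed
  obtain X where X: "\<And>i j. i \<in> A \<Longrightarrow> j \<in> T i \<Longrightarrow> cen P t a i j = X j" "\<And>j. (\<And>i. i \<in> A \<Longrightarrow> j \<notin> T i) \<Longrightarrow> X j = 0"
    using bal_centre(2)[OF b(1) fat(1) t a] by blast
  have "X \<in> cube"
    unfolding cube_def
  proof (intro CollectI conjI allI impI)
    fix j
    show "\<bar>X j\<bar> \<le> 1"
    proof (cases "\<exists>i\<in>A. j \<in> T i")
      case True
      then show ?thesis using X(1) bd by metis
    qed (use X(2)[of j] in auto)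
  next
    fix j assume "d \<le> j"
    then show "X j = 0" using T_sub by (intro X(2)) fastforce
  qed
  from cube_centre[OF b(2) fat(2) t x this]
  have "(\<Sum>i\<in>A. lin (T i) x (cen J t (\<lambda>_. x) i)) \<le> (\<Sum>i\<in>A. lin (T i) X (cen J t (\<lambda>_. x) i))" .
  also have "\<dots> = (\<Sum>i\<in>A. lin (T i) (cen P t a i) (cen J t (\<lambda>_. x) i))"
    using X(1) by (intro sum.cong) (auto simp: lin_def)
  finally show ?thesis using that[OF a(1) x(1)] a(2)[OF a0] x(2)[OF x0] bal_centre(1)[OF b(1) fat(1) t a a(1)] bd by fastforce
qed

text \<open>Weak duality with errors. The graph point of \<open>y\<close> bounds the sum of the
  primal heights by the values at \<open>y\<close>; the conjugate point of \<open>x\<close> bounds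
  the values at \<open>x\<close> by the dual value. Optimality of \<open>x\<close> and
  \<open>stop\<close> put the dual value below the primal heights. Each of the two tests costs
  \<open>4 * M / t\<close>.\<close>

lemma output_gap:
  assumes b: "bodies P" "bodies J" and v: "valid P J h \<gamma>" and t: "0 < t" and a: "a \<in> bal" and x: "x \<in> cube"
    and za: "(\<Sum>i\<in>A. lin (T i) (a i) (cen P t a i)) = 0"
    and xq: "(\<Sum>i\<in>A. lin (T i) x (cen J t (\<lambda>_. x) i)) \<le> (\<Sum>i\<in>A. lin (T i) (cen P t a i) (cen J t (\<lambda>_. x) i))"
    and stop: "\<And>i. i \<in> A \<Longrightarrow> lin (T i) (cen P t a i) (cen J t (\<lambda>_. x) i) \<le> cen P t a i d + cen J t (\<lambda>_. x) i d"
    and y: "y \<in> cube"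
  shows "(\<Sum>i\<in>A. h i x) \<le> (\<Sum>i\<in>A. h i y) + 8 * M / t"
proof -
  note fat = valid_fat[OF v]
  let ?p = "\<lambda>i. cen P t a i" and ?q = "\<lambda>i. cen J t (\<lambda>_. x) i"
  have Tj: "\<bar>z j\<bar> \<le> 1" if "z \<in> cube" "i \<in> A" "j \<in> T i" for z i j
    using that T_sub[of i] by (auto simp: cube_def)
  let ?u = "\<lambda>i j. if j = d then h i y else y j"
  let ?v = "\<lambda>i j. if j = d then lin (T i) (\<gamma> i x) x - h i x else \<gamma> i x j"
  have uP: "?u i \<in> P i" if i: "i \<in> A" for i
  proof -
    have ad: "adm i (h i) (\<gamma> i)" "epi i (h i) \<subseteq> P i" using v i by (auto simp: valid_def)
    have "\<bar>h i y\<bar> \<le> 1 + w i" by (rule adm_bound[OF i ad(1)]) (rule Tj[OF y i])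
    moreover have "h i (?u i) \<le> h i y + (\<Sum>j\<in>T i. \<bar>?u i j - y j\<bar>)" by (rule adm_lipschitz[OF ad(1)])
    moreover have "(\<Sum>j\<in>T i. \<bar>?u i j - y j\<bar>) = 0" using d_notin[OF i] by (intro sum.neutral) auto
    ultimately have "?u i \<in> epi i (h i)" using w1[OF i] Tj[OF y i] d_notin[OF i] by (auto simp: epi_def)
    then show ?thesis using ad(2) by blast
  qed
  have vJ: "?v i \<in> J i" if i: "i \<in> A" for i
  proof -
    have ad: "adm i (h i) (\<gamma> i)" "conj_epi i (h i) \<subseteq> J i" using v i by (auto simp: valid_def)
    have 1: "\<bar>h i x\<bar> \<le> 1 + w i" by (rule adm_bound[OF i ad(1)]) (rule Tj[OF x i])
    have "\<bar>lin (T i) (\<gamma> i x) x\<bar> \<le> (\<Sum>j\<in>T i. \<bar>x j\<bar>)" by (rule abs_lin_le_sum) (rule admD(2)[OF ad(1)])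
    also have "\<dots> \<le> 1 * w i" using Tj[OF x i] by (intro sum_T_le[OF i]) auto
    finally have 2: "\<bar>?v i d\<bar> \<le> 8 * w i" using 1 w1[OF i] by simp
    have 3: "lin (T i) z (?v i) - h i z \<le> ?v i d" for z
    proof -
      have "lin (T i) z (?v i) = lin (T i) (\<gamma> i x) z" using d_notin[OF i] by (auto simp: lin_def mult.commute intro!: sum.cong)
      then show ?thesis using admD(1)[OF ad(1), of x z] by (simp add: lin_diff)
    qed
    have "\<bar>?v i j\<bar> \<le> 2" if "j \<in> T i" for j
      using admD(2)[OF ad(1) that, of x] that d_notin[OF i] by auto
    then have "?v i \<in> conj_epi i (h i)" using 2 3 unfolding conj_epi_def by blast
    then show ?thesis using ad(2) by blast
  qed
  have "t * (\<Sum>i\<in>A. lin (T i) (a i) (?u i) - ?u i d) \<le> t * (\<Sum>i\<in>A. lin (T i) (a i) (?p i) - ?p i d) + 4 * M"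
    by (rule psi_gap[OF b(1) fat(1) uP])
  moreover have "(\<Sum>i\<in>A. lin (T i) (a i) (?u i)) = (\<Sum>i\<in>A. lin (T i) (a i) y)"
    using d_notin by (intro sum.cong lin_cong) auto
  ultimately have 1: "t * (\<Sum>i\<in>A. ?p i d) \<le> t * (\<Sum>i\<in>A. h i y) + 4 * M"
    using bal_sum[OF a, of y] za by (simp add: sum_subtractf right_diff_distrib)
  have "t * (\<Sum>i\<in>A. lin (T i) x (?v i) - ?v i d) \<le> t * (\<Sum>i\<in>A. lin (T i) x (?q i) - ?q i d) + 4 * M"
    using psi_gap[OF b(2) fat(2) vJ, where \<alpha> = "\<lambda>_. x" and t = t] by simp
  moreover have "(\<Sum>i\<in>A. lin (T i) x (?v i) - ?v i d) = (\<Sum>i\<in>A. h i x)"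
  proof (rule sum.cong)
    fix i assume i: "i \<in> A"
    have "lin (T i) x (?v i) = lin (T i) (\<gamma> i x) x" using d_notin[OF i] by (auto simp: lin_def mult.commute intro!: sum.cong)
    then show "lin (T i) x (?v i) - ?v i d = h i x" by simp
  qed simp
  ultimately have 2: "t * (\<Sum>i\<in>A. h i x) \<le> t * (\<Sum>i\<in>A. lin (T i) x (?q i) - ?q i d) + 4 * M" by simp
  have "(\<Sum>i\<in>A. lin (T i) (?p i) (?q i)) \<le> (\<Sum>i\<in>A. ?p i d + ?q i d)" using stop by (intro sum_mono)
  then have "(\<Sum>i\<in>A. lin (T i) x (?q i) - ?q i d) \<le> (\<Sum>i\<in>A. ?p i d)"
    using xq by (simp add: sum.distrib sum_subtractf)
  then have "t * (\<Sum>i\<in>A. lin (T i) x (?q i) - ?q i d) \<le> t * (\<Sum>i\<in>A. ?p i d)" using t by (intro mult_left_mono) auto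
  then have "t * (\<Sum>i\<in>A. h i x) \<le> t * (\<Sum>i\<in>A. h i y) + 8 * M" using 1 2 by linarith
  then show ?thesis using t by (simp add: field_simps)
qed

end

section \<open>The protocol\<close>

text \<open>\<open>H o\<close> is the convex function that a machine extracts from its oracle \<open>o\<close>, \<open>\<Gamma> o\<close> a choice of
  subgradients of it; \<open>V i\<close> is the set of messages in which machine \<open>i\<close> transmits a subgradient.\<close>

locale game_comm = game +
  fixes s :: nat and G :: "vec set" and L :: nat
    and H :: "(vec \<Rightarrow> vec) \<Rightarrow> vec \<Rightarrow> real" and \<Gamma> :: "(vec \<Rightarrow> vec) \<Rightarrow> vec \<Rightarrow> vec" and V :: "nat \<Rightarrow> vec set"
  assumes finG: "finite G" and A_sub: "A \<subseteq> {..<s}"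
    and det: "determined_on G H" "determined_on G \<Gamma>"
    and V: "i \<in> A \<Longrightarrow> finite (V i)" "i \<in> A \<Longrightarrow> card (V i) \<le> 2 ^ ((2 * L + 1) * card (T i))"
begin

definition msg :: "nat \<Rightarrow> (vec \<Rightarrow> vec) \<Rightarrow> vec \<Rightarrow> vec" where
  "msg i o' x = (\<lambda>j. if j \<in> T i then \<Gamma> o' x j else 0)"

definition inputs :: "(nat \<Rightarrow> vec set) \<Rightarrow> (nat \<Rightarrow> vec set) \<Rightarrow> (nat \<Rightarrow> vec \<Rightarrow> vec) set \<Rightarrow> bool" where
  "inputs P J Q \<longleftrightarrow> (\<forall>g\<in>Q. valid P J (\<lambda>i. H (g i)) (\<lambda>i. \<Gamma> (g i)) \<and> (\<forall>i\<in>A. \<forall>x. msg i (g i) x \<in> V i))"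

text \<open>The Fenchel--Young inequality that a point \<open>p\<close> of the epigraph imposes on
  the conjugate.\<close>

definition dual_cut :: "nat \<Rightarrow> vec \<Rightarrow> vec set" where
  "dual_cut i p = {u. lin (I i) (\<lambda>j. if j = d then -1 else p j) u \<le> p d}"

definition primal_cut :: "nat \<Rightarrow> vec \<Rightarrow> vec \<Rightarrow> vec set" where
  "primal_cut i p v = {u. lin (I i) (\<lambda>j. if j = d then -1 else v j) u < lin (I i) (\<lambda>j. if j = d then -1 else v j) p}"

lemma lin_I_minus: "i \<in> A \<Longrightarrow> lin (I i) (\<lambda>j. if j = d then -1 else v j) u = lin (T i) v u - u d"
proof -
  assume i: "i \<in> A"
  have "lin (T i) (\<lambda>j. if j = d then -1 else v j) u = lin (T i) v u"
    unfolding lin_def using d_notin[OF i] by (intro sum.cong) auto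
  then show ?thesis by (simp add: lin_I[OF i])
qed

lemma inputs_dual_cut:
  assumes Q: "inputs P J Q" and i: "i \<in> A" and p: "\<And>j. j \<in> T i \<Longrightarrow> \<bar>p j\<bar> \<le> 1"
  shows "inputs P (J(i := J i \<inter> dual_cut i p)) {g \<in> Q. H (g i) p \<le> p d}"
proof -
  have "conj_epi i h \<subseteq> dual_cut i p" if "h p \<le> p d" for h
  proof
    fix u assume "u \<in> conj_epi i h"
    then have "lin (T i) p u - h p \<le> u d" using p by (auto simp: conj_epi_def)
    then show "u \<in> dual_cut i p" using that by (simp add: dual_cut_def lin_I_minus[OF i])
  qed
  then show ?thesis using Q by (auto simp: inputs_def valid_def)
qed

text \<open>A function above \<open>p d\<close> at \<open>p\<close> with slope \<open>v\<close>
  there exceeds the affine function through that lower point everywhere, so its epigraph avoids even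
  the boundary of the halfspace.\<close>

lemma inputs_primal_cut:
  assumes Q: "inputs P J Q" and i: "i \<in> A"
  shows "inputs (P(i := P i \<inter> primal_cut i p v)) J {g \<in> Q. \<not> H (g i) p \<le> p d \<and> msg i (g i) p = v}"
proof -
  have "epi i (H o') \<subseteq> primal_cut i p v" if "\<not> H o' p \<le> p d" "msg i o' p = v" "adm i (H o') (\<Gamma> o')" for o'
  proof
    fix u assume u: "u \<in> epi i (H o')"
    have m: "lin (T i) v z = lin (T i) (\<Gamma> o' p) z" for z
      unfolding that(2)[symmetric] lin_def msg_def by (intro sum.cong) auto
    have "p d + (lin (T i) v u - lin (T i) v p) < u d"
      using admD(1)[OF that(3), of p u] u that(1) by (simp add: m lin_diff epi_def)
    then show "u \<in> primal_cut i p v" by (simp add: primal_cut_def lin_I_minus[OF i])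
  qed
  then show ?thesis using Q unfolding inputs_def valid_def by fastforce
qed

text \<open>Amortization. The budget consists of \<open>\<phi> - LB\<close> and a reserve of
  \<open>8 * M\<close> for each remaining doubling. A cut at machine \<open>i\<close> lowers
  \<open>\<phi>\<close> by \<open>w i * c\<close>, which releases \<open>(2 * L + 2) * w i\<close>
  bits and so pays for question and message; a doubling uses up its reserve. \<open>N\<close> bounds
  a measure that falls by at least 1 in both cases.\<close>

lemma solvable_game:
  fixes \<phi> :: real and K :: nat
  defines "c \<equiv> ln (6 / 5 :: real)" and "LB \<equiv> - 5 * M - 4 * M * (real K + 1) * ln 2"
  assumes out: "\<And>g x. g \<in> Q \<Longrightarrow> x \<in> cube \<Longrightarrow>
      (\<And>y. y \<in> cube \<Longrightarrow> (\<Sum>i\<in>A. H (g i) x) \<le> (\<Sum>i\<in>A. H (g i) y) + 8 * M / 2 ^ K) \<Longrightarrow> good g (emb x)"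
    and b: "bodies P" "bodies J" "\<And>i. i \<in> A \<Longrightarrow> P i \<subseteq> P0 i" and Q: "inputs P J Q"
    and ax: "a0 \<in> bal" "x0 \<in> cube" "psi P (2 ^ k) a0 + psi J (2 ^ k) (\<lambda>_. x0) \<le> \<phi>"
    and k: "k \<le> K" and N: "(\<phi> - LB + 8 * M * real (K - k)) / c + real (K - k) < real N"
  shows "solvable s good Q ((2 * real L + 2) / c * (\<phi> - LB + 8 * M * real (K - k)))"
  using out b Q ax k N
proof (induction N arbitrary: P J Q a0 x0 \<phi> k)
  case N: (0 P J Q a0 x0 \<phi> k)
  have c: "0 < c" by (simp add: c_def)
  have M0: "0 \<le> M" by (simp add: M_def sum_nonneg)
  \<comment> \<open>A negative measure contradicts the lower bound \<open>LB\<close>, which any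
    remaining oracle enforces.\<close>
  have "Q = {}"
  proof (rule ccontr)
    assume "Q \<noteq> {}"
    then obtain g where "g \<in> Q" by blast
    then have v: "valid P J (\<lambda>i. H (g i)) (\<lambda>i. \<Gamma> (g i))" using N(5) by (simp add: inputs_def)
    have "LB \<le> \<phi>" unfolding LB_def
      using potential_lower[OF N(2,3) v N(7,6), of "2 ^ k" K] N(8,9) by (auto intro: order_trans power_increasing)
    then have "0 \<le> (\<phi> - LB + 8 * M * real (K - k)) / c" using c M0 by simp
    then show False using N(10) by simp
  qed
  then show ?case by (simp add: solvable_empty)
next
  case N: (Suc N P J Q a0 x0 \<phi> k)
  note IH = N(1) and out = N(2) and bP = N(3) and bJ = N(4) and P0 = N(5) and inQ = N(6)
    and a0 = N(7) and x0 = N(8) and pot = N(9) and kK = N(10) and NN = N(11)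
  have c: "0 < c" by (simp add: c_def)
  have M0: "0 \<le> M" by (simp add: M_def sum_nonneg)
  let ?\<beta> = "(2 * real L + 2) / c"
  show ?case
  proof (cases "Q = {}")
    case True
    then show ?thesis by (simp add: solvable_empty)
  next
    case False
    then obtain g0 where "g0 \<in> Q" by blast
    then have v: "valid P J (\<lambda>i. H (g0 i)) (\<lambda>i. \<Gamma> (g0 i))" using inQ by (simp add: inputs_def)
    have LB: "LB \<le> \<phi>" unfolding LB_def
      using potential_lower[OF bP bJ v x0 a0, of "2 ^ k" K] pot kK by (auto intro: order_trans power_increasing)
    have t: "(0::real) < 2 ^ k" by simp
    note fat = valid_fat[OF v]
    obtain a x where a: "a \<in> bal" and x: "x \<in> cube"
      and le: "psi P (2 ^ k) a + psi J (2 ^ k) (\<lambda>_. x) \<le> psi P (2 ^ k) a0 + psi J (2 ^ k) (\<lambda>_. x0)"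
      and za: "(\<Sum>i\<in>A. lin (T i) (a i) (cen P (2 ^ k) a i)) = 0"
      and xq: "(\<Sum>i\<in>A. lin (T i) x (cen J (2 ^ k) (\<lambda>_. x) i)) \<le> (\<Sum>i\<in>A. lin (T i) (cen P (2 ^ k) a i) (cen J (2 ^ k) (\<lambda>_. x) i))"
      and bd: "\<And>i j. i \<in> A \<Longrightarrow> j \<in> T i \<Longrightarrow> \<bar>cen P (2 ^ k) a i j\<bar> \<le> 1"
      by (rule centres[OF bP bJ v P0 t a0 x0]) blast+
    have le\<phi>: "psi P (2 ^ k) a + psi J (2 ^ k) (\<lambda>_. x) \<le> \<phi>" using le pot by linarith
    define p where "p = cen P (2 ^ k) a"
    define q where "q = cen J (2 ^ k) (\<lambda>_. x)"
    show ?thesis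
    proof (cases "\<exists>i\<in>A. p i d + q i d < lin (T i) (p i) (q i)")
      case True
      then obtain i where i: "i \<in> A" and ask: "p i d + q i d < lin (T i) (p i) (q i)" by blast
      define \<phi>' where "\<phi>' = \<phi> - w i * c"
      let ?b = "?\<beta> * (\<phi>' - LB + 8 * M * real (K - k))"
      have meas: "(\<phi>' - LB + 8 * M * real (K - k)) / c + real (K - k) < real N"
      proof -
        have "(\<phi>' - LB + 8 * M * real (K - k)) / c = (\<phi> - LB + 8 * M * real (K - k)) / c - w i"
          using c by (simp add: \<phi>'_def field_simps)
        then show ?thesis using NN w1[OF i] by simp
      qed
      have yes: "solvable s good {g \<in> Q. H (g i) (p i) \<le> p i d} ?b"
      proof (cases "{g \<in> Q. H (g i) (p i) \<le> p i d} = {}")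
        case True
        then show ?thesis by (simp only: solvable_empty)
      next
        case False
        let ?C = "J i \<inter> dual_cut i (p i)"
        have inp: "inputs P (J(i := ?C)) {g \<in> Q. H (g i) (p i) \<le> p i d}"
          by (rule inputs_dual_cut[OF inQ i]) (simp add: p_def bd[OF i])
        interpret B: convex_body "I i" "8 * w i" "J i" using bJ i by (simp add: bodyD)
        have C: "convex_body (I i) (8 * w i) ?C" unfolding dual_cut_def by (rule B.cut_le)
        \<comment> \<open>Some oracle is still consistent with the answer, and its conjugate
          epigraph leaves a box in the cut body.\<close>
        have f: "fat (J(i := ?C))" using False inp by (auto simp: inputs_def dest!: valid_fat(2))
        have "psi (J(i := ?C)) (2 ^ k) (\<lambda>_. x) \<le> psi J (2 ^ k) (\<lambda>_. x) - w i * c"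
          unfolding c_def
        proof (rule psi_cut[OF bJ fat(2) i C _ f, where c = "\<lambda>j. if j = d then -1 else p i j"])
          fix u assume "u \<in> ?C"
          \<comment> \<open>By the choice of \<open>i\<close> the dual centre violates the
            inequality of \<open>dual_cut\<close> strictly.\<close>
          then show "lin (I i) (\<lambda>j. if j = d then - 1 else p i j) u < lin (I i) (\<lambda>j. if j = d then - 1 else p i j) (cen J (2 ^ k) (\<lambda>_. x) i)"
            using ask by (simp add: dual_cut_def lin_I_minus[OF i] q_def)
        qed simp
        then have "psi P (2 ^ k) a + psi (J(i := ?C)) (2 ^ k) (\<lambda>_. x) \<le> \<phi>'"
          unfolding \<phi>'_def using le\<phi> by linarith
        from IH[OF _ bP bodies_upd[OF bJ i C] P0 inp a x this kK meas] out show ?thesis by blast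
      qed
      have no: "solvable s good {g \<in> {g \<in> Q. \<not> H (g i) (p i) \<le> p i d}. msg i (g i) (p i) = v} ?b" for v
      proof (cases "{g \<in> Q. \<not> H (g i) (p i) \<le> p i d \<and> msg i (g i) (p i) = v} = {}")
        case True
        then have "{g \<in> {g \<in> Q. \<not> H (g i) (p i) \<le> p i d}. msg i (g i) (p i) = v} = {}" by auto
        then show ?thesis by (simp only: solvable_empty)
      next
        case False
        have eq: "{g \<in> {g \<in> Q. \<not> H (g i) (p i) \<le> p i d}. msg i (g i) (p i) = v}
          = {g \<in> Q. \<not> H (g i) (p i) \<le> p i d \<and> msg i (g i) (p i) = v}" by auto
        let ?C = "P i \<inter> primal_cut i (p i) v"
        have inp: "inputs (P(i := ?C)) J {g \<in> Q. \<not> H (g i) (p i) \<le> p i d \<and> msg i (g i) (p i) = v}"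
          by (rule inputs_primal_cut[OF inQ i])
        interpret B: convex_body "I i" "8 * w i" "P i" using bP i by (simp add: bodyD)
        have C: "convex_body (I i) (8 * w i) ?C" unfolding primal_cut_def by (rule B.cut_lt)
        have f: "fat (P(i := ?C))" using False inp by (auto simp: inputs_def dest!: valid_fat(1))
        have "psi (P(i := ?C)) (2 ^ k) a \<le> psi P (2 ^ k) a - w i * c"
          unfolding c_def
          by (rule psi_cut[OF bP fat(1) i C _ f, where c = "\<lambda>j. if j = d then -1 else v j"])
            (auto simp: primal_cut_def p_def)
        then have pot': "psi (P(i := ?C)) (2 ^ k) a + psi J (2 ^ k) (\<lambda>_. x) \<le> \<phi>'"
          unfolding \<phi>'_def using le\<phi> by linarith
        have "(P(i := ?C)) k \<subseteq> P0 k" if "k \<in> A" for k using P0[OF that] by auto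
        from IH[OF _ bodies_upd[OF bP i C] bJ this inp a x pot' kK meas] out show ?thesis unfolding eq by blast
      qed
      let ?k = "(2 * L + 1) * card (T i)"
      have "solvable s good {g \<in> Q. \<not> H (g i) (p i) \<le> p i d} (?b + real ?k)"
      proof (rule solvable_message[where m = "\<lambda>o'. msg i o' (p i)" and i = i])
        show "determined_on G (\<lambda>o'. msg i o' (p i))"
          unfolding msg_def by (rule determined_on_comp[OF det(2), where k = "\<lambda>f j. if j \<in> T i then f (p i) j else 0"])
        show "msg i (g i) (p i) \<in> V i" if "g \<in> {g \<in> Q. \<not> H (g i) (p i) \<le> p i d}" for g
          using that inQ i by (auto simp: inputs_def)
      qed (use finG A_sub i V no in auto)
      \<comment> \<open>The one-bit answer is charged like the long one, so that both branches share
        a bound.\<close>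
      moreover have "solvable s good {g \<in> Q. H (g i) (p i) \<le> p i d} (?b + real ?k)"
        by (rule solvable_mono[OF yes]) simp
      ultimately have "solvable s good Q (?b + real ?k + 1)"
      proof (intro solvable_bit[OF finG, where F = "\<lambda>o'. H o' (p i) \<le> p i d" and i = i])
        show "determined_on G (\<lambda>o'. H o' (p i) \<le> p i d)"
          by (rule determined_on_comp[OF det(1), where k = "\<lambda>f. f (p i) \<le> p i d"])
      qed (use A_sub i in auto)
      then show ?thesis
      proof (rule solvable_mono)
        have "real ?k \<le> (2 * real L + 1) * w i"
          using mult_left_mono[OF card_T[OF i], of "2 * real L + 1"] by (simp add: algebra_simps)
        then have "real ?k + 1 \<le> (2 * real L + 2) * w i" using w1[OF i] by (simp add: algebra_simps)
        moreover have "?b = ?\<beta> * (\<phi> - LB + 8 * M * real (K - k)) - (2 * real L + 2) * w i"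
          using c by (simp add: \<phi>'_def field_simps)
        ultimately show "?b + real ?k + 1 \<le> ?\<beta> * (\<phi> - LB + 8 * M * real (K - k))" by linarith
      qed
    next
      case False
      then have stop: "lin (T i) (p i) (q i) \<le> p i d + q i d" if "i \<in> A" for i using that by force
      show ?thesis
      proof (cases "k < K")
        case True
        have sum: "(\<Sum>i\<in>A. lin (T i) (p i) (q i)) \<le> (\<Sum>i\<in>A. p i d + q i d)" using stop by (intro sum_mono)
        have "psi P (2 ^ Suc k) a + psi J (2 ^ Suc k) (\<lambda>_. x) \<le>
          psi P (2 ^ k) a + psi J (2 ^ k) (\<lambda>_. x) +
            2 ^ k * ((\<Sum>i\<in>A. lin (T i) (a i) (p i) - p i d) + (\<Sum>i\<in>A. lin (T i) x (q i) - q i d)) + 8 * M"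
          using psi_double[OF bP fat(1), of "2 ^ k" a] psi_double[OF bJ fat(2), of "2 ^ k" "\<lambda>_. x"]
          by (simp add: p_def q_def distrib_left)
        \<comment> \<open>Without a violated inequality the linear terms of the two doublings sum to
          at most zero: the primal multipliers contribute nothing, and optimality of
          \<open>x\<close> compares the dual part with the primal centres.\<close>
        moreover have "(\<Sum>i\<in>A. lin (T i) (a i) (p i) - p i d) + (\<Sum>i\<in>A. lin (T i) x (q i) - q i d) \<le> 0"
          using sum za xq by (simp add: p_def q_def sum.distrib sum_subtractf)
        then have "2 ^ k * ((\<Sum>i\<in>A. lin (T i) (a i) (p i) - p i d) + (\<Sum>i\<in>A. lin (T i) x (q i) - q i d)) \<le> 0"
          by (intro mult_nonneg_nonpos) auto
        ultimately have pot2: "psi P (2 ^ Suc k) a + psi J (2 ^ Suc k) (\<lambda>_. x) \<le> \<phi> + 8 * M" using le\<phi> by linarith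
        have e: "\<phi> + 8 * M - LB + 8 * M * real (K - Suc k) = \<phi> - LB + 8 * M * real (K - k)"
          using True by (simp add: of_nat_diff algebra_simps)
        have meas2: "(\<phi> + 8 * M - LB + 8 * M * real (K - Suc k)) / c + real (K - Suc k) < real N"
          unfolding e using NN True by (simp add: of_nat_diff)
        from IH[OF _ bP bJ P0 inQ a x pot2 Suc_leI[OF True] meas2] out show ?thesis unfolding e by blast
      next
        case False
        then have kk: "k = K" using kK by simp
        show ?thesis
        proof (rule solvable_output[where \<theta> = "emb x"])
          fix g assume g: "g \<in> Q"
          then have vg: "valid P J (\<lambda>i. H (g i)) (\<lambda>i. \<Gamma> (g i))" using inQ by (simp add: inputs_def)
          show "good g (emb x)"
          proof (rule out[OF g x])
            fix y assume y: "y \<in> cube"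
            show "(\<Sum>i\<in>A. H (g i) x) \<le> (\<Sum>i\<in>A. H (g i) y) + 8 * M / 2 ^ K"
              using output_gap[OF bP bJ vg t a x za xq stop[unfolded p_def q_def] y] by (simp add: kk)
          qed
        next
          show "0 \<le> ?\<beta> * (\<phi> - LB + 8 * M * real (K - k))"
            using c LB M0 by (intro mult_nonneg_nonneg divide_nonneg_nonneg add_nonneg_nonneg) auto
        qed
      qed
    qed
  qed
qed

end

section \<open>From oracles to piecewise linear functions\<close>

lemma Rn_iff: "x \<in> Rn d \<longleftrightarrow> (\<forall>j\<ge>d. x j = 0)"
  by (simp add: topspace_Euclidean_space)

lemma abs_diff_le_dist2: "j < d \<Longrightarrow> \<bar>x j - y j\<bar> \<le> dist2 d x y"
  unfolding dist2_def using member_le_L2_set[of "{..<d}" j "\<lambda>j. \<bar>x j - y j\<bar>"]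
  by (simp add: L2_set_def)

text \<open>Tests the subgradient inequality with unit steps in both directions along coordinate
  \<open>j\<close>.\<close>

lemma subgradient_bound:
  assumes f: "lipschitz_fun d \<mu> f" and v: "subgradient d f x v" and x: "x \<in> Rn d" and j: "j < d"
  shows "\<bar>v j\<bar> \<le> \<mu>"
proof -
  have "e * v j \<le> \<mu>" if e: "\<bar>e\<bar> = 1" for e
  proof -
    let ?y = "x(j := x j + e)"
    have y: "?y \<in> Rn d" using x j by (auto simp: Rn_iff)
    have "(\<Sum>k<d. v k * (?y k - x k)) = (\<Sum>k<d. if k = j then v j * e else 0)" by (intro sum.cong) auto
    then have "e * v j \<le> f ?y - f x" using v y j unfolding subgradient_def by (auto simp: mult.commute)
    also have "\<dots> \<le> \<mu> * dist2 d ?y x" using f x y unfolding lipschitz_fun_def by (meson abs_le_D1)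
    also have "\<dots> \<le> \<mu> * 1"
    proof (rule mult_left_mono)
      have "dist2 d ?y x \<le> (\<Sum>k<d. \<bar>?y k - x k\<bar>)" unfolding dist2_def by (rule L2_set_le_sum_abs)
      also have "\<dots> = (\<Sum>k<d. if k = j then 1 else 0)" using e by (intro sum.cong) auto
      finally show "dist2 d ?y x \<le> 1" using j by simp
    qed (use f in \<open>simp add: lipschitz_fun_def\<close>)
    finally show ?thesis by simp
  qed
  from this[of 1] this[of "-1"] show ?thesis by (simp add: abs_le_iff)
qed

text \<open>The function is constant along coordinate \<open>j\<close>, so \<open>e * v j\<close> is
  nonpositive for every \<open>e\<close>, in particular for \<open>e = v j\<close>.\<close>

lemma subgradient_zero:
  assumes f: "depends_on d S f" and v: "subgradient d f x v" and x: "x \<in> Rn d" and j: "j < d" "j \<notin> S"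
  shows "v j = 0"
proof -
  have "e * v j \<le> 0" for e
  proof -
    let ?y = "x(j := x j + e)"
    have y: "?y \<in> Rn d" using x j by (auto simp: Rn_iff)
    have "(\<Sum>k<d. v k * (?y k - x k)) = (\<Sum>k<d. if k = j then v j * e else 0)" by (intro sum.cong) auto
    then have "e * v j \<le> f ?y - f x" using v y j unfolding subgradient_def by (auto simp: mult.commute)
    moreover have "f ?y = f x" using f x y j unfolding depends_on_def by (metis fun_upd_other)
    ultimately show ?thesis by simp
  qed
  from this[of "v j"] show ?thesis by (simp add: mult_le_0_iff) (metis order_antisym)
qed

text \<open>The numbers \<open>r * 2 ^ L\<close> are integers of absolute value below
  \<open>4 ^ L\<close>, and \<open>2 * 4 ^ L = 2 ^ (2 * L + 1)\<close>.\<close>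

lemma card_fixed_point:
  "finite {r. fixed_point L r}" "card {r. fixed_point L r} \<le> 2 ^ (2 * L + 1)"
proof -
  let ?K = "{-(4 ^ L)..<4 ^ L} :: int set"
  have sub: "{r. fixed_point L r} \<subseteq> (\<lambda>k. real_of_int k / 2 ^ L) ` ?K"
  proof
    fix r :: real assume "r \<in> {r. fixed_point L r}"
    then obtain k where k: "r * 2 ^ L = real_of_int k" "\<bar>r\<bar> < 2 ^ L" by (auto simp: fixed_point_def elim: Ints_cases)
    have "\<bar>real_of_int k\<bar> = \<bar>r\<bar> * 2 ^ L" unfolding k(1)[symmetric] by (simp add: abs_mult)
    also have "\<dots> < 2 ^ L * 2 ^ L" using k(2) by simp
    also have "\<dots> = real_of_int (4 ^ L)" by (simp add: power_mult_distrib[symmetric])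
    finally have "\<bar>k\<bar> < 4 ^ L" by linarith
    then have "k \<in> ?K" by auto
    moreover have "r = real_of_int k / 2 ^ L" unfolding k(1)[symmetric] by simp
    ultimately show "r \<in> (\<lambda>k. real_of_int k / 2 ^ L) ` ?K" by blast
  qed
  then show "finite {r. fixed_point L r}" by (rule finite_subset) simp
  have "card {r. fixed_point L r} \<le> card ?K"
    using card_mono[OF _ sub] card_image_le[of ?K "\<lambda>k. real_of_int k / 2 ^ L"] by simp
  also have "card ?K = 2 ^ (2 * L + 1)"
    by (simp add: power_mult nat_mult_distrib nat_power_eq)
  finally show "card {r. fixed_point L r} \<le> 2 ^ (2 * L + 1)" .
qed

locale net =
  fixes d :: nat and \<theta>0 :: vec and D \<mu> :: real and N :: nat
  assumes N: "0 < N" and D: "0 < D" and \<mu>: "0 < \<mu>" and \<theta>0: "\<theta>0 \<in> Rn d"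
begin

definition pt :: "(nat \<Rightarrow> int) \<Rightarrow> vec" where
  "pt k = (\<lambda>j. if j < d then \<theta>0 j + D * (real_of_int (k j) / real N) else 0)"

definition pts :: "vec set" where
  "pts = pt ` ({..<d} \<rightarrow>\<^sub>E {- int N..int N})"

definition seg :: "vec \<Rightarrow> nat \<Rightarrow> vec" where
  "seg p k = (\<lambda>j. \<theta>0 j + real k / real N * (p j - \<theta>0 j))"

text \<open>The partition points of the segments serve to recover values from slopes; for
  \<open>k = N\<close> they are the net points themselves.\<close>

definition queries :: "vec set" where
  "queries = (\<lambda>(p, k). seg p k) ` (pts \<times> {..N})"

text \<open>A lower Riemann sum for the increment of the function along the segment from \<open>\<theta>0\<close> to \<open>p\<close>.\<close>

definition rise :: "(vec \<Rightarrow> vec) \<Rightarrow> vec \<Rightarrow> real" where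
  "rise g p = (\<Sum>k<N. \<Sum>j<d. g (seg p k) j * ((p j - \<theta>0 j) / real N))"

definition tangent :: "(vec \<Rightarrow> vec) \<Rightarrow> vec \<Rightarrow> vec \<Rightarrow> real" where
  "tangent g p y = rise g p + (\<Sum>j<d. g p j * (y j - p j))"

definition fhat :: "(vec \<Rightarrow> vec) \<Rightarrow> vec \<Rightarrow> real" where
  "fhat g y = Max ((\<lambda>p. tangent g p y) ` pts)"

definition best :: "(vec \<Rightarrow> vec) \<Rightarrow> vec \<Rightarrow> vec" where
  "best g y = (SOME p. p \<in> pts \<and> tangent g p y = fhat g y)"

definition emb :: "vec \<Rightarrow> vec" where
  "emb u = (\<lambda>j. \<theta>0 j + D * u j)"

text \<open>The substitution \<open>emb\<close> and the division by \<open>\<mu> * D\<close> move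
  the problem to the unit cube with slopes at most 1.\<close>

definition H :: "(vec \<Rightarrow> vec) \<Rightarrow> vec \<Rightarrow> real" where
  "H g u = fhat g (emb u) / (\<mu> * D)"

definition Gam :: "(vec \<Rightarrow> vec) \<Rightarrow> vec \<Rightarrow> vec" where
  "Gam g u = (\<lambda>j. g (best g (emb u)) j / \<mu>)"

lemma fin_pts: "finite pts"
  unfolding pts_def by (intro finite_imageI finite_PiE) auto

lemma pts_ne: "pts \<noteq> {}"
  unfolding pts_def by (simp add: PiE_eq_empty_iff)

lemma fin_queries: "finite queries"
  unfolding queries_def using fin_pts by auto

lemma ptsD: assumes "p \<in> pts" shows "p \<in> Rn d" "j < d \<Longrightarrow> \<bar>p j - \<theta>0 j\<bar> \<le> D"
proof -
  obtain k where k: "k \<in> {..<d} \<rightarrow>\<^sub>E {- int N..int N}" "p = pt k" using assms by (auto simp: pts_def)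
  show "p \<in> Rn d" by (simp add: k(2) pt_def Rn_iff)
  assume j: "j < d"
  then have "\<bar>real_of_int (k j)\<bar> \<le> real N" using k(1) by (force simp: PiE_iff abs_le_iff)
  then have "\<bar>real_of_int (k j) / real N\<bar> \<le> 1" using N by (simp add: divide_le_eq)
  then have "D * \<bar>real_of_int (k j) / real N\<bar> \<le> D * 1" using D by (intro mult_left_mono) auto
  then show "\<bar>p j - \<theta>0 j\<bar> \<le> D" using j D by (simp add: k(2) pt_def abs_mult)
qed

lemma seg_Rn: "p \<in> Rn d \<Longrightarrow> seg p k \<in> Rn d"
  using \<theta>0 by (simp add: Rn_iff seg_def)

lemma seg_N: "seg p N = p"
  using N by (simp add: seg_def)

lemma seg_0: "seg p 0 = \<theta>0"
  by (simp add: seg_def)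

lemma pts_queries: "p \<in> pts \<Longrightarrow> p \<in> queries"
  unfolding queries_def using seg_N[of p] by force

lemma seg_queries: "p \<in> pts \<Longrightarrow> k \<le> N \<Longrightarrow> seg p k \<in> queries"
  unfolding queries_def by force

lemma best: "best g y \<in> pts" "tangent g (best g y) y = fhat g y"
proof -
  have "fhat g y \<in> (\<lambda>p. tangent g p y) ` pts" unfolding fhat_def using fin_pts pts_ne by (intro Max_in) auto
  then have "\<exists>p. p \<in> pts \<and> tangent g p y = fhat g y" by auto
  then have "best g y \<in> pts \<and> tangent g (best g y) y = fhat g y" unfolding best_def by (rule someI_ex)
  then show "best g y \<in> pts" "tangent g (best g y) y = fhat g y" by auto
qed

lemma tangent_le: "p \<in> pts \<Longrightarrow> tangent g p y \<le> fhat g y"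
  unfolding fhat_def using fin_pts by (intro Max_ge) auto

lemma tangent_diff: "tangent g p y - tangent g p x = (\<Sum>j<d. g p j * (y j - x j))"
  by (simp add: tangent_def sum_subtractf[symmetric] right_diff_distrib[symmetric])

lemma tangent_cong: "(\<And>x. x \<in> queries \<Longrightarrow> g x = g' x) \<Longrightarrow> p \<in> pts \<Longrightarrow> tangent g p y = tangent g' p y"
proof -
  assume e: "\<And>x. x \<in> queries \<Longrightarrow> g x = g' x" and p: "p \<in> pts"
  have "rise g p = rise g' p" unfolding rise_def
    by (intro sum.cong) (auto simp: e[OF seg_queries[OF p]])
  then show ?thesis using e[OF pts_queries[OF p]] by (simp add: tangent_def)
qed

text \<open>The choice in \<open>best\<close> does no harm: for oracles that agree on
  \<open>queries\<close> the predicates to choose from are equal.\<close>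

lemma determined: "determined_on queries H" "determined_on queries Gam"
proof -
  have fh: "fhat g = fhat g'" and be: "best g = best g'" if e: "\<forall>x\<in>queries. g x = g' x" for g g'
  proof -
    have t: "tangent g p y = tangent g' p y" if "p \<in> pts" for p y using tangent_cong[OF _ that] e by blast
    show fh: "fhat g = fhat g'"
    proof
      fix y show "fhat g y = fhat g' y" unfolding fhat_def using t by (intro arg_cong[of _ _ Max] image_cong) auto
    qed
    show "best g = best g'"
    proof
      fix y
      have "(\<lambda>p. p \<in> pts \<and> tangent g p y = fhat g y) = (\<lambda>p. p \<in> pts \<and> tangent g' p y = fhat g' y)"
        using t fh by auto
      then show "best g y = best g' y" unfolding best_def by (rule arg_cong)
    qed
  qed
  show "determined_on queries H"
    unfolding determined_on_def
  proof (intro allI impI ext)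
    fix g g' :: "vec \<Rightarrow> vec" and u assume e: "\<forall>x\<in>queries. g x = g' x"
    show "H g u = H g' u" by (simp add: H_def fh[OF e])
  qed
  show "determined_on queries Gam"
    unfolding determined_on_def
  proof (intro allI impI ext)
    fix g g' :: "vec \<Rightarrow> vec" and u j assume e: "\<forall>x\<in>queries. g x = g' x"
    have "g (best g' (emb u)) = g' (best g' (emb u))" using e pts_queries[OF best(1)] by blast
    then show "Gam g u j = Gam g' u j" by (simp add: Gam_def be[OF e])
  qed
qed

context
  fixes f g
  assumes lip: "lipschitz_fun d \<mu> f" and sub: "\<And>x. x \<in> Rn d \<Longrightarrow> subgradient d f x (g x)"
begin

lemma g_bound: "x \<in> Rn d \<Longrightarrow> j < d \<Longrightarrow> \<bar>g x j\<bar> \<le> \<mu>"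
  using subgradient_bound[OF lip sub] by blast

lemma sub_ineq: "x \<in> Rn d \<Longrightarrow> y \<in> Rn d \<Longrightarrow> f x + (\<Sum>j<d. g x j * (y j - x j)) \<le> f y"
  using sub unfolding subgradient_def by blast

lemma sum_g_le:
  assumes x: "x \<in> Rn d" and z: "\<And>j. j < d \<Longrightarrow> \<bar>z j\<bar> \<le> r"
  shows "\<bar>\<Sum>j<d. g x j * z j\<bar> \<le> \<mu> * r * real d"
proof -
  have "\<bar>\<Sum>j<d. g x j * z j\<bar> \<le> (\<Sum>j<d. \<bar>g x j * z j\<bar>)" by (rule sum_abs)
  also have "\<dots> \<le> (\<Sum>j<d. \<mu> * r)"
    unfolding abs_mult using g_bound[OF x] z \<mu> by (intro sum_mono mult_mono) auto
  finally show ?thesis by (simp add: mult.commute)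
qed

text \<open>On each piece of the segment the slope at the left end bounds the increment from below
  and the slope at the right end from above. The two sums differ by the telescoped
  \<open>e N - e 0\<close>.\<close>

lemma rise_bounds:
  assumes p: "p \<in> pts"
  shows "rise g p \<le> f p - f \<theta>0" "f p - f \<theta>0 \<le> rise g p + 2 * \<mu> * D * real d / real N"
proof -
  define \<Delta> where "\<Delta> = (\<lambda>j. (p j - \<theta>0 j) / real N)"
  define e where "e = (\<lambda>k. \<Sum>j<d. g (seg p k) j * \<Delta> j)"
  have R: "seg p k \<in> Rn d" for k using ptsD(1)[OF p] by (rule seg_Rn)
  have df: "seg p (Suc k) j - seg p k j = \<Delta> j" for k j
    by (simp add: seg_def \<Delta>_def add_divide_distrib distrib_right)
  have up: "e k \<le> f (seg p (Suc k)) - f (seg p k)" for k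
    using sub_ineq[OF R[of k] R[of "Suc k"]] by (simp add: df e_def)
  have dn: "f (seg p (Suc k)) - f (seg p k) \<le> e (Suc k)" for k
  proof -
    have "seg p k j - seg p (Suc k) j = - \<Delta> j" for j using df[of k j] by linarith
    then show ?thesis using sub_ineq[OF R[of "Suc k"] R[of k]] by (simp add: e_def sum_negf)
  qed
  have tel: "(\<Sum>k<N. f (seg p (Suc k)) - f (seg p k)) = f p - f \<theta>0"
    using sum_lessThan_telescope[of "\<lambda>k. f (seg p k)" N] by (simp add: seg_N seg_0)
  have ris: "rise g p = (\<Sum>k<N. e k)" by (simp add: rise_def e_def \<Delta>_def)
  show "rise g p \<le> f p - f \<theta>0" unfolding ris tel[symmetric] by (intro sum_mono up)
  have \<Delta>: "\<bar>\<Delta> j\<bar> \<le> D / real N" if "j < d" for j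
    using ptsD(2)[OF p that] N by (simp add: \<Delta>_def divide_right_mono)
  have eb: "\<bar>e k\<bar> \<le> \<mu> * (D / real N) * real d" for k
    unfolding e_def by (rule sum_g_le[OF R \<Delta>])
  have "f p - f \<theta>0 \<le> (\<Sum>k<N. e (Suc k))" unfolding tel[symmetric] by (intro sum_mono dn)
  also have "\<dots> = (\<Sum>k<N. e k) + (e N - e 0)"
    using sum_lessThan_telescope[of e N] by (simp add: sum_subtractf)
  also have "e N - e 0 \<le> 2 * (\<mu> * (D / real N) * real d)" using eb[of N] eb[of 0] by linarith
  finally show "f p - f \<theta>0 \<le> rise g p + 2 * \<mu> * D * real d / real N" by (simp add: ris)
qed

lemma fhat_upper: "y \<in> Rn d \<Longrightarrow> fhat g y \<le> f y - f \<theta>0"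
proof -
  assume y: "y \<in> Rn d"
  note b = best[of g y]
  show ?thesis using rise_bounds(1)[OF b(1)] sub_ineq[OF ptsD(1)[OF b(1)] y] unfolding b(2)[symmetric] tangent_def by linarith
qed

text \<open>Each coordinate of \<open>y\<close> is rounded down to the net. The error
  \<open>\<mu> * D * d / N\<close> occurs four times: once from \<open>y\<close> to the net point,
  twice in \<open>rise_bounds\<close>, once along the tangent back to \<open>y\<close>.\<close>

lemma fhat_lower:
  assumes y: "y \<in> Rn d" "\<And>j. j < d \<Longrightarrow> \<bar>y j - \<theta>0 j\<bar> \<le> D"
  shows "f y - f \<theta>0 \<le> fhat g y + 4 * \<mu> * D * real d / real N"
proof -
  define k where "k = (\<lambda>j. if j < d then \<lfloor>(y j - \<theta>0 j) / D * real N\<rfloor> else undefined)"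
  let ?p = "pt k"
  have k: "- int N \<le> k j" "k j \<le> int N" "\<bar>y j - ?p j\<bar> \<le> D / real N" if j: "j < d" for j
  proof -
    let ?z = "(y j - \<theta>0 j) / D * real N"
    have "\<bar>(y j - \<theta>0 j) / D\<bar> \<le> 1" using y(2)[OF j] D by (simp add: divide_le_eq)
    then have "\<bar>(y j - \<theta>0 j) / D\<bar> * real N \<le> 1 * real N" by (intro mult_right_mono) auto
    then have z: "\<bar>?z\<bar> \<le> real N" by (simp add: abs_mult)
    have kj: "k j = \<lfloor>?z\<rfloor>" using j by (simp add: k_def)
    have "- real N \<le> ?z" "?z \<le> real N" using z unfolding abs_le_iff by linarith+
    then show "- int N \<le> k j" "k j \<le> int N" unfolding kj le_floor_iff floor_le_iff by simp_all
    have "\<bar>?z - real_of_int (k j)\<bar> \<le> 1" unfolding kj by linarith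
    then have "D / real N * \<bar>?z - real_of_int (k j)\<bar> \<le> D / real N * 1" using D N by (intro mult_left_mono) auto
    moreover have "y j - ?p j = D / real N * (?z - real_of_int (k j))"
      using j D N by (simp add: pt_def field_simps)
    ultimately show "\<bar>y j - ?p j\<bar> \<le> D / real N" using D N by (simp add: abs_mult)
  qed
  have p: "?p \<in> pts" unfolding pts_def using k by (intro imageI) (auto simp: PiE_iff k_def extensional_def)
  note pR = ptsD(1)[OF p]
  have "f y + (\<Sum>j<d. g y j * (?p j - y j)) \<le> f ?p" by (rule sub_ineq[OF y(1) pR])
  moreover have "\<bar>\<Sum>j<d. g y j * (?p j - y j)\<bar> \<le> \<mu> * (D / real N) * real d"
    using k(3) by (intro sum_g_le[OF y(1)]) (simp add: abs_minus_commute)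
  moreover have "f ?p - f \<theta>0 \<le> rise g ?p + 2 * \<mu> * D * real d / real N" by (rule rise_bounds(2)[OF p])
  moreover have "rise g ?p + (\<Sum>j<d. g ?p j * (y j - ?p j)) \<le> fhat g y" using tangent_le[OF p, of g y] by (simp add: tangent_def)
  moreover have "\<bar>\<Sum>j<d. g ?p j * (y j - ?p j)\<bar> \<le> \<mu> * (D / real N) * real d"
    using k(3) by (intro sum_g_le[OF pR])
  moreover have "4 * \<mu> * D * real d / real N = 4 * (\<mu> * (D / real N) * real d)"
    "2 * \<mu> * D * real d / real N = 2 * (\<mu> * (D / real N) * real d)" by simp_all
  ultimately show ?thesis by linarith
qed

end

end

section \<open>The initial potential and the resulting budget\<close>

lemma (in game) psi_start:
  assumes b: "bodies B" "fat B" and d: "\<And>i u. i \<in> A \<Longrightarrow> u \<in> B i \<Longrightarrow> \<bar>u d\<bar> \<le> 8 * w i"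
    and W: "\<And>i. i \<in> A \<Longrightarrow> w i \<le> W"
  shows "psi B 1 (\<lambda>_ _. 0) \<le> M * (8 + 2 * ln (16 * W))"
proof -
  have "psi B 1 (\<lambda>_ _. 0) \<le> (\<Sum>i\<in>A. (w i)\<^sup>2 * (8 + 2 * ln (16 * W)))"
    unfolding psi_def
  proof (rule sum_mono)
    fix i assume i: "i \<in> A"
    interpret convex_body "I i" "8 * w i" "B i" using b i by (simp add: bodyD)
    let ?\<theta> = "tilt 1 (\<lambda>_ _. 0) i"
    have w: "0 < w i" "1 \<le> w i" using w_pos[OF i] w1[OF i] by auto
    \<comment> \<open>The exponent is \<open>- u d / w i\<close>, hence at most 8, and the body lies
      in a box of side \<open>16 * w i\<close>.\<close>
    have "mass (I i) (B i) ?\<theta> \<le> exp 8 * (2 * (8 * w i)) ^ card (I i)"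
    proof (rule mass_upper)
      fix u assume u: "u \<in> B i"
      have "lin (I i) ?\<theta> u = - u d / w i" unfolding lin_tilt[OF i] by (simp add: lin_def)
      also have "\<dots> \<le> 8 * w i / w i" using d[OF i u] w by (intro divide_right_mono) linarith+
      also have "\<dots> = 8" using w by simp
      finally show "lin (I i) ?\<theta> u \<le> 8" .
    qed (use w in simp)
    then have "ln (mass (I i) (B i) ?\<theta>) \<le> ln (exp 8 * (16 * w i) ^ card (I i))"
      using mass_pos[OF b i, of ?\<theta>] by (intro ln_mono) (auto simp: mult.assoc[symmetric])
    also have "\<dots> = 8 + real (card (I i)) * ln (16 * w i)" using w by (simp add: ln_mult ln_realpow distrib_left)
    also have "\<dots> \<le> 8 * w i + 2 * w i * ln (16 * W)"
    proof (rule add_mono)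
      have "ln (16 * w i) \<le> ln (16 * W)" using w W[OF i] by (intro ln_mono) auto
      moreover have "0 \<le> ln (16 * w i)" using w by (intro ln_ge_zero) linarith
      ultimately show "real (card (I i)) * ln (16 * w i) \<le> 2 * w i * ln (16 * W)"
        using card_I[OF i] w by (intro mult_mono) linarith+
    qed (use w in linarith)
    finally have "ln (mass (I i) (B i) ?\<theta>) \<le> 8 * w i + 2 * w i * ln (16 * W)" .
    then have "w i * ln (mass (I i) (B i) ?\<theta>) \<le> w i * (8 * w i + 2 * w i * ln (16 * W))" using w by (intro mult_left_mono) linarith+
    then show "w i * ln (mass (I i) (B i) ?\<theta>) \<le> (w i)\<^sup>2 * (8 + 2 * ln (16 * W))"
      by (simp add: power2_eq_square algebra_simps)
  qed
  then show ?thesis by (simp add: M_def sum_distrib_right)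
qed

text \<open>The game starts at \<open>t = 1\<close> with the initial boxes. The 21 consists of 16
  from the two initial masses and 5 from the lower bound; the factor 6 bounds
  \<open>1 / ln (6 / 5)\<close>.\<close>

lemma (in game_comm) solvable_start:
  assumes out: "\<And>g x. g \<in> Q \<Longrightarrow> x \<in> cube \<Longrightarrow>
      (\<And>y. y \<in> cube \<Longrightarrow> (\<Sum>i\<in>A. H (g i) x) \<le> (\<Sum>i\<in>A. H (g i) y) + 8 * M / 2 ^ K) \<Longrightarrow> good g (emb x)"
    and adm: "\<And>g i. g \<in> Q \<Longrightarrow> i \<in> A \<Longrightarrow> adm i (H (g i)) (\<Gamma> (g i))"
    and msg: "\<And>g i x. g \<in> Q \<Longrightarrow> i \<in> A \<Longrightarrow> msg i (g i) x \<in> V i"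
    and W: "\<And>i. i \<in> A \<Longrightarrow> w i \<le> W" "1 \<le> W"
  shows "solvable s good Q (6 * (2 * real L + 2) * (M * (21 + 4 * ln (16 * W) + 4 * (real K + 1) * ln 2 + 8 * real K)))"
proof (cases "Q = {}")
  case True
  then show ?thesis by (simp add: solvable_empty)
next
  case False
  then obtain g0 where g0: "g0 \<in> Q" by blast
  have inp: "inputs P0 J0 Q"
    unfolding inputs_def valid_def
    using adm msg by (auto simp: epi_def conj_epi_def P0_def J0_def I_def)
  then have v: "valid P0 J0 (\<lambda>i. H (g0 i)) (\<lambda>i. \<Gamma> (g0 i))" using g0 by (simp add: inputs_def)
  define \<phi> where "\<phi> = 2 * (M * (8 + 2 * ln (16 * W)))"
  define c where "c = ln (6 / 5 :: real)"
  define LB where "LB = - 5 * M - 4 * M * (real K + 1) * ln 2"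
  have "psi P0 1 (\<lambda>_ _. 0) \<le> M * (8 + 2 * ln (16 * W))"
    by (rule psi_start[OF bodies0(1) valid_fat(1)[OF v] _ W(1)]) (auto simp: P0_def I_def)
  moreover have "psi J0 1 (\<lambda>_ _. 0) \<le> M * (8 + 2 * ln (16 * W))"
    by (rule psi_start[OF bodies0(2) valid_fat(2)[OF v] _ W(1)]) (auto simp: J0_def I_def)
  ultimately have pot: "psi P0 (2 ^ 0) (\<lambda>_ _. 0) + psi J0 (2 ^ 0) (\<lambda>_ _. 0) \<le> \<phi>" by (simp add: \<phi>_def)
  obtain n :: nat where n: "(\<phi> - LB + 8 * M * real (K - 0)) / c + real (K - 0) < real n"
    using reals_Archimedean2 by blast
  have bal0: "(\<lambda>_ _. 0) \<in> bal" by (simp add: bal_def)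
  have "solvable s good Q ((2 * real L + 2) / c * (\<phi> - LB + 8 * M * real (K - 0)))"
    unfolding c_def LB_def
    by (rule solvable_game[where emb = emb, OF _ bodies0 subset_refl inp bal0 zero_cube pot le0 n[unfolded c_def LB_def]])
      (rule out)
  then show ?thesis
  proof (rule solvable_mono)
    have M0: "0 \<le> M" by (simp add: M_def sum_nonneg)
    have "ln (5 / 6 :: real) \<le> 5 / 6 - 1" by (rule ln_le_minus_one) simp
    then have "1 / 6 \<le> c" using ln_inverse[of "6 / 5 :: real"] by (simp add: c_def)
    then have "1 / c \<le> 6" by (simp add: field_simps)
    have e: "\<phi> - LB + 8 * M * real K = M * (21 + 4 * ln (16 * W) + 4 * (real K + 1) * ln 2 + 8 * real K)"
      by (simp add: \<phi>_def LB_def algebra_simps)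
    have "0 \<le> ln (16 * W)" using W(2) by (intro ln_ge_zero) linarith
    then have "0 \<le> \<phi> - LB + 8 * M * real K" unfolding e using M0 by (intro mult_nonneg_nonneg add_nonneg_nonneg) auto
    then have "1 / c * ((2 * real L + 2) * (\<phi> - LB + 8 * M * real K)) \<le> 6 * ((2 * real L + 2) * (\<phi> - LB + 8 * M * real K))"
      using \<open>1 / c \<le> 6\<close> by (intro mult_right_mono mult_nonneg_nonneg) auto
    then show "(2 * real L + 2) / c * (\<phi> - LB + 8 * M * real (K - 0))
      \<le> 6 * (2 * real L + 2) * (M * (21 + 4 * ln (16 * W) + 4 * (real K + 1) * ln 2 + 8 * real K))"
      unfolding e[symmetric] mult.assoc[of 6] by simp
  qed
qed

text \<open>The game needs public coordinate sets. Fixing the announced values one machine after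
  another leaves one subproblem for each choice \<open>T\<close>.\<close>

lemma solvable_announce:
  assumes "finite A" "finite G" "A \<subseteq> {..<s}" "determined_on G m"
    and "\<And>i. i \<in> A \<Longrightarrow> finite (V i)" "\<And>i. i \<in> A \<Longrightarrow> card (V i) \<le> 2 ^ k i"
    and "\<And>g i. g \<in> Q \<Longrightarrow> i \<in> A \<Longrightarrow> m (g i) \<in> V i"
    and "\<And>T. solvable s good {g \<in> Q. \<forall>i\<in>A. m (g i) = T i} b"
  shows "solvable s good Q (b + (\<Sum>i\<in>A. real (k i)))"
  using assms
proof (induction A arbitrary: Q rule: finite_induct)
  case empty
  then show ?case by simp
next
  case (insert i A)
  have "solvable s good Q ((b + (\<Sum>i\<in>A. real (k i))) + real (k i))"
  proof (rule solvable_message[OF insert.prems(1,3), where i = i and V = "V i"])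
    fix v assume "v \<in> V i"
    show "solvable s good {g \<in> Q. m (g i) = v} (b + (\<Sum>i\<in>A. real (k i)))"
    proof (rule insert.IH)
      fix T
      have "{g \<in> {g \<in> Q. m (g i) = v}. \<forall>i\<in>A. m (g i) = T i} = {g \<in> Q. \<forall>l\<in>insert i A. m (g l) = (T(i := v)) l}"
        using insert.hyps(2) by auto
      then show "solvable s good {g \<in> {g \<in> Q. m (g i) = v}. \<forall>i\<in>A. m (g i) = T i} b"
        using insert.prems(7)[of "T(i := v)"] by simp
    qed (use insert.prems(1-6) in blast)+
  qed (use insert.prems(2,4,5,6) in blast)+
  then show ?case using insert.hyps by (simp add: ac_simps)
qed

text \<open>A small set is listed by a function on \<open>{..<n}\<close>, with \<open>d\<close> as
  the padding value.\<close>

lemma card_small_subsets: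
  "finite {U. U \<subseteq> {..<d} \<and> card U \<le> n}" "card {U. U \<subseteq> {..<d :: nat} \<and> card U \<le> n} \<le> (d + 1) ^ n"
proof -
  let ?F = "{..<n} \<rightarrow>\<^sub>E {..d}"
  have sub: "{U. U \<subseteq> {..<d} \<and> card U \<le> n} \<subseteq> (\<lambda>f. f ` {..<n} \<inter> {..<d}) ` ?F"
  proof
    fix U assume "U \<in> {U. U \<subseteq> {..<d} \<and> card U \<le> n}"
    then have U: "U \<subseteq> {..<d}" "card U \<le> n" by auto
    then have fU: "finite U" using finite_subset by blast
    obtain h where h: "bij_betw h {0..<card U} U" using ex_bij_betw_nat_finite[OF fU] by blast
    define f where "f = (\<lambda>k. if k < card U then h k else if k < n then d else undefined)"
    have hk: "h k \<in> U" if "k < card U" for k using h that by (auto simp: bij_betw_def)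
    have "f k \<le> d" if "k < n" for k using hk[of k] U(1) that by (auto simp: f_def)
    then have "f \<in> ?F" using U(2) by (auto simp: PiE_iff extensional_def f_def)
    moreover have "f ` {..<n} \<inter> {..<d} = U"
    proof
      show "f ` {..<n} \<inter> {..<d} \<subseteq> U" using hk by (auto simp: f_def split: if_splits)
      show "U \<subseteq> f ` {..<n} \<inter> {..<d}"
      proof
        fix u assume u: "u \<in> U"
        then have "u \<in> h ` {0..<card U}" using bij_betw_imp_surj_on[OF h] by simp
        then obtain k where "k < card U" "u = h k" by auto
        then have "u = f k" "k < n" using U(2) by (auto simp: f_def)
        then show "u \<in> f ` {..<n} \<inter> {..<d}" using U(1) u by blast
      qed
    qed
    ultimately show "U \<in> (\<lambda>f. f ` {..<n} \<inter> {..<d}) ` ?F" by blast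
  qed
  have fin: "finite ?F" by (intro finite_PiE) auto
  show "finite {U. U \<subseteq> {..<d} \<and> card U \<le> n}" by (rule finite_subset[OF sub]) (use fin in simp)
  have "card {U. U \<subseteq> {..<d} \<and> card U \<le> n} \<le> card ?F"
    using card_mono[OF _ sub] card_image_le[OF fin, of "\<lambda>f. f ` {..<n} \<inter> {..<d}"] fin by simp
  also have "card ?F = (d + 1) ^ n" by (simp add: card_PiE)
  finally show "card {U. U \<subseteq> {..<d} \<and> card U \<le> n} \<le> (d + 1) ^ n" .
qed

definition messages :: "nat \<Rightarrow> real \<Rightarrow> nat set \<Rightarrow> vec set" where
  "messages L \<mu> T = (\<lambda>f j. if j \<in> T then f j / \<mu> else 0) ` (T \<rightarrow>\<^sub>E {r. fixed_point L r})"

lemma card_messages: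
  assumes "finite T"
  shows "finite (messages L \<mu> T)" "card (messages L \<mu> T) \<le> 2 ^ ((2 * L + 1) * card T)"
proof -
  let ?F = "T \<rightarrow>\<^sub>E {r. fixed_point L r}"
  have fin: "finite ?F" using assms card_fixed_point(1) by (intro finite_PiE)
  then show "finite (messages L \<mu> T)" by (simp add: messages_def)
  have "card (messages L \<mu> T) \<le> card ?F" unfolding messages_def by (rule card_image_le[OF fin])
  also have "\<dots> = card {r. fixed_point L r} ^ card T" using assms by (simp add: card_PiE)
  also have "\<dots> \<le> (2 ^ (2 * L + 1)) ^ card T" by (intro power_mono card_fixed_point(2)) simp
  finally show "card (messages L \<mu> T) \<le> 2 ^ ((2 * L + 1) * card T)" by (simp only: power_mult)
qed

section \<open>The rebuilt functions as inputs of the game\<close>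

context net
begin

text \<open>These coordinates can be read off finitely many answers, and they lie in every set of
  coordinates on which the function depends.\<close>

definition supp :: "(vec \<Rightarrow> vec) \<Rightarrow> nat set" where
  "supp g = {j. j < d \<and> (\<exists>p\<in>pts. g p j \<noteq> 0)}"

lemma determined_supp: "determined_on queries supp"
  unfolding determined_on_def
proof (intro allI impI)
  fix g g' :: "vec \<Rightarrow> vec" assume "\<forall>x\<in>queries. g x = g' x"
  then have "g p = g' p" if "p \<in> pts" for p using pts_queries[OF that] by blast
  then show "supp g = supp g'" by (simp add: supp_def)
qed

lemma sum_supp: "p \<in> pts \<Longrightarrow> (\<Sum>j<d. g p j * z j) = (\<Sum>j\<in>supp g. g p j * z j)"
  by (rule sum.mono_neutral_right) (auto simp: supp_def)

lemma emb_Rn: "(\<And>j. d \<le> j \<Longrightarrow> u j = 0) \<Longrightarrow> emb u \<in> Rn d"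
  using \<theta>0 by (simp add: Rn_iff emb_def)

text \<open>The tangent selected by \<open>best\<close> touches the maximum at \<open>emb x\<close>
  and lies below it elsewhere.\<close>

lemma H_tangent: "H g x + lin (supp g) (Gam g x) (\<lambda>j. y j - x j) \<le> H g y"
proof -
  let ?p = "best g (emb x)"
  have "fhat g (emb x) + (\<Sum>j<d. g ?p j * (emb y j - emb x j)) \<le> fhat g (emb y)"
    using tangent_le[OF best(1)[of g "emb x"], of g "emb y"] tangent_diff[of g ?p "emb y" "emb x"] best(2)[of g "emb x"]
    by linarith
  moreover have "(\<Sum>j<d. g ?p j * (emb y j - emb x j)) = (\<mu> * D) * lin (supp g) (Gam g x) (\<lambda>j. y j - x j)"
    unfolding sum_supp[OF best(1)[of g "emb x"], of g] lin_def sum_distrib_left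
    using \<mu> by (intro sum.cong) (simp_all add: Gam_def emb_def right_diff_distrib)
  ultimately have "(fhat g (emb x) + (\<mu> * D) * lin (supp g) (Gam g x) (\<lambda>j. y j - x j)) / (\<mu> * D) \<le> fhat g (emb y) / (\<mu> * D)"
    using \<mu> D by (intro divide_right_mono) auto
  then show ?thesis using \<mu> D by (simp add: H_def add_divide_distrib)
qed

lemma Gam_bound:
  assumes "lipschitz_fun d \<mu> f" "\<And>x. x \<in> Rn d \<Longrightarrow> subgradient d f x (g x)" "j < d"
  shows "\<bar>Gam g x j\<bar> \<le> 1"
  using g_bound[OF assms(1,2) ptsD(1)[OF best(1)] assms(3)] \<mu> by (simp add: Gam_def divide_le_eq)

text \<open>Tangents with underestimated heights never exceed the increment of \<open>f\<close>; the
  converse estimate needs a point of the cube, which the net covers.\<close>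

lemma H_bounds:
  assumes "lipschitz_fun d \<mu> f" "\<And>x. x \<in> Rn d \<Longrightarrow> subgradient d f x (g x)" "\<And>j. d \<le> j \<Longrightarrow> u j = 0"
  shows "\<mu> * D * H g u \<le> f (emb u) - f \<theta>0"
    and "(\<And>j. j < d \<Longrightarrow> \<bar>u j\<bar> \<le> 1) \<Longrightarrow> f (emb u) - f \<theta>0 \<le> \<mu> * D * (H g u + 4 * real d / real N)"
proof -
  note R = emb_Rn[OF assms(3)]
  have H: "\<mu> * D * H g u = fhat g (emb u)" using \<mu> D by (simp add: H_def)
  show "\<mu> * D * H g u \<le> f (emb u) - f \<theta>0" unfolding H by (rule fhat_upper[OF assms(1,2) R])
  assume u: "\<And>j. j < d \<Longrightarrow> \<bar>u j\<bar> \<le> 1"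
  have "\<bar>emb u j - \<theta>0 j\<bar> \<le> D" if "j < d" for j
    using mult_left_mono[OF u[OF that], of D] D by (simp add: emb_def abs_mult)
  from fhat_lower[OF assms(1,2) R this]
  show "f (emb u) - f \<theta>0 \<le> \<mu> * D * (H g u + 4 * real d / real N)" unfolding distrib_left H by (simp add: ac_simps)
qed

text \<open>At the base point the rebuilt function lies between \<open>- 4 * d / N\<close> and 0,
  whence the demand \<open>4 * d \<le> N\<close>.\<close>

lemma H_zero:
  assumes "lipschitz_fun d \<mu> f" "\<And>x. x \<in> Rn d \<Longrightarrow> subgradient d f x (g x)" "4 * d \<le> N"
  shows "\<bar>H g (\<lambda>_. 0)\<bar> \<le> 1"
proof -
  have e: "emb (\<lambda>_. 0) = \<theta>0" by (simp add: emb_def)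
  have pos: "0 < \<mu> * D" using \<mu> D by simp
  have "\<mu> * D * H g (\<lambda>_. 0) \<le> 0" using H_bounds(1)[OF assms(1,2), of "\<lambda>_. 0"] by (simp add: e)
  then have "H g (\<lambda>_. 0) \<le> 0" using mult_le_cancel_left_pos[OF pos, of _ 0] by simp
  moreover have "0 \<le> \<mu> * D * (H g (\<lambda>_. 0) + 4 * real d / real N)" using H_bounds(2)[OF assms(1,2), of "\<lambda>_. 0"] by (simp add: e)
  then have "0 \<le> H g (\<lambda>_. 0) + 4 * real d / real N" using mult_le_cancel_left_pos[OF pos, of 0] by simp
  moreover have "4 * real d / real N \<le> 1" using assms(3) N by (simp add: divide_le_eq)
  ultimately show ?thesis by (simp add: abs_le_iff)
qed

end

text \<open>All additive constants are absorbed by \<open>l\<close>, which is at least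
  \<open>ln 2\<close> because \<open>\<epsilon> < s\<close> and \<open>2 \<le> d\<close>. The
  estimate \<open>2 / 3 \<le> ln 2\<close> also yields \<open>log 2 x \<le> 3 / 2 * ln x\<close>,
  and the 1 lost by rounding up is at most \<open>3 / 2 * l\<close>.\<close>

lemma ln_estimates:
  fixes s d :: nat and \<epsilon> :: real
  assumes s: "0 < s" and d: "2 \<le> d" and \<epsilon>: "0 < \<epsilon>" "\<epsilon> < real s"
  defines "l \<equiv> ln (real s * real d / \<epsilon>)"
  shows "2 / 3 \<le> l" "ln (real d) \<le> l" "ln (16 * real d) \<le> 5 * l"
    "real (nat \<lceil>log 2 (16 * real s * (real d)\<^sup>2 / \<epsilon>)\<rceil>) \<le> 21 / 2 * l"
    "real (nat \<lceil>log 2 (real d + 1)\<rceil>) \<le> 9 / 2 * l"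
proof -
  have l2: "2 / 3 \<le> ln (2 :: real)" by (rule ln2_ge_two_thirds)
  have ld: "ln 2 \<le> ln (real d)" using d by (intro ln_mono) auto
  have "real d \<le> real s * real d / \<epsilon>" using \<epsilon> d by (simp add: pos_le_divide_eq mult.commute mult_right_mono)
  then show dl: "ln (real d) \<le> l" unfolding l_def using d by (intro ln_mono) auto
  show ll: "2 / 3 \<le> l" using l2 ld dl by linarith
  have l16: "ln (16 :: real) = 4 * ln 2" using ln_realpow[of "2::real" 4] by simp
  have "ln (16 * real d) = 4 * ln 2 + ln (real d)" using d by (simp add: ln_mult l16)
  then show "ln (16 * real d) \<le> 5 * l" using ld dl by linarith
  let ?z = "16 * real s * (real d)\<^sup>2 / \<epsilon>"
  have z: "?z = 16 * real d * (real s * real d / \<epsilon>)" by (simp add: power2_eq_square)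
  have pos: "0 < real s * real d / \<epsilon>" using s d \<epsilon> by simp
  have "ln ?z = ln (16 * real d) + l" unfolding z l_def using d pos by (intro ln_mult_pos) auto
  then have lz: "ln ?z \<le> 6 * l" using \<open>ln (16 * real d) \<le> 5 * l\<close> by linarith
  have lg: "log 2 x \<le> 3 / 2 * ln x" if "1 \<le> x" for x :: real
  proof -
    have "ln x * (2 / 3) \<le> ln x * ln 2" using that l2 by (intro mult_left_mono) auto
    then have "ln x \<le> 3 / 2 * ln x * ln 2" by linarith
    then show ?thesis by (simp add: log_def pos_divide_le_eq)
  qed
  have "1 * 1 \<le> 16 * real d * (real s * real d / \<epsilon>)"
    using \<open>real d \<le> real s * real d / \<epsilon>\<close> d by (intro mult_mono) linarith+
  then have z1: "1 \<le> ?z" unfolding z by linarith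
  then have "0 \<le> ln ?z" by (rule ln_ge_zero)
  then have "0 \<le> log 2 ?z" by (simp add: log_def)
  moreover have "log 2 ?z \<le> 9 * l" using lg[OF z1] lz by linarith
  ultimately have "real (nat \<lceil>log 2 ?z\<rceil>) \<le> 9 * l + 1" by linarith
  then show "real (nat \<lceil>log 2 ?z\<rceil>) \<le> 21 / 2 * l" using ll by linarith
  have "2 * real d \<le> real d * real d" using d by (intro mult_right_mono) auto
  then have "real d + 1 \<le> real d * real d" using d by linarith
  then have "ln (real d + 1) \<le> ln (real d * real d)" by (intro ln_mono) auto
  also have "\<dots> = 2 * ln (real d)" using d by (simp add: ln_mult)
  finally have "log 2 (real d + 1) \<le> 3 * l" using lg[of "real d + 1"] dl by simp
  then have "real (nat \<lceil>log 2 (real d + 1)\<rceil>) \<le> 3 * l + 1" using ll by linarith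
  then show "real (nat \<lceil>log 2 (real d + 1)\<rceil>) \<le> 9 / 2 * l" using ll by linarith
qed

text \<open>The 184 rounds up \<open>(21 + 4) * 3 / 2 + 4 * 5 + 4 * 21 / 2 + 8 * 21 / 2\<close>.
  With \<open>24 * 184 = 4416\<close> and \<open>9 / 2\<close> for the announcements the total stays
  below 4500.\<close>

lemma bit_count:
  fixes A :: "nat set" and n :: "nat \<Rightarrow> nat" and l :: real
  assumes "finite A" and n: "\<And>i. i \<in> A \<Longrightarrow> 0 < n i" and L: "1 \<le> L" and l: "2 / 3 \<le> l"
    and k: "real k \<le> 9 / 2 * l" and K: "real K \<le> 21 / 2 * l" and d: "ln (16 * real d) \<le> 5 * l"
  shows "6 * (2 * real L + 2) * ((\<Sum>i\<in>A. (real (n i))\<^sup>2) * (21 + 4 * ln (16 * real d) + 4 * (real K + 1) * ln 2 + 8 * real K))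
    + (\<Sum>i\<in>A. real (n i * k)) \<le> 4500 * ((\<Sum>i\<in>A. (real (n i))\<^sup>2) * l * real L)"
proof -
  let ?M = "\<Sum>i\<in>A. (real (n i))\<^sup>2"
  have M0: "0 \<le> ?M" by (simp add: sum_nonneg)
  have "(real K + 1) * ln 2 \<le> (real K + 1) * 1" using ln_le_minus_one[of "2::real"] by (intro mult_left_mono) auto
  then have v: "(real K + 1) * ln 2 \<le> real K + 1" by simp
  have "21 + 4 * a + 4 * v + 8 * b \<le> 184 * l" if "a \<le> 5 * l" "v \<le> b + 1" "b \<le> 21 / 2 * l" for a v b
    using that l by linarith
  from this[OF d v K]
  have "21 + 4 * ln (16 * real d) + 4 * (real K + 1) * ln 2 + 8 * real K \<le> 184 * l" by (simp only: mult.assoc)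
  then have 1: "?M * (21 + 4 * ln (16 * real d) + 4 * (real K + 1) * ln 2 + 8 * real K) \<le> ?M * (184 * l)"
    using M0 by (rule mult_left_mono)
  have "6 * (2 * real L + 2) \<le> 24 * real L" using L by simp
  moreover have "0 \<le> ?M * (184 * l)" using M0 l by (intro mult_nonneg_nonneg) linarith+
  ultimately have "6 * (2 * real L + 2) * (?M * (184 * l)) \<le> 24 * real L * (?M * (184 * l))"
    by (rule mult_right_mono)
  moreover have "6 * (2 * real L + 2) * (?M * (21 + 4 * ln (16 * real d) + 4 * (real K + 1) * ln 2 + 8 * real K))
      \<le> 6 * (2 * real L + 2) * (?M * (184 * l))"
    using 1 by (rule mult_left_mono) simp
  moreover have "(\<Sum>i\<in>A. real (n i * k)) \<le> ?M * (9 / 2 * l) * real L"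
  proof -
    have "(\<Sum>i\<in>A. real (n i * k)) = (\<Sum>i\<in>A. real (n i)) * real k" by (simp add: sum_distrib_right)
    also have "\<dots> \<le> ?M * (9 / 2 * l)"
    proof (intro mult_mono k sum_mono M0)
      fix i assume "i \<in> A"
      then have "1 \<le> real (n i)" using n by fastforce
      then show "real (n i) \<le> (real (n i))\<^sup>2" by (simp add: power2_eq_square)
    qed simp
    also have "\<dots> * 1 \<le> ?M * (9 / 2 * l) * real L" using M0 l L by (intro mult_left_mono) auto
    finally show ?thesis by simp
  qed
  moreover have "24 * real L * (?M * (184 * l)) + ?M * (9 / 2 * l) * real L = (4416 + 9 / 2) * (?M * l * real L)"
    by (simp add: algebra_simps)
  moreover have "(4416 + 9 / 2) * (?M * l * real L) \<le> 4500 * (?M * l * real L)" using M0 l by (intro mult_right_mono) auto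
  ultimately show ?thesis by linarith
qed

definition problem :: "nat \<Rightarrow> nat \<Rightarrow> nat \<Rightarrow> (nat \<Rightarrow> nat) \<Rightarrow> real \<Rightarrow> (nat \<Rightarrow> vec \<Rightarrow> real) \<Rightarrow> (nat \<Rightarrow> vec \<Rightarrow> vec) \<Rightarrow> bool" where
  "problem s d L dims \<mu> f g \<longleftrightarrow>
    (\<forall>i<s. convex_fun d (f i) \<and> lipschitz_fun d \<mu> (f i) \<and>
      (\<exists>S\<subseteq>{..<d}. card S = dims i \<and> depends_on d S (f i)) \<and> subgradient_oracle d L (f i) (g i))"

text \<open>The protocol sees only \<open>g\<close>, so its output has to serve every family of
  functions that fits these oracles.\<close>

definition solution :: "nat \<Rightarrow> nat \<Rightarrow> nat \<Rightarrow> (nat \<Rightarrow> nat) \<Rightarrow> real \<Rightarrow> vec \<Rightarrow> real \<Rightarrow> real \<Rightarrow> (nat \<Rightarrow> vec \<Rightarrow> vec) \<Rightarrow> vec \<Rightarrow> bool" where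
  "solution s d L dims \<mu> \<theta>0 D \<epsilon> g \<theta> \<longleftrightarrow> \<theta> \<in> Rn d \<and>
    (\<forall>f \<theta>opt. problem s d L dims \<mu> f g \<longrightarrow> \<theta>opt \<in> Rn d \<longrightarrow> dist2 d \<theta>opt \<theta>0 \<le> D \<longrightarrow>
      (\<Sum>i<s. f i \<theta>) \<le> (\<Sum>i<s. f i \<theta>opt) + \<epsilon> * \<mu> * D)"

lemma problemD:
  assumes "problem s d L dims \<mu> f g" "i < s"
  shows "lipschitz_fun d \<mu> (f i)" "\<exists>S\<subseteq>{..<d}. card S = dims i \<and> depends_on d S (f i)"
    "x \<in> Rn d \<Longrightarrow> subgradient d (f i) x (g i x)" "x \<in> Rn d \<Longrightarrow> j < d \<Longrightarrow> fixed_point L (g i x j)"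
  using assms unfolding problem_def subgradient_oracle_def by blast+

lemma problem_constant:
  assumes "problem s d L dims \<mu> f g" "i < s" "dims i = 0" "x \<in> Rn d" "y \<in> Rn d"
  shows "f i x = f i y"
proof -
  obtain S where S: "S \<subseteq> {..<d}" "card S = dims i" "depends_on d S (f i)" using problemD(2)[OF assms(1,2)] by blast
  then have "S = {}" using assms(3) finite_subset[OF S(1)] by simp
  then have "\<forall>j\<in>S. x j = y j" by simp
  then show ?thesis using S(3) assms(4,5) unfolding depends_on_def by blast
qed

text \<open>Half of \<open>\<epsilon>\<close> is spent on the net and half on the final inverse
  temperature. Machines with \<open>dims i = 0\<close> have constant functions and stay out of the
  game, which gives all participants weight at least 1.\<close>

lemma solvable_problem:
  fixes s d L :: nat and dims :: "nat \<Rightarrow> nat" and \<mu> D \<epsilon> :: real and \<theta>0 :: vec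
  assumes s: "0 < s" and d: "2 \<le> d" and L: "1 \<le> L" and \<epsilon>: "0 < \<epsilon>" "\<epsilon> < real s"
    and \<theta>0: "\<theta>0 \<in> Rn d" and \<mu>: "0 < \<mu>" and D: "0 < D"
  shows "solvable s (solution s d L dims \<mu> \<theta>0 D \<epsilon>) {g. \<exists>f. problem s d L dims \<mu> f g}
    (4500 * ((\<Sum>i<s. (real (dims i))\<^sup>2 * ln (real s * real d / \<epsilon>)) * real L))"
  (is "solvable s ?good ?Q _")
proof (cases "?Q = {}")
  case True
  then show ?thesis by (simp only: solvable_empty)
next
  case False
  let ?rounds = "\<lambda>M K. 6 * (2 * real L + 2) * (M * (21 + 4 * ln (16 * real d) + 4 * (real K + 1) * ln 2 + 8 * real K))"
  define Q where "Q = ?Q"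
  have dimd: "dims i \<le> d" if "i < s" for i
  proof -
    obtain f g where "problem s d L dims \<mu> f g" using False by blast
    from problemD(2)[OF this that] obtain S where "S \<subseteq> {..<d}" "card S = dims i" by blast
    then show ?thesis using card_mono[of "{..<d}" S] by simp
  qed
  define l where "l = ln (real s * real d / \<epsilon>)"
  note est = ln_estimates[OF s d \<epsilon>, folded l_def]
  define A where "A = {i. i < s \<and> 0 < dims i}"
  have finA: "finite A" by (simp add: A_def)
  define M where "M = (\<Sum>i\<in>A. (real (dims i))\<^sup>2)"
  have M_s: "(\<Sum>i<s. (real (dims i))\<^sup>2) = M"
    unfolding M_def A_def by (rule sum.mono_neutral_right) auto
  have M_le: "M \<le> real s * (real d)\<^sup>2"
  proof -
    have "M \<le> (\<Sum>i<s. (real d)\<^sup>2)" unfolding M_s[symmetric] using dimd by (intro sum_mono power_mono) auto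
    then show ?thesis by simp
  qed
  have M0: "0 \<le> M" by (simp add: M_def sum_nonneg)
  \<comment> \<open>The net costs \<open>4 * d / N\<close> per machine, so at most
    \<open>\<epsilon> / 2\<close> over \<open>s\<close> machines.\<close>
  define N where "N = nat \<lceil>8 * real s * real d / \<epsilon>\<rceil>"
  have Nge: "8 * real s * real d / \<epsilon> \<le> real N" unfolding N_def by linarith
  have "4 * real d \<le> 8 * real s * real d / \<epsilon>"
  proof -
    have "\<epsilon> * real d \<le> real s * real d" using \<epsilon> by (intro mult_right_mono) auto
    moreover have "4 * real d * \<epsilon> = 4 * (\<epsilon> * real d)" "8 * real s * real d = 8 * (real s * real d)" "0 \<le> real s * real d"
      by simp_all
    ultimately have "4 * real d * \<epsilon> \<le> 8 * real s * real d" by linarith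
    then show ?thesis using \<epsilon> by (simp only: pos_le_divide_eq)
  qed
  then have N4: "4 * d \<le> N" and N0: "0 < N" using Nge d by linarith+
  interpret net d \<theta>0 D \<mu> N using N0 D \<mu> \<theta>0 by unfold_locales
  \<comment> \<open>As \<open>M\<close> is at most \<open>s * d * d\<close>, this makes
    \<open>8 * M / 2 ^ K\<close> at most \<open>\<epsilon> / 2\<close>.\<close>
  define K where "K = nat \<lceil>log 2 (16 * real s * (real d)\<^sup>2 / \<epsilon>)\<rceil>"
  \<comment> \<open>Bits for one coordinate index or the padding value.\<close>
  define k0 where "k0 = nat \<lceil>log 2 (real d + 1)\<rceil>"
  have K16: "16 * real s * (real d)\<^sup>2 / \<epsilon> \<le> 2 ^ K"
  proof -
    have "0 < 16 * real s * (real d)\<^sup>2 / \<epsilon>" using s d \<epsilon> by simp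
    then have "16 * real s * (real d)\<^sup>2 / \<epsilon> = 2 powr (log 2 (16 * real s * (real d)\<^sup>2 / \<epsilon>))" by simp
    also have "\<dots> \<le> 2 powr (real K)" unfolding K_def by (intro powr_mono) linarith+
    finally show ?thesis by (simp add: powr_realpow)
  qed
  have k0d: "d + 1 \<le> 2 ^ k0"
  proof -
    have "real d + 1 = 2 powr (log 2 (real d + 1))" by simp
    also have "\<dots> \<le> 2 powr (real k0)" unfolding k0_def by (intro powr_mono) linarith+
    finally have "real (d + 1) \<le> real (2 ^ k0)" by (simp add: powr_realpow)
    then show ?thesis unfolding of_nat_le_iff .
  qed
  have MK: "8 * M / 2 ^ K \<le> \<epsilon> / 2"
  proof -
    have "16 * real s * (real d)\<^sup>2 \<le> 2 ^ K * \<epsilon>" using K16 \<epsilon> by (simp add: pos_divide_le_eq)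
    then have "16 * M \<le> 2 ^ K * \<epsilon>" using M_le by linarith
    then show ?thesis by (simp add: divide_le_eq mult.commute)
  qed
  have Nd: "4 * real s * real d / real N \<le> \<epsilon> / 2"
    using Nge N0 \<epsilon> by (simp add: pos_divide_le_eq mult.commute mult.left_commute)
  have suppS: "supp (g i) \<subseteq> S" if g: "problem s d L dims \<mu> f g" "i < s" "depends_on d S (f i)" for f g i S
  proof
    fix j assume "j \<in> supp (g i)"
    then obtain p where p: "p \<in> pts" "g i p j \<noteq> 0" "j < d" by (auto simp: supp_def)
    note R = ptsD(1)[OF p(1)]
    show "j \<in> S" using subgradient_zero[OF g(3) problemD(3)[OF g(1,2) R] R p(3)] p(2) by blast
  qed
  \<comment> \<open>The supports are now fixed. If no oracle is left nothing remains to do;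
    otherwise a surviving one shows that \<open>T i\<close> has at most \<open>dims i\<close>
    elements.\<close>
  have round: "solvable s ?good {g \<in> Q. \<forall>i\<in>A. supp (g i) = T i}
     (?rounds M K)" for T
  proof (cases "{g \<in> Q. \<forall>i\<in>A. supp (g i) = T i} = {}")
    case True
    then show ?thesis by (simp only: solvable_empty)
  next
    case False
    have T: "T i \<subseteq> {..<d}" "card (T i) \<le> dims i" if i: "i \<in> A" for i
    proof -
      obtain f g where g: "problem s d L dims \<mu> f g" "supp (g i) = T i" using False i by (auto simp: Q_def)
      have "i < s" using i by (simp add: A_def)
      from problemD(2)[OF g(1) this] obtain S where S: "S \<subseteq> {..<d}" "card S = dims i" "depends_on d S (f i)" by blast
      have "T i \<subseteq> S" using suppS[OF g(1) \<open>i < s\<close> S(3)] g(2) by simp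
      then show "T i \<subseteq> {..<d}" "card (T i) \<le> dims i"
        using S card_mono[OF finite_subset[OF S(1)], of "T i"] by auto
    qed
    have finT: "finite (T i)" if "i \<in> A" for i using T(1)[OF that] finite_subset by blast
    interpret gm: game_comm A T "\<lambda>i. real (dims i)" d s queries L H Gam "\<lambda>i. messages L \<mu> (T i)"
    proof unfold_locales
      show "finite A" by (rule finA)
      show "T i \<subseteq> {..<d}" if "i \<in> A" for i by (rule T(1)[OF that])
      show "1 \<le> real (dims i)" if "i \<in> A" for i using that by (simp add: A_def)
      show "real (card (T i)) \<le> real (dims i)" if "i \<in> A" for i using T(2)[OF that] by simp
      show "finite queries" by (rule fin_queries)
      show "A \<subseteq> {..<s}" by (auto simp: A_def)
      show "determined_on queries H" "determined_on queries Gam" by (rule determined)+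
      show "finite (messages L \<mu> (T i))" if "i \<in> A" for i by (rule card_messages(1)[OF finT[OF that]])
      show "card (messages L \<mu> (T i)) \<le> 2 ^ ((2 * L + 1) * card (T i))" if "i \<in> A" for i
        by (rule card_messages(2)[OF finT[OF that]])
    qed
    have gmM: "gm.M = M" by (simp add: gm.M_def M_def)
    show ?thesis
      unfolding gmM[symmetric]
    proof (rule gm.solvable_start[where emb = emb])
      fix g i assume g: "g \<in> {g \<in> Q. \<forall>i\<in>A. supp (g i) = T i}" and i: "i \<in> A"
      then obtain f where f: "problem s d L dims \<mu> f g" and sp: "supp (g i) = T i" by (auto simp: Q_def)
      have ilt: "i < s" using i by (simp add: A_def)
      note fl = problemD(1)[OF f ilt] and fs = problemD(3)[OF f ilt]
      show "gm.adm i (H (g i)) (Gam (g i))"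
        unfolding gm.adm_def
      proof (intro conjI allI ballI)
        show "H (g i) x + lin (T i) (Gam (g i) x) (\<lambda>j. y j - x j) \<le> H (g i) y" for x y
          using H_tangent[of "g i" x y] by (simp add: sp)
        show "\<bar>Gam (g i) x j\<bar> \<le> 1" if "j \<in> T i" for x j
          using Gam_bound[OF fl fs] T(1)[OF i] that by blast
        show "\<bar>H (g i) (\<lambda>_. 0)\<bar> \<le> 1" by (rule H_zero[OF fl fs N4])
      qed
      fix x
      let ?p = "best (g i) (emb x)"
      have "fixed_point L (g i ?p j)" if "j \<in> T i" for j
        using problemD(4)[OF f ilt ptsD(1)[OF best(1)]] T(1)[OF i] that by blast
      then show "gm.msg i (g i) x \<in> messages L \<mu> (T i)"
        unfolding messages_def
        by (intro image_eqI[of _ _ "\<lambda>j. if j \<in> T i then g i ?p j else undefined"])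
          (auto simp: gm.msg_def Gam_def fun_eq_iff PiE_iff extensional_def)
    next
      fix g x assume g: "g \<in> {g \<in> Q. \<forall>i\<in>A. supp (g i) = T i}" and x: "x \<in> gm.cube"
        and opt: "\<And>y. y \<in> gm.cube \<Longrightarrow> (\<Sum>i\<in>A. H (g i) x) \<le> (\<Sum>i\<in>A. H (g i) y) + 8 * gm.M / 2 ^ K"
      have xc: "d \<le> j \<Longrightarrow> x j = 0" "j < d \<Longrightarrow> \<bar>x j\<bar> \<le> 1" for j using x by (auto simp: gm.cube_def)
      show "solution s d L dims \<mu> \<theta>0 D \<epsilon> g (emb x)"
        unfolding solution_def
      proof (intro conjI allI impI)
        show R: "emb x \<in> Rn d" by (rule emb_Rn) (rule xc)
        fix f \<theta>opt assume f: "problem s d L dims \<mu> f g" and o: "\<theta>opt \<in> Rn d" and dist: "dist2 d \<theta>opt \<theta>0 \<le> D"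
        define y where "y = (\<lambda>j. (\<theta>opt j - \<theta>0 j) / D)"
        have y0: "d \<le> j \<Longrightarrow> y j = 0" for j using o \<theta>0 by (simp add: y_def Rn_iff)
        have y1: "\<bar>y j\<bar> \<le> 1" if "j < d" for j
          using order_trans[OF abs_diff_le_dist2[OF that] dist] D by (simp add: y_def divide_le_eq)
        have ey: "emb y = \<theta>opt" using D by (simp add: emb_def y_def)
        have yc: "y \<in> gm.cube" using y0 y1 by (simp add: gm.cube_def)
        have "(\<Sum>i\<in>A. f i (emb x) - f i \<theta>0) \<le> (\<Sum>i\<in>A. \<mu> * D * (H (g i) x + 4 * real d / real N))"
        proof (rule sum_mono)
          fix i assume "i \<in> A"
          then have ilt: "i < s" by (simp add: A_def)
          show "f i (emb x) - f i \<theta>0 \<le> \<mu> * D * (H (g i) x + 4 * real d / real N)"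
            by (rule H_bounds(2)[OF problemD(1)[OF f ilt] problemD(3)[OF f ilt] xc])
        qed
        also have "\<dots> = \<mu> * D * ((\<Sum>i\<in>A. H (g i) x) + real (card A) * (4 * real d / real N))"
          by (simp add: sum_distrib_left[symmetric] sum.distrib)
        also have "\<dots> \<le> \<mu> * D * ((\<Sum>i\<in>A. H (g i) y) + \<epsilon>)"
        proof (rule mult_left_mono)
          have "card A \<le> card {..<s}" by (intro card_mono) (auto simp: A_def)
          then have "real (card A) * (4 * real d / real N) \<le> real s * (4 * real d / real N)" by (intro mult_right_mono) auto
          also have "\<dots> \<le> \<epsilon> / 2" using Nd by (simp add: ac_simps)
          finally show "(\<Sum>i\<in>A. H (g i) x) + real (card A) * (4 * real d / real N) \<le> (\<Sum>i\<in>A. H (g i) y) + \<epsilon>"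
            using opt[OF yc] MK unfolding gmM by linarith
        qed (use \<mu> D in simp)
        also have "\<dots> = (\<Sum>i\<in>A. \<mu> * D * H (g i) y) + \<epsilon> * \<mu> * D" by (simp add: sum_distrib_left algebra_simps)
        finally have le1: "(\<Sum>i\<in>A. f i (emb x)) - (\<Sum>i\<in>A. f i \<theta>0) \<le> (\<Sum>i\<in>A. \<mu> * D * H (g i) y) + \<epsilon> * \<mu> * D"
          unfolding sum_subtractf .
        have le2: "(\<Sum>i\<in>A. \<mu> * D * H (g i) y) \<le> (\<Sum>i\<in>A. f i \<theta>opt - f i \<theta>0)"
        proof (rule sum_mono)
          fix i assume "i \<in> A"
          then have ilt: "i < s" by (simp add: A_def)
          have "\<mu> * D * H (g i) y \<le> f i (emb y) - f i \<theta>0"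
            by (rule H_bounds(1)[OF problemD(1)[OF f ilt] problemD(3)[OF f ilt]]) (assumption | rule y0)+
          then show "\<mu> * D * H (g i) y \<le> f i \<theta>opt - f i \<theta>0" by (simp only: ey)
        qed
        from le1 le2[unfolded sum_subtractf] have sA: "(\<Sum>i\<in>A. f i (emb x)) \<le> (\<Sum>i\<in>A. f i \<theta>opt) + \<epsilon> * \<mu> * D"
          by linarith
        have split: "(\<Sum>i<s. z i) = (\<Sum>i\<in>{..<s} - A. z i) + (\<Sum>i\<in>A. z i)" for z :: "nat \<Rightarrow> real"
          by (rule sum.subset_diff) (auto simp: A_def)
        have "(\<Sum>i\<in>{..<s} - A. f i (emb x)) = (\<Sum>i\<in>{..<s} - A. f i \<theta>opt)"
        proof (rule sum.cong)
          fix i assume "i \<in> {..<s} - A"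
          then have "i < s" "dims i = 0" by (auto simp: A_def)
          then show "f i (emb x) = f i \<theta>opt" using R o by (rule problem_constant[OF f])
        qed simp
        then show "(\<Sum>i<s. f i (emb x)) \<le> (\<Sum>i<s. f i \<theta>opt) + \<epsilon> * \<mu> * D"
          unfolding split using sA by linarith
      qed
    next
      show "real (dims i) \<le> real d" if "i \<in> A" for i using dimd that by (simp add: A_def)
      show "1 \<le> real d" using d by simp
    qed
  qed
  have "solvable s ?good Q
     (?rounds M K + (\<Sum>i\<in>A. real (dims i * k0)))"
  proof (rule solvable_announce[OF finA fin_queries _ determined_supp, where V = "\<lambda>i. {U. U \<subseteq> {..<d} \<and> card U \<le> dims i}"])
    show "A \<subseteq> {..<s}" by (auto simp: A_def)
    show "finite {U. U \<subseteq> {..<d} \<and> card U \<le> dims i}" for i by (rule card_small_subsets(1))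
    show "card {U. U \<subseteq> {..<d} \<and> card U \<le> dims i} \<le> 2 ^ (dims i * k0)" for i
    proof -
      have "card {U. U \<subseteq> {..<d} \<and> card U \<le> dims i} \<le> (d + 1) ^ dims i" by (rule card_small_subsets(2))
      also have "\<dots> \<le> (2 ^ k0) ^ dims i" using k0d by (rule power_mono) simp
      finally show ?thesis by (simp only: power_mult[symmetric] mult.commute[of k0])
    qed
    show "supp (g i) \<in> {U. U \<subseteq> {..<d} \<and> card U \<le> dims i}" if "g \<in> Q" "i \<in> A" for g i
    proof -
      obtain f where f: "problem s d L dims \<mu> f g" using \<open>g \<in> Q\<close> by (auto simp: Q_def)
      have "i < s" using \<open>i \<in> A\<close> by (simp add: A_def)
      from problemD(2)[OF f this] obtain S where S: "S \<subseteq> {..<d}" "card S = dims i" "depends_on d S (f i)" by blast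
      then show ?thesis using suppS[OF f \<open>i < s\<close> S(3)] card_mono[OF finite_subset[OF S(1)], of "supp (g i)"] by auto
    qed
    show "solvable s ?good {g \<in> Q. \<forall>i\<in>A. supp (g i) = T i}
     (?rounds M K)" for T by (rule round)
  qed
  then have "solvable s ?good Q (4500 * (M * l * real L))"
  proof (rule solvable_mono)
    show "?rounds M K + (\<Sum>i\<in>A. real (dims i * k0))
      \<le> 4500 * (M * l * real L)"
      unfolding M_def
    proof (rule bit_count[OF finA _ L])
      show "0 < dims i" if "i \<in> A" for i using that by (simp add: A_def)
    qed (use est in \<open>simp_all only: K_def k0_def\<close>)
  qed
  moreover have "(\<Sum>i<s. (real (dims i))\<^sup>2 * l) = M * l" unfolding M_s[symmetric] by (simp add: sum_distrib_right)
  ultimately show ?thesis by (simp add: Q_def l_def)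
qed

lemma solvable_protocol:
  assumes "solvable s good Q b"
  shows "\<exists>P. is_protocol s P \<and> (\<forall>g\<in>Q. \<exists>bs \<theta>. final_blackboard P g bs \<and> real (length bs) \<le> b \<and>
    (\<forall>i. run (g i) (result P i bs) = \<theta>) \<and> good g \<theta>)"
proof -
  obtain tr where tr: "speakers tr \<subseteq> {..<s}" "\<And>g. g \<in> Q \<Longrightarrow> good g (out g tr) \<and> real (cost g tr) \<le> b"
    using assms by (auto simp: solvable_def)
  show ?thesis
  proof (intro exI[of _ "tree_protocol tr"] conjI ballI)
    show "is_protocol s (tree_protocol tr)" by (rule is_protocol_tree[OF tr(1)])
    fix g assume g: "g \<in> Q"
    obtain bs where "final_blackboard (tree_protocol tr) g bs" "length bs = cost g tr"
      "\<forall>i. run (g i) (result (tree_protocol tr) i bs) = out g tr" using tree_protocol_run by blast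
    then show "\<exists>bs \<theta>. final_blackboard (tree_protocol tr) g bs \<and> real (length bs) \<le> b \<and>
      (\<forall>i. run (g i) (result (tree_protocol tr) i bs) = \<theta>) \<and> good g \<theta>"
      using tr(2)[OF g] by (intro exI[of _ bs] exI[of _ "out g tr"]) simp
  qed
qed

text \<open>Here the starting point itself is good enough. For \<open>L = 0\<close> every slope
  entry is an integer of absolute value below 1, so the start minimizes each function. Otherwise the
  Lipschitz bound gives an error of at most \<open>s * \<mu> * D\<close>, which is zero or within
  the allowance.\<close>

lemma solvable_trivial:
  assumes \<theta>0: "\<theta>0 \<in> Rn d" and \<epsilon>: "0 < \<epsilon>" and triv: "L = 0 \<or> \<mu> \<le> 0 \<or> D \<le> 0 \<or> real s \<le> \<epsilon>"
    and s: "0 < s"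
  shows "solvable s (solution s d L dims \<mu> \<theta>0 D \<epsilon>) {g. \<exists>f. problem s d L dims \<mu> f g} 0"
proof (rule solvable_output[where \<theta> = \<theta>0])
  fix g
  show "solution s d L dims \<mu> \<theta>0 D \<epsilon> g \<theta>0"
    unfolding solution_def
  proof (intro conjI allI impI)
    fix f \<theta>opt assume f: "problem s d L dims \<mu> f g" and o: "\<theta>opt \<in> Rn d" and dist: "dist2 d \<theta>opt \<theta>0 \<le> D"
    have D0: "0 \<le> D" using dist unfolding dist2_def by (rule order_trans[OF L2_set_nonneg])
    have \<mu>0: "0 \<le> \<mu>" using problemD(1)[OF f s] by (simp add: lipschitz_fun_def)
    have lip: "f i \<theta>0 \<le> f i \<theta>opt + \<mu> * D" if "i < s" for i
    proof -
      have "\<bar>f i \<theta>opt - f i \<theta>0\<bar> \<le> \<mu> * dist2 d \<theta>opt \<theta>0" using problemD(1)[OF f that] o \<theta>0 by (simp add: lipschitz_fun_def)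
      also have "\<dots> \<le> \<mu> * D" using dist \<mu>0 by (rule mult_left_mono)
      finally show ?thesis by linarith
    qed
    have const: "f i \<theta>0 \<le> f i \<theta>opt" if "i < s" "L = 0" for i
    proof -
      have "g i \<theta>0 j = 0" if "j < d" for j
      proof -
        have "fixed_point 0 (g i \<theta>0 j)" using problemD(4)[OF f \<open>i < s\<close> \<theta>0 that] \<open>L = 0\<close> by simp
        then obtain k where "g i \<theta>0 j = real_of_int k" "\<bar>g i \<theta>0 j\<bar> < 1" by (auto simp: fixed_point_def elim: Ints_cases)
        then show ?thesis by simp
      qed
      then show ?thesis using problemD(3)[OF f that(1) \<theta>0] o by (simp add: subgradient_def)
    qed
    show "(\<Sum>i<s. f i \<theta>0) \<le> (\<Sum>i<s. f i \<theta>opt) + \<epsilon> * \<mu> * D"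
    proof (cases "L = 0")
      case True
      have "(\<Sum>i<s. f i \<theta>0) \<le> (\<Sum>i<s. f i \<theta>opt)" using const True by (intro sum_mono) auto
      moreover have "0 \<le> \<epsilon> * \<mu> * D" using \<epsilon> \<mu>0 D0 by simp
      ultimately show ?thesis by linarith
    next
      case False
      have "(\<Sum>i<s. f i \<theta>0) \<le> (\<Sum>i<s. f i \<theta>opt + \<mu> * D)" using lip by (intro sum_mono) auto
      also have "\<dots> = (\<Sum>i<s. f i \<theta>opt) + real s * (\<mu> * D)" by (simp add: sum.distrib)
      finally have "(\<Sum>i<s. f i \<theta>0) \<le> (\<Sum>i<s. f i \<theta>opt) + real s * (\<mu> * D)" .
      moreover have "real s * (\<mu> * D) \<le> \<epsilon> * (\<mu> * D)"
      proof (cases "real s \<le> \<epsilon>")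
        case True
        then show ?thesis using \<mu>0 D0 by (intro mult_right_mono) auto
      next
        case False
        then have "\<mu> * D = 0" using triv \<open>L \<noteq> 0\<close> \<mu>0 D0 by auto
        then show ?thesis by (simp only: mult_zero_right order_refl)
      qed
      ultimately show ?thesis by (simp only: mult.assoc)
    qed
  qed (rule \<theta>0)
qed simp

theorem theorem1p13:
  fixes c :: real
  shows "\<exists>C::real. \<forall>(s::nat) (d::nat) (L::nat) (dims :: nat \<Rightarrow> nat) (\<mu>::real) (D::real) (\<epsilon>::real) (\<theta>0::vec).
    0 < s \<longrightarrow> 0 < d \<longrightarrow> real L \<le> c * ln (real d) \<longrightarrow> 0 < \<epsilon> \<longrightarrow> \<theta>0 \<in> Rn d \<longrightarrow>
    (\<exists>P. is_protocol s P \<and>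
      (\<forall>(f :: nat \<Rightarrow> vec \<Rightarrow> real) (g :: nat \<Rightarrow> vec \<Rightarrow> vec) (\<theta>opt :: vec).
        (\<forall>i<s. convex_fun d (f i) \<and> lipschitz_fun d \<mu> (f i) \<and>
               (\<exists>S\<subseteq>{..<d}. card S = dims i \<and> depends_on d S (f i)) \<and>
               subgradient_oracle d L (f i) (g i)) \<longrightarrow>
        is_arg_min (\<lambda>\<theta>. \<Sum>i<s. f i \<theta>) (\<lambda>\<theta>. \<theta> \<in> Rn d) \<theta>opt \<longrightarrow>
        dist2 d \<theta>opt \<theta>0 \<le> D \<longrightarrow>
        (\<exists>b \<theta>. final_blackboard P g b \<and>
               real (length b) \<le> C * \<bar>(\<Sum>i<s. (real (dims i))\<^sup>2 * ln (real s * real d / \<epsilon>)) * real L\<bar> \<and>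
               \<theta> \<in> Rn d \<and>
               (\<forall>i<s. run (g i) (result P i b) = \<theta>) \<and>
               (\<Sum>i<s. f i \<theta>) \<le> (\<Sum>i<s. f i \<theta>opt) + \<epsilon> * \<mu> * D)))"
proof (intro exI[of _ 4500] allI impI)
  fix s d L :: nat and dims :: "nat \<Rightarrow> nat" and \<mu> D \<epsilon> :: real and \<theta>0 :: vec
  assume s: "0 < s" and d: "0 < d" and L: "real L \<le> c * ln (real d)" and \<epsilon>: "0 < \<epsilon>" and \<theta>0: "\<theta>0 \<in> Rn d"
  let ?b = "4500 * \<bar>(\<Sum>i<s. (real (dims i))\<^sup>2 * ln (real s * real d / \<epsilon>)) * real L\<bar>"
  have "solvable s (solution s d L dims \<mu> \<theta>0 D \<epsilon>) {g. \<exists>f. problem s d L dims \<mu> f g} ?b"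
  proof (cases "L = 0 \<or> \<mu> \<le> 0 \<or> D \<le> 0 \<or> real s \<le> \<epsilon>")
    case True
    show ?thesis by (rule solvable_mono[OF solvable_trivial[OF \<theta>0 \<epsilon> True s]]) simp
  next
    case False
    then have pos: "1 \<le> L" "0 < \<mu>" "0 < D" "\<epsilon> < real s" by auto
    \<comment> \<open>For \<open>d = 1\<close> the bound on \<open>L\<close> forces
      \<open>L = 0\<close>, which belongs to the first case.\<close>
    have "d \<noteq> 1" using L pos(1) by auto
    then have "2 \<le> d" using d by simp
    from solvable_problem[OF s this pos(1) \<epsilon> pos(4) \<theta>0 pos(2,3)]
    show ?thesis by (rule solvable_mono) simp
  qed
  from solvable_protocol[OF this] obtain P where P: "is_protocol s P"
    and run: "\<forall>g\<in>{g. \<exists>f. problem s d L dims \<mu> f g}. \<exists>bs \<theta>. final_blackboard P g bs \<and> real (length bs) \<le> ?b \<and>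
      (\<forall>i. run (g i) (result P i bs) = \<theta>) \<and> solution s d L dims \<mu> \<theta>0 D \<epsilon> g \<theta>" by (elim exE conjE)
  show "\<exists>P. is_protocol s P \<and>
      (\<forall>(f :: nat \<Rightarrow> vec \<Rightarrow> real) (g :: nat \<Rightarrow> vec \<Rightarrow> vec) (\<theta>opt :: vec).
        (\<forall>i<s. convex_fun d (f i) \<and> lipschitz_fun d \<mu> (f i) \<and>
               (\<exists>S\<subseteq>{..<d}. card S = dims i \<and> depends_on d S (f i)) \<and>
               subgradient_oracle d L (f i) (g i)) \<longrightarrow>
        is_arg_min (\<lambda>\<theta>. \<Sum>i<s. f i \<theta>) (\<lambda>\<theta>. \<theta> \<in> Rn d) \<theta>opt \<longrightarrow>
        dist2 d \<theta>opt \<theta>0 \<le> D \<longrightarrow>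
        (\<exists>b \<theta>. final_blackboard P g b \<and> real (length b) \<le> ?b \<and> \<theta> \<in> Rn d \<and>
               (\<forall>i<s. run (g i) (result P i b) = \<theta>) \<and>
               (\<Sum>i<s. f i \<theta>) \<le> (\<Sum>i<s. f i \<theta>opt) + \<epsilon> * \<mu> * D))"
  proof (rule exI[of _ P], rule conjI[OF P], intro allI impI)
    fix f :: "nat \<Rightarrow> vec \<Rightarrow> real" and g :: "nat \<Rightarrow> vec \<Rightarrow> vec" and \<theta>opt :: vec
    assume "\<forall>i<s. convex_fun d (f i) \<and> lipschitz_fun d \<mu> (f i) \<and>
               (\<exists>S\<subseteq>{..<d}. card S = dims i \<and> depends_on d S (f i)) \<and>
               subgradient_oracle d L (f i) (g i)"
    then have f: "problem s d L dims \<mu> f g" by (simp only: problem_def)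
    assume "is_arg_min (\<lambda>\<theta>. \<Sum>i<s. f i \<theta>) (\<lambda>\<theta>. \<theta> \<in> Rn d) \<theta>opt"
    then have o: "\<theta>opt \<in> Rn d" unfolding is_arg_min_def by (rule conjunct1)
    assume dist: "dist2 d \<theta>opt \<theta>0 \<le> D"
    from f have "g \<in> {g. \<exists>f. problem s d L dims \<mu> f g}" by (intro CollectI exI)
    from bspec[OF run this] obtain bs \<theta> where bs: "final_blackboard P g bs" "real (length bs) \<le> ?b"
      "\<forall>i. run (g i) (result P i bs) = \<theta>" and \<theta>: "solution s d L dims \<mu> \<theta>0 D \<epsilon> g \<theta>" by (elim exE conjE)
    from \<theta> f o dist have "\<theta> \<in> Rn d" "(\<Sum>i<s. f i \<theta>) \<le> (\<Sum>i<s. f i \<theta>opt) + \<epsilon> * \<mu> * D"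
      unfolding solution_def by simp_all
    with bs show "\<exists>b \<theta>. final_blackboard P g b \<and> real (length b) \<le> ?b \<and> \<theta> \<in> Rn d \<and>
               (\<forall>i<s. run (g i) (result P i b) = \<theta>) \<and>
               (\<Sum>i<s. f i \<theta>) \<le> (\<Sum>i<s. f i \<theta>opt) + \<epsilon> * \<mu> * D"
      by (intro exI[of _ bs] exI[of _ \<theta>]) simp
  qed
qed

end
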